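(* Let $\Omega=\{1,\dots,q\}^{\mathbb{Z}^d}$ and let $\Phi$ be a translation-invariant absolutely summable potential on $\Omega$ with Gibbsian specification $\gamma^\Phi$. Consider either a translation-invariant discrete-time Markov process with transition kernel $P$, or a translation-invariant interacting particle system with generator $L$ and Markovian semigroup $(P^L_t)_{t\ge 0}$. Assume that the zero entropy loss condition (defined in the context) holds for this dynamics with a Gibbs measure $\mu$ for $\gamma^\Phi$. Let $\nu_0$ be any translation-invariant probability measure on $\Omega$. Then the set $C$ of all weak limit points, as time tends to infinity, of the sequence $\nu_n:=P^n\nu_0$ (respectively of the trajectory $\nu_t:=P^L_t\nu_0$) contains a translation-invariant Gibbs measure for $\gamma^\Phi$.
   Context: $\Omega=\{1,\dots,q\}^{\mathbb{Z}^d}$ carries the product topology and Borel sigma-algebra; weak convergence of measures is with respect to this topology. For $\omega\in\Omega$ and finite $\Lambda\subset\mathbb{Z}^d$, $\omega_\Lambda$ denotes the restriction to $\Lambda$, and also the cylinder event that the configuration equals $\omega_\Lambda$ on $\Lambda$. Gibbs measures: a translation-invariant absolutely summable potential is a translation-invariant family $\Phi=(\Phi_A)_A$, indexed by finite nonempty $A\subset\mathbb{Z}^d$, of functions $\Phi_A:\Omega\to\mathbb{R}$ with $\Phi_A(\omega)$ depending only on $\omega_A$ and $\Vert\Phi\Vert:=\sum_{A\ni 0}\Vert\Phi_A\Vert_\infty<\infty$. Its Gibbsian specification $\gamma^\Phi$ consists of the kernels $\gamma^\Phi_\Lambda(\omega_\Lambda|\eta)=Z_\Lambda^{\Phi}(\eta)^{-1}\exp(-\sum_{A\cap\Lambda\ne\emptyset}\Phi_A(\omega_\Lambda\eta_{\Lambda^c}))$,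 $\Lambda$ finite, with $Z_\Lambda^\Phi(\eta)$ the normalization; $\mu$ is a Gibbs measure for $\gamma^\Phi$ if $\mu\gamma^\Phi_\Lambda=\mu$ for all finite $\Lambda$ (DLR equation). Relative entropy: for probability measures $\nu,\mu$ on $\Omega$ put $h_\Lambda(\nu|\mu):=\sum_{\omega_\Lambda\in\{1,\dots,q\}^\Lambda}\nu(\omega_\Lambda)\log\frac{\nu(\omega_\Lambda)}{\mu(\omega_\Lambda)}$ and $h(\nu|\mu):=\lim_{\Lambda\uparrow\mathbb{Z}^d}\frac1{|\Lambda|}h_\Lambda(\nu|\mu)$, where $\Lambda$ runs over hypercubes centered at the origin (the limit exists for translation-invariant $\nu$ and translation-invariant Gibbs $\mu$). Dynamics. (i) Discrete time: a time-homogeneous, translation-invariant transition kernel $P(\sigma,\cdot)$ on $\Omega$, continuous in $\sigma$ (with respect to the product topology and weak topology of measures); $P\nu$ denotes the image measure $\int\nu(d\sigma)P(\sigma,\cdot)$. (ii) Continuous time: a translation-invariant interacting particle system with generator (closure of) $$Lf(\eta)=\sum_{\Delta}\int c_\Delta(\eta,d\xi_\Delta)\,[f(\xi_\Delta\eta_{\Delta^c})-f(\eta)],$$ the sum being over finite $\Delta\subset\mathbb{Z}^d$, where each $c_\Delta(\eta,\cdot)$ is a finite measure on $\{1,\dots,q\}^\Delta$ depending continuously on $\eta$. It is well-defined in the sense of Liggett's book: with $c_\Delta:=\sup_\eta c_\Delta(\eta,\{1,\dots,q\}^\Delta)$ one has $\sum_{\Delta\ni 0}c_\Delta<\infty$,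 and $\sum_{\Delta\ni 0}\sum_{u\ne 0}c_\Delta(u)<\infty$, where $c_\Delta(u)$ is the supremum of the total variation distance of $c_\Delta(\eta_1,\cdot)$ and $c_\Delta(\eta_2,\cdot)$ over all $\eta_1,\eta_2$ agreeing off $u$. $(P_t^L)_{t\ge0}$ is the associated Markovian (Feller) semigroup and $P_t^L\nu$ is the law at time $t$ started from $\nu$. Zero entropy loss condition (for the given dynamics, with $\mu$ and $\gamma^\Phi$): $\mu$ is a translation-invariant Gibbs measure for $\gamma^\Phi$ which is time-stationary for the dynamics ($P\mu=\mu$, respectively $P_t^L\mu=\mu$ for all $t$). Moreover, in discrete time: every translation-invariant probability measure $\nu$ with $g_P(\nu|\mu):=h(P\nu|\mu)-h(\nu|\mu)=0$ is a Gibbs measure for $\gamma^\Phi$; in continuous time: every translation-invariant probability measure $\nu$ with $g_L(\nu|\mu):=\lim_{\Lambda\uparrow\mathbb{Z}^d}\frac{1}{|\Lambda|}\frac{d}{dt}\big|_{t=0}h_\Lambda(P_t^L\nu|\mu)=0$ is a Gibbs measure for $\gamma^\Phi$. *)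

theory Defs
  imports "HOL-Probability.Probability"
begin

(* The lattice is int ^ 'd, with d = CARD('d) >= 1. The spin space {1,...,q} is an arbitrary
   (nonempty) finite type 's, q = CARD('s), carrying its discrete topology; thus the topology of
   the function type is the product topology and borel is the Borel sigma-algebra of Omega. *)
type_synonym 'd site = "(int, 'd) vec"
type_synonym ('d, 's) config = "'d site \<Rightarrow> 's"

definition shift :: "int ^ 'd::finite \<Rightarrow> (int ^ 'd \<Rightarrow> 's) \<Rightarrow> (int ^ 'd \<Rightarrow> 's)" where
  "shift u \<omega> = (\<lambda>x. \<omega> (x + u))"

definition prob_measures :: "('d::finite, 's::{finite, discrete_topology}) config measure set" where
  "prob_measures = space (prob_algebra borel)"

definition translation_invariant ::
  "('d::finite, 's::{finite, discrete_topology}) config measure \<Rightarrow> bool" where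
  "translation_invariant \<nu> \<longleftrightarrow> (\<forall>u. distr \<nu> borel (shift u) = \<nu>)"

definition weakly_converges ::
  "('i \<Rightarrow> ('d::finite, 's::{finite, discrete_topology}) config measure) \<Rightarrow>
    ('d, 's) config measure \<Rightarrow> 'i filter \<Rightarrow> bool" where
  "weakly_converges X \<nu> F \<longleftrightarrow>
    (\<forall>f :: ('d, 's) config \<Rightarrow> real. continuous_on UNIV f \<longrightarrow>
      ((\<lambda>i. \<integral>\<omega>. f \<omega> \<partial>X i) \<longlongrightarrow> (\<integral>\<omega>. f \<omega> \<partial>\<nu>)) F)"

(* Used with time index nat (discrete time) and real (continuous time). *)
definition weak_limit_points ::
  "('t::linorder \<Rightarrow> ('d::finite, 's::{finite, discrete_topology}) config measure) \<Rightarrow>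
    ('d, 's) config measure set" where
  "weak_limit_points X = {\<nu> \<in> prob_measures.
     \<exists>\<tau> :: nat \<Rightarrow> 't. filterlim \<tau> at_top sequentially \<and>
       weakly_converges (\<lambda>k. X (\<tau> k)) \<nu> sequentially}"


section \<open>Potentials and Gibbs measures\<close>

(* Only the values at finite nonempty sets are meaningful. *)
type_synonym ('d, 's) potential = "'d site set \<Rightarrow> ('d, 's) config \<Rightarrow> real"

(* Each Phi_A takes finitely many values by locality, so the supremum is a genuine one. *)
definition ti_abs_summable_potential :: "('d::finite, 's::finite) potential \<Rightarrow> bool" where
  "ti_abs_summable_potential \<Phi> \<longleftrightarrow>
    (\<forall>A. finite A \<and> A \<noteq> {} \<longrightarrow>
      (\<forall>\<omega> \<eta>. (\<forall>x\<in>A. \<omega> x = \<eta> x) \<longrightarrow> \<Phi> A \<omega> = \<Phi> A \<eta>)) \<and>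
    (\<forall>A u \<omega>. finite A \<and> A \<noteq> {} \<longrightarrow> \<Phi> ((\<lambda>x. x + u) ` A) \<omega> = \<Phi> A (shift u \<omega>)) \<and>
    (\<lambda>A. SUP \<omega>. \<bar>\<Phi> A \<omega>\<bar>) summable_on {A. finite A \<and> 0 \<in> A}"

definition hamiltonian ::
  "('d::finite, 's::finite) potential \<Rightarrow> 'd site set \<Rightarrow> ('d, 's) config \<Rightarrow> real" where
  "hamiltonian \<Phi> \<Lambda> \<omega> = (\<Sum>\<^sub>\<infinity>A\<in>{A. finite A \<and> A \<inter> \<Lambda> \<noteq> {}}. \<Phi> A \<omega>)"

(* Local configurations on Lambda are the elements of Lambda ->E UNIV, and
   override_on eta xi Lambda is the concatenation xi_Lambda eta_{Lambda^c}. *)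
definition partition_function ::
  "('d::finite, 's::finite) potential \<Rightarrow> 'd site set \<Rightarrow> ('d, 's) config \<Rightarrow> real" where
  "partition_function \<Phi> \<Lambda> \<eta> =
    (\<Sum>\<xi>\<in>\<Lambda> \<rightarrow>\<^sub>E UNIV. exp (- hamiltonian \<Phi> \<Lambda> (override_on \<eta> \<xi> \<Lambda>)))"

definition gibbs_weight ::
  "('d::finite, 's::finite) potential \<Rightarrow> 'd site set \<Rightarrow> ('d, 's) config \<Rightarrow>
    ('d, 's) config \<Rightarrow> real" where
  "gibbs_weight \<Phi> \<Lambda> \<eta> \<xi> =
    exp (- hamiltonian \<Phi> \<Lambda> (override_on \<eta> \<xi> \<Lambda>)) / partition_function \<Phi> \<Lambda> \<eta>"

definition gibbs_kernel ::
  "('d::finite, 's::{finite, discrete_topology}) potential \<Rightarrow> 'd site set \<Rightarrow> ('d, 's) config \<Rightarrow>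
    ('d, 's) config measure" where
  "gibbs_kernel \<Phi> \<Lambda> \<eta> =
    distr (point_measure (\<Lambda> \<rightarrow>\<^sub>E UNIV) (\<lambda>\<xi>. ennreal (gibbs_weight \<Phi> \<Lambda> \<eta> \<xi>)))
      borel (\<lambda>\<xi>. override_on \<eta> \<xi> \<Lambda>)"

definition gibbs_measure ::
  "('d::finite, 's::{finite, discrete_topology}) potential \<Rightarrow> ('d, 's) config measure \<Rightarrow> bool" where
  "gibbs_measure \<Phi> \<mu> \<longleftrightarrow>
    \<mu> \<in> prob_measures \<and> (\<forall>\<Lambda>. finite \<Lambda> \<longrightarrow> \<mu> \<bind> gibbs_kernel \<Phi> \<Lambda> = \<mu>)"


section \<open>Relative entropy\<close>

definition cylinder :: "'d::finite site set \<Rightarrow> ('d, 's) config \<Rightarrow> ('d, 's) config set" where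
  "cylinder \<Lambda> \<xi> = {\<omega>. \<forall>x\<in>\<Lambda>. \<omega> x = \<xi> x}"

(* Summands with nu(xi) = 0 vanish. The convention for mu(xi) = 0 < nu(xi) is irrelevant: the
   reference measure mu is always a Gibbs measure below, and these charge every cylinder. *)
definition local_entropy ::
  "'d::finite site set \<Rightarrow> ('d, 's::{finite, discrete_topology}) config measure \<Rightarrow>
    ('d, 's) config measure \<Rightarrow> real" where
  "local_entropy \<Lambda> \<nu> \<mu> =
    (\<Sum>\<xi>\<in>\<Lambda> \<rightarrow>\<^sub>E UNIV. measure \<nu> (cylinder \<Lambda> \<xi>) *
      ln (measure \<nu> (cylinder \<Lambda> \<xi>) / measure \<mu> (cylinder \<Lambda> \<xi>)))"

definition cube :: "nat \<Rightarrow> (int ^ 'd::finite) set" where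
  "cube n = {x. \<forall>i. \<bar>x $ i\<bar> \<le> int n}"

definition relative_entropy ::
  "('d::finite, 's::{finite, discrete_topology}) config measure \<Rightarrow>
    ('d, 's) config measure \<Rightarrow> real" where
  "relative_entropy \<nu> \<mu> = lim (\<lambda>n. local_entropy (cube n) \<nu> \<mu> / real (card (cube n :: 'd site set)))"


section \<open>Discrete-time dynamics\<close>

definition ti_transition_kernel ::
  "(('d::finite, 's::{finite, discrete_topology}) config \<Rightarrow> ('d, 's) config measure) \<Rightarrow> bool" where
  "ti_transition_kernel P \<longleftrightarrow>
    P \<in> borel \<rightarrow>\<^sub>M prob_algebra borel \<and>
    (\<forall>\<sigma>. weakly_converges P (P \<sigma>) (at \<sigma>)) \<and>
    (\<forall>u \<sigma>. P (shift u \<sigma>) = distr (P \<sigma>) borel (shift u))"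

definition zero_entropy_loss_discrete ::
  "('d::finite, 's::{finite, discrete_topology}) potential \<Rightarrow>
    (('d, 's) config \<Rightarrow> ('d, 's) config measure) \<Rightarrow> ('d, 's) config measure \<Rightarrow> bool" where
  "zero_entropy_loss_discrete \<Phi> P \<mu> \<longleftrightarrow>
    gibbs_measure \<Phi> \<mu> \<and> translation_invariant \<mu> \<and> \<mu> \<bind> P = \<mu> \<and>
    (\<forall>\<nu>\<in>prob_measures. translation_invariant \<nu> \<and>
      relative_entropy (\<nu> \<bind> P) \<mu> - relative_entropy \<nu> \<mu> = 0 \<longrightarrow> gibbs_measure \<Phi> \<nu>)"


section \<open>Interacting particle systems\<close>

(* c Delta eta xi is the mass of the point xi of Delta ->E UNIV under c_Delta(eta, .). *)
type_synonym ('d, 's) rates =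
  "'d site set \<Rightarrow> ('d, 's) config \<Rightarrow> ('d, 's) config \<Rightarrow> real"

definition total_rate :: "('d::finite, 's::finite) rates \<Rightarrow> 'd site set \<Rightarrow> real" where
  "total_rate c \<Delta> = (SUP \<eta>. \<Sum>\<xi>\<in>\<Delta> \<rightarrow>\<^sub>E UNIV. c \<Delta> \<eta> \<xi>)"

definition agree_off :: "'d::finite site \<Rightarrow> (('d, 's) config \<times> ('d, 's) config) set" where
  "agree_off u = {(\<eta>\<^sub>1, \<eta>\<^sub>2). \<forall>x. x \<noteq> u \<longrightarrow> \<eta>\<^sub>1 x = \<eta>\<^sub>2 x}"

(* Total variation as the l1-distance of the mass functions; another normalization would only
   change the following summability condition by a constant factor. *)
definition rate_dependence :: "('d::finite, 's::finite) rates \<Rightarrow> 'd site set \<Rightarrow> 'd site \<Rightarrow> real" where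
  "rate_dependence c \<Delta> u =
    (SUP (\<eta>\<^sub>1, \<eta>\<^sub>2)\<in>agree_off u. \<Sum>\<xi>\<in>\<Delta> \<rightarrow>\<^sub>E UNIV. \<bar>c \<Delta> \<eta>\<^sub>1 \<xi> - c \<Delta> \<eta>\<^sub>2 \<xi>\<bar>)"

(* By continuity and compactness of Omega all suprema involved are finite. *)
definition ti_ips_rates :: "('d::finite, 's::{finite, discrete_topology}) rates \<Rightarrow> bool" where
  "ti_ips_rates c \<longleftrightarrow>
    (\<forall>\<Delta>. finite \<Delta> \<longrightarrow> (\<forall>\<xi>\<in>\<Delta> \<rightarrow>\<^sub>E UNIV.
      (\<forall>\<eta>. 0 \<le> c \<Delta> \<eta> \<xi>) \<and> continuous_on UNIV (\<lambda>\<eta>. c \<Delta> \<eta> \<xi>))) \<and>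
    (\<forall>\<Delta> u \<eta>. finite \<Delta> \<longrightarrow> (\<forall>\<xi>\<in>((\<lambda>x. x + u) ` \<Delta>) \<rightarrow>\<^sub>E UNIV.
      c ((\<lambda>x. x + u) ` \<Delta>) \<eta> \<xi> = c \<Delta> (shift u \<eta>) (shift u \<xi>))) \<and>
    total_rate c summable_on {\<Delta>. finite \<Delta> \<and> 0 \<in> \<Delta>} \<and>
    (\<lambda>(\<Delta>, u). rate_dependence c \<Delta> u) summable_on ({\<Delta>. finite \<Delta> \<and> 0 \<in> \<Delta>} \<times> {u. u \<noteq> 0})"

(* Liggett's space D(X) of continuous functions with summable oscillations, on which the series
   defining the pregenerator converges absolutely and uniformly. *)
definition smooth_functions ::
  "(('d::finite, 's::{finite, discrete_topology}) config \<Rightarrow> real) set" where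
  "smooth_functions = {f. continuous_on UNIV f \<and>
    (\<lambda>x. SUP (\<eta>\<^sub>1, \<eta>\<^sub>2)\<in>agree_off x. \<bar>f \<eta>\<^sub>1 - f \<eta>\<^sub>2\<bar>) summable_on UNIV}"

definition ips_pregenerator ::
  "('d::finite, 's::finite) rates \<Rightarrow> (('d, 's) config \<Rightarrow> real) \<Rightarrow> ('d, 's) config \<Rightarrow> real" where
  "ips_pregenerator c f \<eta> =
    (\<Sum>\<^sub>\<infinity>\<Delta>\<in>{\<Delta>. finite \<Delta>}. \<Sum>\<xi>\<in>\<Delta> \<rightarrow>\<^sub>E UNIV. c \<Delta> \<eta> \<xi> * (f (override_on \<eta> \<xi> \<Delta>) - f \<eta>))"

(* Graph of the closure of the pregenerator in C(Omega) with the supremum norm. *)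
definition ips_generator ::
  "('d::finite, 's::{finite, discrete_topology}) rates \<Rightarrow>
    ((('d, 's) config \<Rightarrow> real) \<times> (('d, 's) config \<Rightarrow> real)) set" where
  "ips_generator c = {(f, g). \<exists>F :: nat \<Rightarrow> ('d, 's) config \<Rightarrow> real. (\<forall>n. F n \<in> smooth_functions) \<and>
     uniform_limit UNIV F f sequentially \<and>
     uniform_limit UNIV (\<lambda>n. ips_pregenerator c (F n)) g sequentially}"

(* Markovian Feller semigroups, given by their transition kernels K t for t >= 0. *)
definition feller_semigroup ::
  "(real \<Rightarrow> ('d::finite, 's::{finite, discrete_topology}) config \<Rightarrow> ('d, 's) config measure) \<Rightarrow>
    bool" where
  "feller_semigroup K \<longleftrightarrow>
    (\<forall>t\<ge>0. K t \<in> borel \<rightarrow>\<^sub>M prob_algebra borel) \<and>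
    (\<forall>\<eta>. K 0 \<eta> = return borel \<eta>) \<and>
    (\<forall>s\<ge>0. \<forall>t\<ge>0. \<forall>\<eta>. K (s + t) \<eta> = K s \<eta> \<bind> K t) \<and>
    (\<forall>f :: ('d, 's) config \<Rightarrow> real. continuous_on UNIV f \<longrightarrow>
      (\<forall>t\<ge>0. continuous_on UNIV (\<lambda>\<eta>. \<integral>\<zeta>. f \<zeta> \<partial>K t \<eta>)) \<and>
      uniform_limit UNIV (\<lambda>t \<eta>. \<integral>\<zeta>. f \<zeta> \<partial>K t \<eta>) f (at_right 0))"

definition semigroup_generator ::
  "(real \<Rightarrow> ('d::finite, 's::{finite, discrete_topology}) config \<Rightarrow> ('d, 's) config measure) \<Rightarrow>
    ((('d, 's) config \<Rightarrow> real) \<times> (('d, 's) config \<Rightarrow> real)) set" where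
  "semigroup_generator K = {(f, g). continuous_on UNIV f \<and> continuous_on UNIV g \<and>
     uniform_limit UNIV (\<lambda>t \<eta>. ((\<integral>\<zeta>. f \<zeta> \<partial>K t \<eta>) - f \<eta>) / t) g (at_right 0)}"

(* By Hille-Yosida the generator determines the semigroup; the semigroup of an interacting particle
   system with rates c is thus the unique K with the following property. *)
definition ips_semigroup ::
  "('d::finite, 's::{finite, discrete_topology}) rates \<Rightarrow>
    (real \<Rightarrow> ('d, 's) config \<Rightarrow> ('d, 's) config measure) \<Rightarrow> bool" where
  "ips_semigroup c K \<longleftrightarrow> feller_semigroup K \<and> semigroup_generator K = ips_generator c"

(* g_L(nu|mu) = g. The right derivative of h_Lambda at time 0 may be -infinity (if mass flows into a
   nu-null cylinder); this then persists in all larger volumes, so that g_L(nu|mu) = -infinity, and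
   the relation holds for no real g. *)
definition has_entropy_loss ::
  "(real \<Rightarrow> ('d::finite, 's::{finite, discrete_topology}) config \<Rightarrow> ('d, 's) config measure) \<Rightarrow>
    ('d, 's) config measure \<Rightarrow> ('d, 's) config measure \<Rightarrow> real \<Rightarrow> bool" where
  "has_entropy_loss K \<nu> \<mu> g \<longleftrightarrow> (\<exists>D :: nat \<Rightarrow> real.
    (\<forall>\<^sub>F n in sequentially.
      ((\<lambda>t. local_entropy (cube n) (\<nu> \<bind> K t) \<mu>) has_real_derivative D n) (at 0 within {0..})) \<and>
    (\<lambda>n. D n / real (card (cube n :: 'd site set))) \<longlonglongrightarrow> g)"

definition zero_entropy_loss_continuous ::
  "('d::finite, 's::{finite, discrete_topology}) potential \<Rightarrow>
    (real \<Rightarrow> ('d, 's) config \<Rightarrow> ('d, 's) config measure) \<Rightarrow> ('d, 's) config measure \<Rightarrow> bool" where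
  "zero_entropy_loss_continuous \<Phi> K \<mu> \<longleftrightarrow>
    gibbs_measure \<Phi> \<mu> \<and> translation_invariant \<mu> \<and> (\<forall>t\<ge>0. \<mu> \<bind> K t = \<mu>) \<and>
    (\<forall>\<nu>\<in>prob_measures. translation_invariant \<nu> \<and> has_entropy_loss K \<nu> \<mu> 0 \<longrightarrow> gibbs_measure \<Phi> \<nu>)"

end

(* Every limit of time averages of the law at time t is stationary, so its relative entropy does
   not change in time; the zero entropy loss condition makes it a Gibbs measure mu. Averaging over
   smaller and smaller sets of times that have positive density and along which the law is nearly
   constant gives translation-invariant measures rho_k converging to a limit point nu of the
   trajectory, and c_k * rho_k <= mu with c_k > 0. A translation-invariant measure dominated in
   this way is again Gibbs: its density with respect to mu is approximated by local functions
   which, by translation invariance, can be moved away from any given finite volume, where the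
   kernels treat them as constants. The Gibbs measures form a weakly closed set, so nu is Gibbs.
   In continuous time the averages run over dyadic times. *)
theory Submission
  imports Defs
begin

section \<open>Local events and the topology of the configuration space\<close>

text \<open>The obstacle is that a limit of time averages need not be a limit point of the
  trajectory: it mixes what the law does at different times. The Gibbs property of the mixture \<mu>
  has to be carried over to a law seen along actual times. A set of times of density c > 0 accounts
  for a part of \<mu>, so its normalised average is at most \<mu> / c. A single time has density
  zero and cannot be reached in one step: the constants c_k may tend to 0, and only closedness of
  the Gibbs measures bridges the last gap. Sets of times on which the law is nearly constant come
  from a pigeonhole: rounding the probabilities of finitely many local events splits the times into
  finitely many classes, and one of these has positive density. As the sets are selected adaptively,
  the averages over all subsets of times must converge together beforehand. Domination enters
  through finite-volume densities: their second moments grow with the volume but stay bounded, which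
  forces them to be Cauchy in L1.\<close>

definition local_on :: "'d::finite site set \<Rightarrow> (('d, 's) config \<Rightarrow> 'b) \<Rightarrow> bool" where
  "local_on \<Gamma> g \<longleftrightarrow> (\<forall>\<omega> \<eta>. (\<forall>x\<in>\<Gamma>. \<omega> x = \<eta> x) \<longrightarrow> g \<omega> = g \<eta>)"

text \<open>These are the clopen events of the compact configuration space. Measures are compared,
  constructed and passed to limits mainly through their values on this countable algebra.\<close>

definition local_sets :: "('d::finite, 's) config set set" where
  "local_sets = {A. \<exists>\<Gamma>. finite \<Gamma> \<and> local_on \<Gamma> (\<lambda>\<omega>. \<omega> \<in> A)}"

lemma local_onD: "local_on \<Gamma> g \<Longrightarrow> (\<And>x. x \<in> \<Gamma> \<Longrightarrow> \<omega> x = \<eta> x) \<Longrightarrow> g \<omega> = g \<eta>"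
  unfolding local_on_def by blast

lemma local_onI: "(\<And>\<omega> \<eta>. (\<And>x. x \<in> \<Gamma> \<Longrightarrow> \<omega> x = \<eta> x) \<Longrightarrow> g \<omega> = g \<eta>) \<Longrightarrow> local_on \<Gamma> g"
  unfolding local_on_def by blast

lemma local_setsI: "finite \<Gamma> \<Longrightarrow> local_on \<Gamma> (\<lambda>\<omega>. \<omega> \<in> A) \<Longrightarrow> A \<in> local_sets"
  unfolding local_sets_def by blast

lemma local_setsE:
  assumes "A \<in> local_sets"
  obtains \<Gamma> where "finite \<Gamma>" "local_on \<Gamma> (\<lambda>\<omega>. \<omega> \<in> A)"
  using assms unfolding local_sets_def by blast

lemma local_on_mono: "local_on \<Gamma> g \<Longrightarrow> \<Gamma> \<subseteq> \<Gamma>' \<Longrightarrow> local_on \<Gamma>' g"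
  by (auto simp: local_on_def)

lemma local_on_compose2: "local_on \<Gamma> g \<Longrightarrow> local_on \<Gamma> h \<Longrightarrow> local_on \<Gamma> (\<lambda>\<omega>. F (g \<omega>) (h \<omega>))"
  unfolding local_on_def by metis

lemma local_on_restrict:
  assumes "local_on \<Gamma> g"
  shows "g (restrict \<omega> \<Gamma>) = g \<omega>"
  by (rule local_onD[OF assms]) auto

lemma local_on_cylinder: "local_on \<Gamma> (\<lambda>\<omega>. \<omega> \<in> cylinder \<Gamma> \<xi>)"
  by (auto simp: local_on_def cylinder_def)

lemma cylinder_local_sets: "finite \<Gamma> \<Longrightarrow> cylinder \<Gamma> \<xi> \<in> local_sets"
  by (rule local_setsI[OF _ local_on_cylinder])

lemma UNIV_local_sets [simp]: "UNIV \<in> local_sets"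
  by (rule local_setsI[of "{}"]) (auto simp: local_on_def)

lemma empty_local_sets [simp]: "{} \<in> local_sets"
  by (rule local_setsI[of "{}"]) (auto simp: local_on_def)

lemma local_sets_binop:
  assumes "A \<in> local_sets" "B \<in> local_sets"
  shows "{\<omega>. F (\<omega> \<in> A) (\<omega> \<in> B)} \<in> local_sets"
proof -
  obtain \<Gamma> where A: "finite \<Gamma>" "local_on \<Gamma> (\<lambda>\<omega>. \<omega> \<in> A)"
    using assms(1) by (rule local_setsE)
  obtain \<Gamma>' where B: "finite \<Gamma>'" "local_on \<Gamma>' (\<lambda>\<omega>. \<omega> \<in> B)"
    using assms(2) by (rule local_setsE)
  have "local_on (\<Gamma> \<union> \<Gamma>') (\<lambda>\<omega>. F (\<omega> \<in> A) (\<omega> \<in> B))"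
    by (rule local_on_compose2[OF local_on_mono[OF A(2) Un_upper1] local_on_mono[OF B(2) Un_upper2]])
  with A B show ?thesis
    by (intro local_setsI[of "\<Gamma> \<union> \<Gamma>'"]) simp_all
qed

lemma local_sets_Int [simp]: "A \<in> local_sets \<Longrightarrow> B \<in> local_sets \<Longrightarrow> A \<inter> B \<in> local_sets"
  using local_sets_binop[of A B "(\<and>)"] by (simp add: Int_def)

lemma local_sets_Un [simp]: "A \<in> local_sets \<Longrightarrow> B \<in> local_sets \<Longrightarrow> A \<union> B \<in> local_sets"
  using local_sets_binop[of A B "(\<or>)"] by (simp add: Un_def)

lemma local_sets_Diff [simp]: "A \<in> local_sets \<Longrightarrow> B \<in> local_sets \<Longrightarrow> A - B \<in> local_sets"
  using local_sets_binop[of A B "\<lambda>p q. p \<and> \<not> q"] by (simp add: set_diff_eq)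

lemma local_sets_shift:
  assumes "A \<in> local_sets"
  shows "shift u -` A \<in> local_sets"
proof -
  obtain \<Gamma> where "finite \<Gamma>" "local_on \<Gamma> (\<lambda>\<omega>. \<omega> \<in> A)"
    using assms by (rule local_setsE)
  then have "finite ((\<lambda>x. x + u) ` \<Gamma>)" "local_on ((\<lambda>x. x + u) ` \<Gamma>) (\<lambda>\<omega>. \<omega> \<in> shift u -` A)"
    by (auto simp: local_on_def shift_def)
  then show ?thesis by (rule local_setsI)
qed

lemma Int_stable_local_sets: "Int_stable local_sets"
  by (auto simp: Int_stable_def)

lemma algebra_local_sets: "algebra UNIV local_sets"
  by (auto simp: algebra_iff_Un Compl_eq_Diff_UNIV)

lemma finite_cube [simp]: "finite (cube n :: (int ^ 'd::finite) set)"
proof (rule finite_imageD[of "vec_nth"])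
  have "vec_nth ` (cube n :: (int ^ 'd) set) \<subseteq> UNIV \<rightarrow>\<^sub>E {- int n..int n}"
    by (auto simp: cube_def abs_le_iff) (metis minus_le_iff)
  then show "finite (vec_nth ` (cube n :: (int ^ 'd) set))"
    by (rule finite_subset) (auto intro!: finite_PiE)
  show "inj_on vec_nth (cube n :: (int ^ 'd) set)"
    by (auto simp: inj_on_def vec_eq_iff)
qed

lemma cube_mono: "m \<le> n \<Longrightarrow> cube m \<subseteq> cube n"
  unfolding cube_def by (auto intro: order_trans[of _ "int m" "int n"])

lemma finite_subset_cube:
  fixes \<Gamma> :: "(int ^ 'd::finite) set"
  assumes "finite \<Gamma>"
  obtains n where "\<Gamma> \<subseteq> cube n"
proof
  \<comment> \<open>Sums of absolute coordinates are a crude bound for each single coordinate;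
    unlike a maximum they also make sense for empty \<open>\<Gamma>\<close>.\<close>
  let ?N = "\<lambda>x::int ^ 'd. \<Sum>i\<in>UNIV. nat \<bar>x $ i\<bar>"
  show "\<Gamma> \<subseteq> cube (\<Sum>x\<in>\<Gamma>. ?N x)"
  proof
    fix x assume "x \<in> \<Gamma>"
    then have "?N x \<le> (\<Sum>x\<in>\<Gamma>. ?N x)"
      using assms by (intro member_le_sum) auto
    moreover have "nat \<bar>x $ i\<bar> \<le> ?N x" for i
      by (intro member_le_sum) auto
    ultimately have "nat \<bar>x $ i\<bar> \<le> (\<Sum>x\<in>\<Gamma>. ?N x)" for i
      by (meson order_trans)
    then show "x \<in> cube (\<Sum>x\<in>\<Gamma>. ?N x)"
      by (auto simp: cube_def nat_le_iff)
  qed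
qed

section \<open>Cylinders, the product topology and compactness\<close>

lemma open_cylinder:
  fixes \<xi> :: "('d::finite, 's::{finite, discrete_topology}) config"
  assumes "finite \<Gamma>"
  shows "open (cylinder \<Gamma> \<xi>)"
proof -
  have "open {f. \<forall>i\<in>\<Gamma>. f (id i) \<in> (\<lambda>i. {\<xi> i}) i}"
    by (rule product_topology_basis'[OF assms]) (rule discrete_topology_class.open_discrete)
  moreover have "{f. \<forall>i\<in>\<Gamma>. f (id i) \<in> (\<lambda>i. {\<xi> i}) i} = cylinder \<Gamma> \<xi>"
    by (auto simp: cylinder_def)
  ultimately show ?thesis by simp
qed

lemma open_local_sets:
  fixes A :: "('d::finite, 's::{finite, discrete_topology}) config set"
  assumes "A \<in> local_sets"
  shows "open A"
proof -
  obtain \<Gamma> where \<Gamma>: "finite \<Gamma>" "local_on \<Gamma> (\<lambda>\<omega>. \<omega> \<in> A)"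
    using assms by (rule local_setsE)
  have "A = (\<Union>\<omega>\<in>A. cylinder \<Gamma> \<omega>)"
  proof safe
    fix \<omega> \<eta> assume "\<omega> \<in> A" "\<eta> \<in> cylinder \<Gamma> \<omega>"
    then show "\<eta> \<in> A" using local_onD[OF \<Gamma>(2), of \<omega> \<eta>] by (auto simp: cylinder_def)
  qed (auto simp: cylinder_def)
  then show ?thesis
    using open_cylinder[OF \<Gamma>(1)] by (metis (no_types, lifting) open_UN)
qed

lemma closed_local_sets:
  fixes A :: "('d::finite, 's::{finite, discrete_topology}) config set"
  assumes "A \<in> local_sets"
  shows "closed A"
  using open_local_sets[of "- A"] assms by (auto simp: Compl_eq_Diff_UNIV closed_def)

lemma borel_local_sets [measurable]:
  fixes A :: "('d::finite, 's::{finite, discrete_topology}) config set"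
  shows "A \<in> local_sets \<Longrightarrow> A \<in> sets borel"
  by (intro borel_open open_local_sets)

text \<open>A basic open set constrains finitely many coordinates, and some cube contains them all.
  Hence cylinders over cubes form a neighbourhood base.\<close>

lemma open_contains_cylinder:
  fixes \<omega> :: "('d::finite, 's::{finite, discrete_topology}) config"
  assumes "open U" "\<omega> \<in> U"
  obtains n where "cylinder (cube n) \<omega> \<subseteq> U"
proof -
  have "openin (product_topology (\<lambda>i. euclidean) UNIV) U"
    using assms(1) by (simp add: open_fun_def)
  from product_topology_open_contains_basis[OF this assms(2)]
  obtain X where X: "\<omega> \<in> (\<Pi>\<^sub>E i\<in>UNIV. X i)" "finite {i. X i \<noteq> UNIV}" "(\<Pi>\<^sub>E i\<in>UNIV. X i) \<subseteq> U"
    by auto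
  obtain n where n: "{i. X i \<noteq> UNIV} \<subseteq> cube n"
    using finite_subset_cube[OF X(2)] .
  have "cylinder (cube n) \<omega> \<subseteq> U"
  proof
    fix \<eta> assume \<eta>: "\<eta> \<in> cylinder (cube n) \<omega>"
    have "\<eta> i \<in> X i" for i
      using X(1) n \<eta> by (cases "i \<in> cube n") (auto simp: cylinder_def PiE_iff)
    then show "\<eta> \<in> U" using X(3) by (auto simp: PiE_iff)
  qed
  then show ?thesis by (rule that)
qed

lemma compact_config: "compact (UNIV :: ('d::finite, 's::{finite, discrete_topology}) config set)"
proof -
  have "compact_space (product_topology (\<lambda>i::'d site. euclidean :: 's topology) UNIV)"
    unfolding compact_space_product_topology by (simp add: compact_space_def finite_imp_compact)
  then show ?thesis
    by (simp add: euclidean_product_topology compact_space_def)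
qed

text \<open>Compactness makes continuity uniform: finitely many cylinders, on each of which
  \<open>f\<close> stays within \<open>e / 2\<close> of its value at the centre, cover the space,
  and the largest of their cubes decides which of them contain a given configuration.\<close>

lemma continuous_config_uniform:
  fixes f :: "('d::finite, 's::{finite, discrete_topology}) config \<Rightarrow> real"
  assumes f: "continuous_on UNIV f" and e: "e > 0"
  obtains n where "\<And>\<omega> \<eta>. (\<And>x. x \<in> cube n \<Longrightarrow> \<omega> x = \<eta> x) \<Longrightarrow> \<bar>f \<omega> - f \<eta>\<bar> < e"
proof -
  have "\<exists>n. \<forall>\<eta>\<in>cylinder (cube n) \<omega>. \<bar>f \<eta> - f \<omega>\<bar> < e / 2" for \<omega>
  proof -
    have "open (f -` ball (f \<omega>) (e / 2))"
      using f by (intro open_vimage) auto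
    moreover have "\<omega> \<in> f -` ball (f \<omega>) (e / 2)" using e by auto
    ultimately obtain n where "cylinder (cube n) \<omega> \<subseteq> f -` ball (f \<omega>) (e / 2)"
      by (rule open_contains_cylinder)
    then show ?thesis by (auto simp: dist_real_def abs_minus_commute intro!: exI[of _ n])
  qed
  then obtain N where N: "\<And>\<omega> \<eta>. \<eta> \<in> cylinder (cube (N \<omega>)) \<omega> \<Longrightarrow> \<bar>f \<eta> - f \<omega>\<bar> < e / 2"
    by metis
  obtain D where D: "finite D" "UNIV \<subseteq> (\<Union>\<omega>\<in>D. cylinder (cube (N \<omega>)) \<omega>)"
  proof (rule compactE_image[OF compact_config, of UNIV "\<lambda>\<omega>. cylinder (cube (N \<omega>)) \<omega>"])
    show "UNIV \<subseteq> (\<Union>\<omega>. cylinder (cube (N \<omega>)) \<omega>)"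
      by (auto simp: cylinder_def)
  qed (auto intro: open_cylinder)
  show ?thesis
  proof (rule that[of "Max (N ` D)"])
    fix \<omega> \<eta> :: "('d, 's) config"
    assume *: "\<And>x. x \<in> cube (Max (N ` D)) \<Longrightarrow> \<omega> x = \<eta> x"
    obtain \<zeta> where \<zeta>: "\<zeta> \<in> D" "\<omega> \<in> cylinder (cube (N \<zeta>)) \<zeta>" using D by auto
    then have "N \<zeta> \<le> Max (N ` D)" using D by auto
    then have "cube (N \<zeta>) \<subseteq> cube (Max (N ` D))" by (rule cube_mono)
    then have "\<omega> x = \<eta> x" if "x \<in> cube (N \<zeta>)" for x
      using * that by blast
    then have "\<eta> \<in> cylinder (cube (N \<zeta>)) \<zeta>"
      using \<zeta>(2) unfolding cylinder_def by simp
    then show "\<bar>f \<omega> - f \<eta>\<bar> < e"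
      using N[OF \<zeta>(2)] N[of \<eta> \<zeta>] by linarith
  qed
qed

text \<open>Countability is the point: an open set is a union of cylinders over cubes, and only
  countably many such cylinders exist, since each cube carries finitely many local
  configurations.\<close>

lemma sets_borel_eq_local_sets:
  "sets (borel :: ('d::finite, 's::{finite, discrete_topology}) config measure) = sigma_sets UNIV local_sets"
proof -
  let ?C = "\<Union>n. cylinder (cube n) ` ((cube n :: 'd site set) \<rightarrow>\<^sub>E (UNIV :: 's set))"
  have C: "?C \<subseteq> local_sets" by (auto intro: cylinder_local_sets)
  have cC: "countable ?C"
    by (intro countable_UN countable_image) (auto intro!: countable_finite finite_PiE)
  have "U \<in> sigma_sets UNIV local_sets" if U: "open U" for U :: "('d, 's) config set"
  proof -
    have "U = \<Union>{c \<in> ?C. c \<subseteq> U}"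
    proof safe
      fix \<omega> assume "\<omega> \<in> U"
      then obtain n where n: "cylinder (cube n) \<omega> \<subseteq> U" using open_contains_cylinder[OF U] by metis
      have eq: "cylinder (cube n) (restrict \<omega> (cube n)) = cylinder (cube n) \<omega>"
        by (auto simp: cylinder_def)
      have *: "cylinder (cube n) \<omega> \<in> ?C"
        unfolding eq[symmetric] by (intro UN_I[of n] imageI) auto
      have mem: "cylinder (cube n) \<omega> \<in> {c \<in> ?C. c \<subseteq> U}"
        by (rule CollectI, rule conjI[OF * n])
      show "\<omega> \<in> \<Union>{c \<in> ?C. c \<subseteq> U}"
        by (rule UnionI[OF mem]) (simp add: cylinder_def)
    qed auto
    moreover have "\<Union>{c \<in> ?C. c \<subseteq> U} \<in> sigma_sets UNIV local_sets"
      using C by (intro sigma_sets_UNION countable_subset[OF _ cC]) (auto intro!: sigma_sets.Basic)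
    ultimately show ?thesis by simp
  qed
  then have "sigma_sets UNIV {S :: ('d, 's) config set. open S} \<subseteq> sigma_sets UNIV local_sets"
    by (intro sigma_sets_mono) auto
  moreover have "sigma_sets UNIV local_sets \<subseteq> sigma_sets UNIV {S :: ('d, 's) config set. open S}"
    by (intro sigma_sets_mono) (auto intro!: sigma_sets.Basic open_local_sets)
  ultimately show ?thesis by (simp add: borel_def)
qed

section \<open>Measures determined by and built from local events\<close>

lemma prob_measures_eqI_local_sets:
  fixes M N :: "('d::finite, 's::{finite, discrete_topology}) config measure"
  assumes M: "M \<in> prob_measures" and N: "N \<in> prob_measures"
    and eq: "\<And>A. A \<in> local_sets \<Longrightarrow> measure M A = measure N A"
  shows "M = N"
proof -
  interpret M: prob_space M using M by (auto simp: prob_measures_def space_prob_algebra)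
  interpret N: prob_space N using N by (auto simp: prob_measures_def space_prob_algebra)
  show ?thesis
    by (rule measure_eqI_generator_eq[OF Int_stable_local_sets, where \<Omega>=UNIV and A="\<lambda>_. UNIV"])
       (use M N in \<open>auto simp: prob_measures_def space_prob_algebra sets_borel_eq_local_sets
          M.emeasure_eq_measure N.emeasure_eq_measure eq\<close>)
qed

text \<open>Finite additivity already implies continuity at the empty set: local events are closed
  in a compact space, so a decreasing sequence of them with empty intersection is empty from some
  index on. This turns limits of probabilities of local events into limit measures.\<close>

lemma extend_local_content:
  fixes m :: "('d::finite, 's::{finite, discrete_topology}) config set \<Rightarrow> real"
  assumes nonneg: "\<And>A. A \<in> local_sets \<Longrightarrow> 0 \<le> m A"
    and add: "\<And>A B. A \<in> local_sets \<Longrightarrow> B \<in> local_sets \<Longrightarrow> A \<inter> B = {} \<Longrightarrow> m (A \<union> B) = m A + m B"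
    and one: "m UNIV = 1"
  obtains M where "M \<in> prob_measures" "\<And>A. A \<in> local_sets \<Longrightarrow> measure M A = m A"
proof -
  interpret algebra UNIV "local_sets :: ('d, 's) config set set" by (rule algebra_local_sets)
  let ?f = "\<lambda>A. ennreal (m A)"
  have m0: "m {} = 0" using add[of "{}" "{}"] by simp
  have "\<exists>\<mu> :: ('d, 's) config set \<Rightarrow> ennreal. (\<forall>s \<in> local_sets. \<mu> s = ?f s) \<and>
      measure_space UNIV (sigma_sets UNIV local_sets) \<mu>"
  proof (rule caratheodory_empty_continuous)
    show "positive local_sets ?f" by (simp add: positive_def m0)
    show "additive local_sets ?f"
      unfolding additive_def
    proof (intro ballI impI)
      fix A B :: "('d, 's) config set"
      assume *: "A \<in> local_sets" "B \<in> local_sets" "A \<inter> B = {}"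
      show "?f (A \<union> B) = ?f A + ?f B"
        unfolding add[OF *] by (rule ennreal_plus[OF nonneg[OF *(1)] nonneg[OF *(2)]])
    qed
  next
    fix A :: "nat \<Rightarrow> ('d, 's) config set"
    assume A: "range A \<subseteq> local_sets" "decseq A" "(\<Inter>i. A i) = {}"
    have "\<exists>i. A i = {}"
    proof (rule ccontr)
      assume nonempty: "\<not> (\<exists>i. A i = {})"
      have "UNIV \<inter> \<Inter>(range A) \<noteq> {}"
      proof (rule compact_imp_fip[OF compact_config])
        fix T assume "T \<in> range A"
        with A(1) have "T \<in> local_sets" by blast
        then show "closed T" by (rule closed_local_sets)
      next
        fix F assume F: "finite F" "F \<subseteq> range A"
        then obtain I where I: "finite I" "F = A ` I" by (meson finite_subset_image)
        obtain k where k: "\<forall>i\<in>I. i \<le> k" using I(1) finite_nat_set_iff_bounded_le by blast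
        have "A k \<subseteq> A i" if "i \<in> I" for i
          using decseqD[OF A(2)] k that by blast
        then have "A k \<subseteq> \<Inter>F" unfolding I(2) by blast
        then show "UNIV \<inter> \<Inter>F \<noteq> {}" using nonempty by blast
      qed
      then show False using A(3) by simp
    qed
    then obtain k where k: "A k = {}" by blast
    have "\<forall>\<^sub>F i in sequentially. ?f (A i) = 0"
    proof (rule eventually_sequentiallyI)
      fix i assume "k \<le> i"
      then have "A i = {}" using decseqD[OF A(2), of k i] k by blast
      then show "?f (A i) = 0" by (simp add: m0)
    qed
    then show "(\<lambda>i. ?f (A i)) \<longlonglongrightarrow> 0"
      by (rule tendsto_eventually)
  qed simp
  then obtain \<mu> :: "('d, 's) config set \<Rightarrow> ennreal"
    where \<mu>: "\<And>s. s \<in> local_sets \<Longrightarrow> \<mu> s = ?f s" "measure_space UNIV (sigma_sets UNIV local_sets) \<mu>"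
    by blast
  define M where "M = measure_of UNIV (local_sets :: ('d, 's) config set set) \<mu>"
  have sM: "sets M = sets borel"
    by (simp add: M_def sets_borel_eq_local_sets)
  have spM: "space M = UNIV" by (simp add: M_def)
  have eM: "emeasure M A = \<mu> A" if "A \<in> sigma_sets UNIV local_sets" for A
    using that \<mu>(2) by (intro emeasure_measure_of[OF M_def]) (auto simp: measure_space_def M_def)
  have eM_local: "emeasure M A = ennreal (m A)" if "A \<in> local_sets" for A
    unfolding eM[OF sigma_sets.Basic[OF that]] by (rule \<mu>(1)[OF that])
  have "prob_space M"
    by (rule prob_spaceI) (unfold spM eM_local[OF UNIV_local_sets] one, simp)
  then have "M \<in> prob_measures" by (simp add: prob_measures_def space_prob_algebra sM)
  moreover have "measure M A = m A" if "A \<in> local_sets" for A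
    unfolding measure_def eM_local[OF that] by (rule enn2real_ennreal[OF nonneg[OF that]])
  ultimately show ?thesis by (rule that)
qed

section \<open>Integrals and weak convergence\<close>

lemma prob_measuresD:
  fixes M :: "('d::finite, 's::{finite, discrete_topology}) config measure"
  assumes "M \<in> prob_measures"
  shows "prob_space M" "sets M = sets borel" "space M = UNIV"
  using assms sets_eq_imp_space_eq[of M borel] unfolding prob_measures_def space_prob_algebra by auto

lemma finite_configs [simp]: "finite \<Gamma> \<Longrightarrow> finite (\<Gamma> \<rightarrow>\<^sub>E (UNIV :: 's::finite set))"
  by (intro finite_PiE) auto

lemma local_on_continuous:
  fixes g :: "('d::finite, 's::{finite, discrete_topology}) config \<Rightarrow> 'b::topological_space"
  assumes "finite \<Gamma>" "local_on \<Gamma> g"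
  shows "continuous_on UNIV g"
proof -
  have "g -` U \<in> local_sets" for U
    using assms(1)
  proof (rule local_setsI)
    show "local_on \<Gamma> (\<lambda>\<omega>. \<omega> \<in> g -` U)"
      unfolding vimage_eq by (rule local_on_compose2[OF assms(2,2), of "\<lambda>x _. x \<in> U"])
  qed
  then show ?thesis
    by (simp add: continuous_on_open_vimage open_local_sets)
qed

lemma continuous_config_integrable:
  fixes f :: "('d::finite, 's::{finite, discrete_topology}) config \<Rightarrow> real"
  assumes M: "M \<in> prob_measures" and f: "continuous_on UNIV f"
  shows "integrable M f"
proof -
  interpret prob_space M by (rule prob_measuresD[OF M])
  have meas: "f \<in> borel_measurable M"
    using borel_measurable_continuous_onI[OF f] prob_measuresD(2)[OF M] measurable_cong_sets by blast
  have "compact (f ` UNIV)"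
    by (rule compact_continuous_image[OF f compact_config])
  then have "bounded (range f)" by (rule compact_imp_bounded)
  then obtain B where "\<And>\<omega>. norm (f \<omega>) \<le> B"
    unfolding bounded_iff by blast
  then show ?thesis
    by (intro integrable_const_bound[of _ B] meas) simp
qed

lemma local_expansion:
  fixes g :: "('d::finite, 's::finite) config \<Rightarrow> real"
  assumes "finite \<Gamma>" "local_on \<Gamma> g"
  shows "g \<omega> = (\<Sum>\<xi>\<in>\<Gamma> \<rightarrow>\<^sub>E UNIV. g \<xi> * indicator (cylinder \<Gamma> \<xi>) \<omega>)"
proof -
  \<comment> \<open>Exactly one local configuration is compatible with \<open>\<omega>\<close>, so
    the sum has a single nonzero indicator.\<close>
  have "\<xi> = restrict \<omega> \<Gamma>" if "\<xi> \<in> \<Gamma> \<rightarrow>\<^sub>E UNIV" "\<omega> \<in> cylinder \<Gamma> \<xi>" for \<xi>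
    using that by (auto simp: cylinder_def fun_eq_iff PiE_def extensional_def)
  then have "(\<Sum>\<xi>\<in>\<Gamma> \<rightarrow>\<^sub>E UNIV. g \<xi> * indicator (cylinder \<Gamma> \<xi>) \<omega>)
      = (\<Sum>\<xi>\<in>{restrict \<omega> \<Gamma>}. g \<xi> * indicator (cylinder \<Gamma> \<xi>) \<omega>)"
    using assms(1) by (intro sum.mono_neutral_right) (auto simp: indicator_def)
  also have "\<dots> = g \<omega>"
    by (simp add: local_on_restrict[OF assms(2)] cylinder_def)
  finally show ?thesis by simp
qed

lemma integral_local:
  fixes g :: "('d::finite, 's::{finite, discrete_topology}) config \<Rightarrow> real"
  assumes M: "M \<in> prob_measures" and g: "finite \<Gamma>" "local_on \<Gamma> g"
  shows "(\<integral>\<omega>. g \<omega> \<partial>M) = (\<Sum>\<xi>\<in>\<Gamma> \<rightarrow>\<^sub>E UNIV. g \<xi> * measure M (cylinder \<Gamma> \<xi>))"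
proof -
  interpret prob_space M by (rule prob_measuresD[OF M])
  have sets: "cylinder \<Gamma> \<xi> \<in> sets M" for \<xi> :: "('d, 's) config"
    using borel_local_sets[OF cylinder_local_sets[OF g(1)]] prob_measuresD(2)[OF M] by blast
  have "(\<integral>\<omega>. g \<omega> \<partial>M) = (\<integral>\<omega>. (\<Sum>\<xi>\<in>\<Gamma> \<rightarrow>\<^sub>E UNIV. g \<xi> * indicator (cylinder \<Gamma> \<xi>) \<omega>) \<partial>M)"
    by (subst local_expansion[OF g]) (rule refl)
  also have "\<dots> = (\<Sum>\<xi>\<in>\<Gamma> \<rightarrow>\<^sub>E UNIV. \<integral>\<omega>. g \<xi> * indicator (cylinder \<Gamma> \<xi>) \<omega> \<partial>M)"
    using sets by (intro Bochner_Integration.integral_sum integrable_mult_right integrable_real_indicator)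
      (auto simp: emeasure_eq_measure)
  also have "\<dots> = (\<Sum>\<xi>\<in>\<Gamma> \<rightarrow>\<^sub>E UNIV. g \<xi> * measure M (cylinder \<Gamma> \<xi>))"
    using sets prob_measuresD(3)[OF M] by simp
  finally show ?thesis .
qed

lemma local_approximation:
  fixes f :: "('d::finite, 's::{finite, discrete_topology}) config \<Rightarrow> real"
  assumes f: "continuous_on UNIV f" and e: "e > 0"
  obtains \<Gamma> g where "finite \<Gamma>" "local_on \<Gamma> g" "\<And>\<omega>. \<bar>f \<omega> - g \<omega>\<bar> < e" "range g \<subseteq> range f"
proof -
  obtain n where n: "\<And>\<omega> \<eta>. (\<And>x. x \<in> cube n \<Longrightarrow> \<omega> x = \<eta> x) \<Longrightarrow> \<bar>f \<omega> - f \<eta>\<bar> < e"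
    using continuous_config_uniform[OF f e] by metis
  show ?thesis
  \<comment> \<open>Off the cube, \<open>restrict\<close> puts the fixed spin
    \<open>undefined\<close>, which acts as a boundary condition. The approximant is a value of
    \<open>f\<close> itself, so bounds on \<open>f\<close> carry over to it.\<close>
  proof (rule that[of "cube n" "\<lambda>\<omega>. f (restrict \<omega> (cube n))"])
    show "local_on (cube n) (\<lambda>\<omega>. f (restrict \<omega> (cube n)))"
    proof (rule local_onI)
      fix \<omega> \<eta> :: "('d, 's) config" assume "\<And>x. x \<in> cube n \<Longrightarrow> \<omega> x = \<eta> x"
      then have "restrict \<omega> (cube n) = restrict \<eta> (cube n)" by (rule restrict_ext)
      then show "f (restrict \<omega> (cube n)) = f (restrict \<eta> (cube n))" by simp
    qed
    show "\<bar>f \<omega> - f (restrict \<omega> (cube n))\<bar> < e" for \<omega>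
      by (rule n) simp
  qed auto
qed

lemma integral_diff_le:
  fixes f g :: "('d::finite, 's::{finite, discrete_topology}) config \<Rightarrow> real"
  assumes M: "M \<in> prob_measures" and f: "continuous_on UNIV f" and g: "continuous_on UNIV g"
    and le: "\<And>\<omega>. \<bar>f \<omega> - g \<omega>\<bar> \<le> e"
  shows "\<bar>(\<integral>\<omega>. f \<omega> \<partial>M) - (\<integral>\<omega>. g \<omega> \<partial>M)\<bar> \<le> e"
proof -
  interpret prob_space M by (rule prob_measuresD[OF M])
  have i: "integrable M f" "integrable M g" "integrable M (\<lambda>\<omega>. \<bar>f \<omega> - g \<omega>\<bar>)"
    by (intro continuous_config_integrable[OF M] continuous_intros f g)+
  have "\<bar>(\<integral>\<omega>. f \<omega> \<partial>M) - (\<integral>\<omega>. g \<omega> \<partial>M)\<bar> = \<bar>\<integral>\<omega>. f \<omega> - g \<omega> \<partial>M\<bar>"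
    using i by simp
  also have "\<dots> \<le> (\<integral>\<omega>. \<bar>f \<omega> - g \<omega>\<bar> \<partial>M)"
    by (rule integral_abs_bound)
  also have "\<dots> \<le> (\<integral>\<omega>. e \<partial>M)"
    by (rule integral_mono[OF i(3)]) (use le in auto)
  finally show ?thesis by (simp add: prob_space)
qed

text \<open>Over an empty or infinite \<open>S\<close> both the sum and the cardinality are 0, and
  so is the average.\<close>

definition average :: "'t set \<Rightarrow> ('t \<Rightarrow> real) \<Rightarrow> real" where
  "average S a = (\<Sum>t\<in>S. a t) / real (card S)"

lemma average_diff_le:
  assumes "\<And>t. t \<in> S \<Longrightarrow> \<bar>a t - b t\<bar> \<le> e" "0 \<le> e"
  shows "\<bar>average S a - average S b\<bar> \<le> e"
proof -
  have "\<bar>(\<Sum>t\<in>S. a t) - (\<Sum>t\<in>S. b t)\<bar> \<le> (\<Sum>t\<in>S. \<bar>a t - b t\<bar>)"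
    unfolding sum_subtractf[symmetric] by (rule sum_abs)
  also have "\<dots> \<le> real (card S) * e"
    using assms(1) by (rule sum_bounded_above)
  finally show ?thesis
    unfolding average_def diff_divide_distrib[symmetric] abs_divide
    using assms(2) by (cases "card S = 0") (auto simp: field_simps)
qed

text \<open>A continuous function is uniformly close to a local one, whose integral is a finite
  linear combination of cylinder probabilities. The three errors of size \<open>e / 3\<close> are
  uniform in the number of averaged measures. The averaged form serves both time averages and
  ordinary weak convergence.\<close>

lemma average_integral_tendsto:
  fixes X :: "'t \<Rightarrow> ('d::finite, 's::{finite, discrete_topology}) config measure"
  assumes X: "\<And>i t. t \<in> S i \<Longrightarrow> X t \<in> prob_measures" and \<nu>: "\<nu> \<in> prob_measures"
    and conv: "\<And>A. A \<in> local_sets \<Longrightarrow> ((\<lambda>i. average (S i) (\<lambda>t. measure (X t) A)) \<longlongrightarrow> measure \<nu> A) F"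
    and f: "continuous_on UNIV f"
  shows "((\<lambda>i. average (S i) (\<lambda>t. \<integral>\<omega>. f \<omega> \<partial>X t)) \<longlongrightarrow> (\<integral>\<omega>. f \<omega> \<partial>\<nu>)) F"
proof (rule tendstoI)
  fix e :: real assume "e > 0"
  then obtain \<Gamma> g where g: "finite \<Gamma>" "local_on \<Gamma> g" "\<And>\<omega>. \<bar>f \<omega> - g \<omega>\<bar> < e / 3"
    using local_approximation[OF f, of "e / 3"] by (metis divide_pos_pos zero_less_numeral)
  have gc: "continuous_on UNIV g" by (rule local_on_continuous[OF g(1,2)])
  have le: "\<bar>(\<integral>\<omega>. f \<omega> \<partial>M) - (\<integral>\<omega>. g \<omega> \<partial>M)\<bar> \<le> e / 3" if "M \<in> prob_measures" for M
    using that f gc by (rule integral_diff_le) (rule less_imp_le[OF g(3)])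
  have eq: "average (S i) (\<lambda>t. \<integral>\<omega>. g \<omega> \<partial>X t)
      = (\<Sum>\<xi>\<in>\<Gamma> \<rightarrow>\<^sub>E UNIV. g \<xi> * average (S i) (\<lambda>t. measure (X t) (cylinder \<Gamma> \<xi>)))" for i
  proof -
    have "(\<Sum>t\<in>S i. \<integral>\<omega>. g \<omega> \<partial>X t)
        = (\<Sum>t\<in>S i. \<Sum>\<xi>\<in>\<Gamma> \<rightarrow>\<^sub>E UNIV. g \<xi> * measure (X t) (cylinder \<Gamma> \<xi>))"
      by (rule sum.cong[OF refl integral_local[OF X g(1,2)]])
    also have "\<dots> = (\<Sum>\<xi>\<in>\<Gamma> \<rightarrow>\<^sub>E UNIV. g \<xi> * (\<Sum>t\<in>S i. measure (X t) (cylinder \<Gamma> \<xi>)))"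
      by (subst sum.swap) (simp add: sum_distrib_left)
    finally show ?thesis
      by (simp add: average_def sum_divide_distrib sum_distrib_left)
  qed
  have "((\<lambda>i. average (S i) (\<lambda>t. \<integral>\<omega>. g \<omega> \<partial>X t)) \<longlongrightarrow> (\<integral>\<omega>. g \<omega> \<partial>\<nu>)) F"
    unfolding eq integral_local[OF \<nu> g(1,2)]
    by (intro tendsto_sum tendsto_mult tendsto_const conv cylinder_local_sets g(1))
  then have "\<forall>\<^sub>F i in F. dist (average (S i) (\<lambda>t. \<integral>\<omega>. g \<omega> \<partial>X t)) (\<integral>\<omega>. g \<omega> \<partial>\<nu>) < e / 3"
    by (rule tendstoD) (use \<open>e > 0\<close> in simp)
  then show "\<forall>\<^sub>F i in F. dist (average (S i) (\<lambda>t. \<integral>\<omega>. f \<omega> \<partial>X t)) (\<integral>\<omega>. f \<omega> \<partial>\<nu>) < e"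
  proof eventually_elim
    case (elim i)
    have "\<bar>average (S i) (\<lambda>t. \<integral>\<omega>. f \<omega> \<partial>X t) - average (S i) (\<lambda>t. \<integral>\<omega>. g \<omega> \<partial>X t)\<bar> \<le> e / 3"
      by (rule average_diff_le[OF le[OF X]]) (use \<open>e > 0\<close> in auto)
    with elim le[OF \<nu>] show ?case
      unfolding dist_real_def by linarith
  qed
qed

lemma weakly_convergesI:
  fixes X :: "'i \<Rightarrow> ('d::finite, 's::{finite, discrete_topology}) config measure"
  assumes X: "\<And>i. X i \<in> prob_measures" and \<nu>: "\<nu> \<in> prob_measures"
    and conv: "\<And>A. A \<in> local_sets \<Longrightarrow> ((\<lambda>i. measure (X i) A) \<longlongrightarrow> measure \<nu> A) F"
  shows "weakly_converges X \<nu> F"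
  unfolding weakly_converges_def
proof (intro allI impI)
  fix f :: "('d, 's) config \<Rightarrow> real" assume f: "continuous_on UNIV f"
  \<comment> \<open>Weak convergence is the averaged statement for singleton sets of
    indices.\<close>
  have single: "average {i} a = a i" for i and a :: "'i \<Rightarrow> real"
    by (simp add: average_def)
  have "((\<lambda>i. average {i} (\<lambda>i. \<integral>\<omega>. f \<omega> \<partial>X i)) \<longlongrightarrow> (\<integral>\<omega>. f \<omega> \<partial>\<nu>)) F"
  proof (rule average_integral_tendsto[OF X \<nu> _ f])
    fix A :: "('d, 's) config set" assume "A \<in> local_sets"
    then show "((\<lambda>i. average {i} (\<lambda>i. measure (X i) A)) \<longlongrightarrow> measure \<nu> A) F"
      unfolding single by (rule conv)
  qed
  then show "((\<lambda>i. \<integral>\<omega>. f \<omega> \<partial>X i) \<longlongrightarrow> (\<integral>\<omega>. f \<omega> \<partial>\<nu>)) F"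
    unfolding single .
qed

lemma continuous_indicator_local:
  fixes A :: "('d::finite, 's::{finite, discrete_topology}) config set"
  assumes "A \<in> local_sets"
  shows "continuous_on UNIV (indicator A :: _ \<Rightarrow> real)"
proof -
  obtain \<Gamma> where "finite \<Gamma>" "local_on \<Gamma> (\<lambda>\<omega>. \<omega> \<in> A)"
    using assms by (rule local_setsE)
  then have "local_on \<Gamma> (indicator A :: _ \<Rightarrow> real)"
    unfolding indicator_def by (intro local_on_compose2[of \<Gamma> "\<lambda>\<omega>. \<omega> \<in> A" "\<lambda>\<omega>. \<omega> \<in> A" "\<lambda>p _. of_bool p"])
  with \<open>finite \<Gamma>\<close> show ?thesis by (rule local_on_continuous)
qed

lemma integral_indicator_config:
  fixes M :: "('d::finite, 's::{finite, discrete_topology}) config measure"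
  assumes "M \<in> prob_measures"
  shows "(\<integral>\<omega>. indicator A \<omega> \<partial>M) = measure M A"
  using prob_measuresD(3)[OF assms] by simp

section \<open>Translation invariance\<close>

lemma continuous_shift: "continuous_on UNIV (shift u :: ('d::finite, 's::topological_space) config \<Rightarrow> _)"
  unfolding shift_def
  by (intro continuous_on_coordinatewise_then_product continuous_on_product_coordinates)

lemma measurable_shift [measurable]:
  "(shift u :: ('d::finite, 's::{finite, discrete_topology}) config \<Rightarrow> _) \<in> borel \<rightarrow>\<^sub>M borel"
  by (intro borel_measurable_continuous_onI continuous_shift)

lemma shift_shift: "shift u (shift v \<omega>) = shift (u + v) \<omega>"
  by (simp add: shift_def add.assoc)

lemma shift_zero: "shift 0 \<omega> = \<omega>"
  by (simp add: shift_def)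

lemma distr_shift_prob_measures:
  fixes M :: "('d::finite, 's::{finite, discrete_topology}) config measure"
  assumes "M \<in> prob_measures"
  shows "distr M borel (shift u) \<in> prob_measures"
proof -
  interpret prob_space M by (rule prob_measuresD[OF assms])
  have "shift u \<in> M \<rightarrow>\<^sub>M borel"
    using measurable_shift prob_measuresD(2)[OF assms] measurable_cong_sets by blast
  then have "prob_space (distr M borel (shift u))" by (rule prob_space_distr)
  then show ?thesis unfolding prob_measures_def space_prob_algebra by simp
qed

text \<open>In this form translation invariance is a family of equalities between probabilities of
  local events, which survive limits.\<close>

lemma translation_invariant_iff_local:
  fixes \<nu> :: "('d::finite, 's::{finite, discrete_topology}) config measure"
  assumes \<nu>: "\<nu> \<in> prob_measures"
  shows "translation_invariant \<nu> \<longleftrightarrow> (\<forall>u. \<forall>A\<in>local_sets. measure \<nu> (shift u -` A) = measure \<nu> A)"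
proof -
  have eq: "measure (distr \<nu> borel (shift u)) A = measure \<nu> (shift u -` A)" if "A \<in> local_sets" for u A
  proof -
    have "shift u \<in> \<nu> \<rightarrow>\<^sub>M borel"
      using measurable_shift prob_measuresD(2)[OF \<nu>] measurable_cong_sets by blast
    then show ?thesis
      using borel_local_sets[OF that] prob_measuresD(3)[OF \<nu>] by (simp add: measure_distr)
  qed
  show ?thesis
  proof
    assume "translation_invariant \<nu>"
    then show "\<forall>u. \<forall>A\<in>local_sets. measure \<nu> (shift u -` A) = measure \<nu> A"
      unfolding translation_invariant_def using eq by metis
  next
    assume *: "\<forall>u. \<forall>A\<in>local_sets. measure \<nu> (shift u -` A) = measure \<nu> A"
    show "translation_invariant \<nu>"
      unfolding translation_invariant_def
    proof
      fix u
      show "distr \<nu> borel (shift u) = \<nu>"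
        using distr_shift_prob_measures[OF \<nu>] \<nu>
        by (rule prob_measures_eqI_local_sets) (simp only: eq *)
    qed
  qed
qed

lemma integral_shift:
  fixes \<nu> :: "('d::finite, 's::{finite, discrete_topology}) config measure" and f :: "_ \<Rightarrow> real"
  assumes \<nu>: "\<nu> \<in> prob_measures" "translation_invariant \<nu>" and f: "continuous_on UNIV f"
  shows "(\<integral>\<omega>. f (shift u \<omega>) \<partial>\<nu>) = (\<integral>\<omega>. f \<omega> \<partial>\<nu>)"
proof -
  have "shift u \<in> \<nu> \<rightarrow>\<^sub>M borel"
    using measurable_shift prob_measuresD(2)[OF \<nu>(1)] measurable_cong_sets by blast
  then have "(\<integral>\<omega>. f \<omega> \<partial>distr \<nu> borel (shift u)) = (\<integral>\<omega>. f (shift u \<omega>) \<partial>\<nu>)"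
    using borel_measurable_continuous_onI[OF f] by (rule integral_distr)
  then show ?thesis
    using \<nu>(2) unfolding translation_invariant_def by simp
qed

section \<open>Kernels acting on probability measures\<close>

lemma prob_measures_bind:
  fixes \<nu> :: "('d::finite, 's::{finite, discrete_topology}) config measure"
  assumes \<nu>: "\<nu> \<in> prob_measures" and P: "P \<in> borel \<rightarrow>\<^sub>M prob_algebra borel"
  shows "\<nu> \<bind> P \<in> prob_measures"
  using prob_space_bind'[OF _ P] sets_bind'[OF _ P] \<nu>
  unfolding prob_measures_def space_prob_algebra[of borel] by blast

lemma kernel_prob_measures:
  assumes "P \<in> borel \<rightarrow>\<^sub>M prob_algebra borel"
  shows "P \<sigma> \<in> prob_measures"
  using measurable_space[OF assms, of \<sigma>] unfolding prob_measures_def by simp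

lemma kernel_subprob:
  fixes \<nu> :: "('d::finite, 's::{finite, discrete_topology}) config measure"
  assumes \<nu>: "\<nu> \<in> prob_measures" and P: "P \<in> borel \<rightarrow>\<^sub>M prob_algebra borel"
  shows "P \<in> \<nu> \<rightarrow>\<^sub>M subprob_algebra borel"
  using measurable_prob_algebraD[OF P] prob_measuresD(2)[OF \<nu>] measurable_cong_sets by blast

lemma measure_bind_config:
  fixes \<nu> :: "('d::finite, 's::{finite, discrete_topology}) config measure"
  assumes \<nu>: "\<nu> \<in> prob_measures" and P: "P \<in> borel \<rightarrow>\<^sub>M prob_algebra borel" and A: "A \<in> sets borel"
  shows "measure (\<nu> \<bind> P) A = (\<integral>\<sigma>. measure (P \<sigma>) A \<partial>\<nu>)"
proof -
  interpret prob_space \<nu> by (rule prob_measuresD[OF \<nu>])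
  show ?thesis using kernel_subprob[OF \<nu> P] A by (rule measure_bind)
qed

lemma continuous_config_bounded:
  fixes f :: "('d::finite, 's::{finite, discrete_topology}) config \<Rightarrow> real"
  assumes f: "continuous_on UNIV f"
  obtains B where "0 \<le> B" "\<And>\<omega>. \<bar>f \<omega>\<bar> \<le> B"
proof -
  have "bounded (range f)"
    by (rule compact_imp_bounded[OF compact_continuous_image[OF f compact_config]])
  then obtain B where B: "\<And>\<omega>. \<bar>f \<omega>\<bar> \<le> B"
    unfolding bounded_iff real_norm_def by blast
  moreover have "0 \<le> B" using B[of undefined] by linarith
  ultimately show ?thesis using that by blast
qed

lemma integral_bind_config:
  fixes \<nu> :: "('d::finite, 's::{finite, discrete_topology}) config measure"
    and f :: "('d, 's) config \<Rightarrow> real"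
  assumes \<nu>: "\<nu> \<in> prob_measures" and P: "P \<in> borel \<rightarrow>\<^sub>M prob_algebra borel"
    and f: "continuous_on UNIV f"
  shows "(\<integral>\<omega>. f \<omega> \<partial>(\<nu> \<bind> P)) = (\<integral>\<sigma>. (\<integral>\<omega>. f \<omega> \<partial>P \<sigma>) \<partial>\<nu>)"
proof -
  interpret prob_space \<nu> by (rule prob_measuresD[OF \<nu>])
  obtain B where B: "\<And>\<omega>. \<bar>f \<omega>\<bar> \<le> B"
    using continuous_config_bounded[OF f] by metis
  show ?thesis
  proof (rule integral_bind[where B=B and B'=1, OF borel_measurable_continuous_onI[OF f] _ kernel_subprob[OF \<nu> P]])
    show "finite_measure \<nu>" by unfold_locales
    have "emeasure (P x) (space (P x)) = 1" for x
      by (rule prob_space.emeasure_space_1[OF prob_measuresD(1)[OF kernel_prob_measures[OF P]]])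
    then show "AE x in \<nu>. emeasure (P x) (space (P x)) \<le> ennreal 1" by simp
  qed (rule B)
qed

section \<open>Gibbs kernels\<close>

lemma range_shift: "range (shift u) = (UNIV :: ('d::finite, 's) config set)"
proof -
  have "\<omega> = shift u (shift (- u) \<omega>)" for \<omega> :: "('d, 's) config"
    by (simp add: shift_shift shift_zero)
  then show ?thesis by blast
qed

lemma potential_local: "ti_abs_summable_potential \<Phi> \<Longrightarrow> finite A \<Longrightarrow> A \<noteq> {} \<Longrightarrow> local_on A (\<Phi> A)"
  unfolding ti_abs_summable_potential_def local_on_def by blast

text \<open>By locality every value is attained at a restricted configuration, so only finitely many
  values occur and the supremum is over a bounded set.\<close>

lemma potential_le_SUP:
  assumes "ti_abs_summable_potential \<Phi>" "finite A" "A \<noteq> {}"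
  shows "\<bar>\<Phi> A \<omega>\<bar> \<le> (SUP \<omega>. \<bar>\<Phi> A \<omega>\<bar>)"
proof -
  have "\<Phi> A \<omega> = \<Phi> A (restrict \<omega> A)" for \<omega>
    by (rule local_on_restrict[OF potential_local[OF assms], symmetric])
  moreover have "restrict \<omega> A \<in> A \<rightarrow>\<^sub>E UNIV" for \<omega>
    by (rule restrict_PiE_iff[THEN iffD2]) simp
  ultimately have "range (\<lambda>\<omega>. \<bar>\<Phi> A \<omega>\<bar>) \<subseteq> (\<lambda>\<omega>. \<bar>\<Phi> A \<omega>\<bar>) ` (A \<rightarrow>\<^sub>E UNIV)"
    by (metis (mono_tags, lifting) image_eqI image_subsetI)
  then have "finite (range (\<lambda>\<omega>. \<bar>\<Phi> A \<omega>\<bar>))"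
    by (rule finite_subset) (intro finite_imageI finite_configs assms(2))
  then show ?thesis
    by (intro cSUP_upper bdd_above_finite) auto
qed

lemma potential_SUP_translate:
  fixes \<Phi> :: "('d::finite, 's::finite) potential"
  assumes "ti_abs_summable_potential \<Phi>" "finite A" "A \<noteq> {}"
  shows "(SUP \<omega>. \<bar>\<Phi> ((\<lambda>x. x + u) ` A) \<omega>\<bar>) = (SUP \<omega>. \<bar>\<Phi> A \<omega>\<bar>)"
proof -
  have "\<Phi> ((\<lambda>x. x + u) ` A) \<omega> = \<Phi> A (shift u \<omega>)" for \<omega>
    using assms unfolding ti_abs_summable_potential_def by blast
  then have "(SUP \<omega>. \<bar>\<Phi> ((\<lambda>x. x + u) ` A) \<omega>\<bar>) = (SUP \<omega>\<in>range (shift u). \<bar>\<Phi> A \<omega>\<bar>)"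
    by (simp add: image_image)
  then show ?thesis by (simp add: range_shift)
qed

text \<open>Translation by \<open>u\<close> maps the finite sets containing the origin bijectively
  onto those containing \<open>u\<close> and preserves the suprema, so summability at the origin
  spreads to every site.\<close>

lemma potential_summable_at:
  fixes \<Phi> :: "('d::finite, 's::finite) potential"
  assumes \<Phi>: "ti_abs_summable_potential \<Phi>"
  shows "(\<lambda>A. SUP \<omega>. \<bar>\<Phi> A \<omega>\<bar>) summable_on {A. finite A \<and> u \<in> A}"
proof -
  have bij: "bij_betw ((`) (\<lambda>x. x + u)) {A. finite A \<and> 0 \<in> A} {A. finite A \<and> u \<in> A}"
    by (rule bij_betw_byWitness[where f'="(`) (\<lambda>x. x - u)"])
       (auto simp: image_image image_iff intro!: bexI[of _ 0])
  have "(\<lambda>A. SUP \<omega>. \<bar>\<Phi> ((\<lambda>x. x + u) ` A) \<omega>\<bar>) summable_on {A. finite A \<and> 0 \<in> A}"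
  proof (rule summable_on_cong[THEN iffD2])
    show "(\<lambda>A. SUP \<omega>. \<bar>\<Phi> A \<omega>\<bar>) summable_on {A. finite A \<and> 0 \<in> A}"
      using \<Phi> unfolding ti_abs_summable_potential_def by blast
    show "(SUP \<omega>. \<bar>\<Phi> ((\<lambda>x. x + u) ` A) \<omega>\<bar>) = (SUP \<omega>. \<bar>\<Phi> A \<omega>\<bar>)"
      if "A \<in> {A. finite A \<and> 0 \<in> A}" for A
      using that by (intro potential_SUP_translate[OF \<Phi>]) auto
  qed
  then show ?thesis
    by (rule summable_on_reindex_bij_betw[OF bij, THEN iffD1])
qed

lemma potential_summable:
  fixes \<Phi> :: "('d::finite, 's::finite) potential"
  assumes \<Phi>: "ti_abs_summable_potential \<Phi>" and "finite \<Lambda>"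
  shows "(\<lambda>A. SUP \<omega>. \<bar>\<Phi> A \<omega>\<bar>) summable_on {A. finite A \<and> A \<inter> \<Lambda> \<noteq> {}}"
  using assms(2)
proof induction
  case empty
  then show ?case by simp
next
  case (insert x \<Lambda>)
  have "{A. finite A \<and> A \<inter> insert x \<Lambda> \<noteq> {}} = {A. finite A \<and> x \<in> A} \<union> {A. finite A \<and> A \<inter> \<Lambda> \<noteq> {}}"
    by auto
  then show ?case
    using summable_on_union[OF potential_summable_at[OF \<Phi>, of x] insert.IH] by simp
qed

text \<open>The finite partial sums are local, hence continuous, and the Weierstrass test with the
  summable norms of the potential makes them converge uniformly along the net of finite
  subsets.\<close>

lemma continuous_hamiltonian:
  fixes \<Phi> :: "('d::finite, 's::{finite, discrete_topology}) potential"
  assumes \<Phi>: "ti_abs_summable_potential \<Phi>" and \<Lambda>: "finite \<Lambda>"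
  shows "continuous_on UNIV (hamiltonian \<Phi> \<Lambda>)"
proof -
  let ?X = "{A. finite A \<and> A \<inter> \<Lambda> \<noteq> {}}"
  have "uniform_limit UNIV (\<lambda>X \<omega>. \<Sum>A\<in>X. \<Phi> A \<omega>) (hamiltonian \<Phi> \<Lambda>) (finite_subsets_at_top ?X)"
    unfolding hamiltonian_def
  proof (rule Weierstrass_m_test_general[OF _ potential_summable[OF \<Phi> \<Lambda>]])
    fix A \<omega> assume "A \<in> ?X"
    then show "norm (\<Phi> A \<omega>) \<le> (SUP \<omega>. \<bar>\<Phi> A \<omega>\<bar>)"
      unfolding real_norm_def by (intro potential_le_SUP[OF \<Phi>]) auto
  qed
  moreover have "\<forall>\<^sub>F X in finite_subsets_at_top ?X. continuous_on UNIV (\<lambda>\<omega>. \<Sum>A\<in>X. \<Phi> A \<omega>)"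
  proof (rule eventually_finite_subsets_at_top_weakI)
    fix X assume X: "finite X" "X \<subseteq> ?X"
    show "continuous_on UNIV (\<lambda>\<omega>. \<Sum>A\<in>X. \<Phi> A \<omega>)"
    proof (rule continuous_on_sum)
      fix A assume "A \<in> X"
      with X have "finite A" "A \<noteq> {}" by auto
      then show "continuous_on UNIV (\<Phi> A)"
        by (intro local_on_continuous[OF _ potential_local[OF \<Phi>]])
    qed
  qed
  ultimately show ?thesis
    by (intro uniform_limit_theorem) auto
qed

section \<open>Gibbs kernels and the DLR equation\<close>

lemma continuous_override_on:
  "continuous_on UNIV (\<lambda>\<eta> :: ('d::finite, 's::topological_space) config. override_on \<eta> \<xi> \<Lambda>)"
  unfolding override_on_def
proof (rule continuous_on_coordinatewise_then_product)
  fix x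
  show "continuous_on UNIV (\<lambda>\<eta> :: ('d, 's) config. if x \<in> \<Lambda> then \<xi> x else \<eta> x)"
    by (cases "x \<in> \<Lambda>") auto
qed

lemma partition_function_pos:
  assumes "finite \<Lambda>"
  shows "partition_function \<Phi> \<Lambda> \<eta> > 0"
  unfolding partition_function_def using assms
  by (intro sum_pos) (auto simp: PiE_eq_empty_iff)

lemma continuous_gibbs_weight:
  fixes \<Phi> :: "('d::finite, 's::{finite, discrete_topology}) potential"
  assumes \<Phi>: "ti_abs_summable_potential \<Phi>" and \<Lambda>: "finite \<Lambda>"
  shows "continuous_on UNIV (\<lambda>\<eta>. gibbs_weight \<Phi> \<Lambda> \<eta> \<xi>)"
proof -
  have *: "continuous_on UNIV (\<lambda>\<eta>. exp (- hamiltonian \<Phi> \<Lambda> (override_on \<eta> \<xi> \<Lambda>)))" for \<xi>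
    by (intro continuous_intros continuous_on_compose2[OF continuous_hamiltonian[OF \<Phi> \<Lambda>]]
        continuous_override_on) simp
  have "continuous_on UNIV (partition_function \<Phi> \<Lambda>)"
    unfolding partition_function_def by (intro continuous_on_sum *)
  moreover have "partition_function \<Phi> \<Lambda> \<eta> \<noteq> 0" for \<eta>
    using partition_function_pos[OF \<Lambda>, of \<Phi> \<eta>] by simp
  ultimately show ?thesis
    unfolding gibbs_weight_def by (intro continuous_on_divide *) auto
qed

lemma gibbs_weight_nonneg: "finite \<Lambda> \<Longrightarrow> 0 \<le> gibbs_weight \<Phi> \<Lambda> \<eta> \<xi>"
  unfolding gibbs_weight_def by (intro divide_nonneg_pos partition_function_pos) auto

lemma sum_gibbs_weight:
  assumes "finite \<Lambda>"
  shows "(\<Sum>\<xi>\<in>\<Lambda> \<rightarrow>\<^sub>E UNIV. gibbs_weight \<Phi> \<Lambda> \<eta> \<xi>) = 1"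
proof -
  have "(\<Sum>\<xi>\<in>\<Lambda> \<rightarrow>\<^sub>E UNIV. gibbs_weight \<Phi> \<Lambda> \<eta> \<xi>)
      = partition_function \<Phi> \<Lambda> \<eta> / partition_function \<Phi> \<Lambda> \<eta>"
    unfolding gibbs_weight_def sum_divide_distrib[symmetric] by (simp add: partition_function_def)
  then show ?thesis using partition_function_pos[OF assms, of \<Phi> \<eta>] by simp
qed

lemma emeasure_gibbs_kernel:
  fixes \<Phi> :: "('d::finite, 's::{finite, discrete_topology}) potential"
  assumes \<Lambda>: "finite \<Lambda>" and A: "A \<in> sets borel"
  shows "emeasure (gibbs_kernel \<Phi> \<Lambda> \<eta>) A
    = ennreal (\<Sum>\<xi>\<in>\<Lambda> \<rightarrow>\<^sub>E UNIV. gibbs_weight \<Phi> \<Lambda> \<eta> \<xi> * indicator A (override_on \<eta> \<xi> \<Lambda>))"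
proof -
  let ?I = "\<Lambda> \<rightarrow>\<^sub>E (UNIV :: 's set)" and ?w = "gibbs_weight \<Phi> \<Lambda> \<eta>" and ?o = "\<lambda>\<xi>. override_on \<eta> \<xi> \<Lambda>"
  have fin: "finite ?I" using \<Lambda> by simp
  have "emeasure (gibbs_kernel \<Phi> \<Lambda> \<eta>) A
      = emeasure (point_measure ?I (\<lambda>\<xi>. ennreal (?w \<xi>))) (?o -` A \<inter> ?I)"
    unfolding gibbs_kernel_def using A
    by (subst emeasure_distr) (auto simp: space_point_measure sets_point_measure measurable_def)
  also have "\<dots> = (\<Sum>\<xi>\<in>?o -` A \<inter> ?I. ennreal (?w \<xi>))"
    using fin by (intro emeasure_point_measure_finite) auto
  also have "\<dots> = ennreal (\<Sum>\<xi>\<in>?o -` A \<inter> ?I. ?w \<xi>)"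
    by (rule sum_ennreal) (rule gibbs_weight_nonneg[OF \<Lambda>])
  also have "(\<Sum>\<xi>\<in>?o -` A \<inter> ?I. ?w \<xi>) = (\<Sum>\<xi>\<in>?I. ?w \<xi> * indicator A (?o \<xi>))"
    using fin by (intro sum.mono_neutral_cong_left) (auto simp: indicator_def)
  finally show ?thesis .
qed

lemma measure_gibbs_kernel:
  fixes \<Phi> :: "('d::finite, 's::{finite, discrete_topology}) potential"
  assumes \<Lambda>: "finite \<Lambda>" and A: "A \<in> sets borel"
  shows "measure (gibbs_kernel \<Phi> \<Lambda> \<eta>) A
    = (\<Sum>\<xi>\<in>\<Lambda> \<rightarrow>\<^sub>E UNIV. gibbs_weight \<Phi> \<Lambda> \<eta> \<xi> * indicator A (override_on \<eta> \<xi> \<Lambda>))"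
  unfolding measure_def emeasure_gibbs_kernel[OF assms]
  by (intro enn2real_ennreal sum_nonneg mult_nonneg_nonneg gibbs_weight_nonneg[OF \<Lambda>]) simp

text \<open>This is quasilocality of the specification: it makes both sides of the DLR equation,
  tested on a local event, integrals of continuous functions.\<close>

lemma continuous_gibbs_kernel:
  fixes \<Phi> :: "('d::finite, 's::{finite, discrete_topology}) potential"
  assumes \<Phi>: "ti_abs_summable_potential \<Phi>" and \<Lambda>: "finite \<Lambda>" and A: "A \<in> local_sets"
  shows "continuous_on UNIV (\<lambda>\<eta>. measure (gibbs_kernel \<Phi> \<Lambda> \<eta>) A)"
  unfolding measure_gibbs_kernel[OF \<Lambda> borel_local_sets[OF A]]
  by (intro continuous_on_sum continuous_on_mult continuous_gibbs_weight[OF \<Phi> \<Lambda>]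
      continuous_on_compose2[OF continuous_indicator_local[OF A]] continuous_override_on) simp

lemma gibbs_kernel_prob_space:
  fixes \<Phi> :: "('d::finite, 's::{finite, discrete_topology}) potential"
  assumes \<Lambda>: "finite \<Lambda>"
  shows "prob_space (gibbs_kernel \<Phi> \<Lambda> \<eta>)"
proof (rule prob_spaceI)
  have "space (gibbs_kernel \<Phi> \<Lambda> \<eta>) = UNIV" by (simp add: gibbs_kernel_def)
  then show "emeasure (gibbs_kernel \<Phi> \<Lambda> \<eta>) (space (gibbs_kernel \<Phi> \<Lambda> \<eta>)) = 1"
    using emeasure_gibbs_kernel[OF \<Lambda>, of UNIV \<Phi> \<eta>] sum_gibbs_weight[OF \<Lambda>, of \<Phi> \<eta>] by simp
qed

lemma measurable_gibbs_kernel: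
  fixes \<Phi> :: "('d::finite, 's::{finite, discrete_topology}) potential"
  assumes \<Phi>: "ti_abs_summable_potential \<Phi>" and \<Lambda>: "finite \<Lambda>"
  shows "gibbs_kernel \<Phi> \<Lambda> \<in> borel \<rightarrow>\<^sub>M prob_algebra borel"
proof (rule measurable_prob_algebra_generated[OF sets_borel_eq_local_sets Int_stable_local_sets])
  show "prob_space (gibbs_kernel \<Phi> \<Lambda> \<eta>)" for \<eta>
    by (rule gibbs_kernel_prob_space[OF \<Lambda>])
  show "sets (gibbs_kernel \<Phi> \<Lambda> \<eta>) = sets borel" for \<eta>
    by (simp add: gibbs_kernel_def)
  fix A :: "('d, 's) config set" assume A: "A \<in> local_sets"
  have "(\<lambda>\<eta>. ennreal (measure (gibbs_kernel \<Phi> \<Lambda> \<eta>) A)) \<in> borel_measurable borel"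
    by (intro measurable_compose[OF borel_measurable_continuous_onI measurable_ennreal]
        continuous_gibbs_kernel[OF \<Phi> \<Lambda> A])
  moreover have "ennreal (measure (gibbs_kernel \<Phi> \<Lambda> \<eta>) A) = emeasure (gibbs_kernel \<Phi> \<Lambda> \<eta>) A" for \<eta>
    by (rule finite_measure.emeasure_eq_measure[OF prob_space.axioms(1), symmetric])
       (rule gibbs_kernel_prob_space[OF \<Lambda>])
  ultimately show "(\<lambda>\<eta>. emeasure (gibbs_kernel \<Phi> \<Lambda> \<eta>) A) \<in> borel_measurable borel" by simp
qed simp

text \<open>A measure is determined by its local events, so the DLR equation becomes a family of
  identities between real integrals, suited to limits and to densities.\<close>

lemma gibbs_measure_iff:
  fixes \<Phi> :: "('d::finite, 's::{finite, discrete_topology}) potential"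
  assumes \<Phi>: "ti_abs_summable_potential \<Phi>" and \<nu>: "\<nu> \<in> prob_measures"
  shows "gibbs_measure \<Phi> \<nu> \<longleftrightarrow>
    (\<forall>\<Lambda>. finite \<Lambda> \<longrightarrow> (\<forall>A\<in>local_sets. (\<integral>\<eta>. measure (gibbs_kernel \<Phi> \<Lambda> \<eta>) A \<partial>\<nu>) = measure \<nu> A))"
proof -
  have "\<nu> \<bind> gibbs_kernel \<Phi> \<Lambda> = \<nu> \<longleftrightarrow>
      (\<forall>A\<in>local_sets. (\<integral>\<eta>. measure (gibbs_kernel \<Phi> \<Lambda> \<eta>) A \<partial>\<nu>) = measure \<nu> A)" if "finite \<Lambda>" for \<Lambda>
  proof -
    note meas = measurable_gibbs_kernel[OF \<Phi> that]
    have eq: "measure (\<nu> \<bind> gibbs_kernel \<Phi> \<Lambda>) A = (\<integral>\<eta>. measure (gibbs_kernel \<Phi> \<Lambda> \<eta>) A \<partial>\<nu>)"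
      if "A \<in> local_sets" for A
      by (rule measure_bind_config[OF \<nu> meas borel_local_sets[OF that]])
    show ?thesis
    proof
      assume "\<nu> \<bind> gibbs_kernel \<Phi> \<Lambda> = \<nu>"
      then show "\<forall>A\<in>local_sets. (\<integral>\<eta>. measure (gibbs_kernel \<Phi> \<Lambda> \<eta>) A \<partial>\<nu>) = measure \<nu> A"
        using eq by metis
    next
      assume *: "\<forall>A\<in>local_sets. (\<integral>\<eta>. measure (gibbs_kernel \<Phi> \<Lambda> \<eta>) A \<partial>\<nu>) = measure \<nu> A"
      show "\<nu> \<bind> gibbs_kernel \<Phi> \<Lambda> = \<nu>"
        using prob_measures_bind[OF \<nu> meas] \<nu>
        by (rule prob_measures_eqI_local_sets) (simp only: eq *)
    qed
  qed
  then show ?thesis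
    unfolding gibbs_measure_def using \<nu> by blast
qed

text \<open>Convergence on local events is weak convergence, and the kernel probability of a local
  event is a continuous test function.\<close>

lemma gibbs_measure_limit:
  fixes \<Phi> :: "('d::finite, 's::{finite, discrete_topology}) potential"
  assumes \<Phi>: "ti_abs_summable_potential \<Phi>" and \<nu>: "\<nu> \<in> prob_measures"
    and \<rho>: "\<And>k :: nat. \<rho> k \<in> prob_measures" "\<And>k. gibbs_measure \<Phi> (\<rho> k)"
    and conv: "\<And>A. A \<in> local_sets \<Longrightarrow> (\<lambda>k. measure (\<rho> k) A) \<longlonglongrightarrow> measure \<nu> A"
  shows "gibbs_measure \<Phi> \<nu>"
  unfolding gibbs_measure_iff[OF \<Phi> \<nu>]
proof (intro allI impI ballI)
  fix \<Lambda> :: "'d site set" and A :: "('d, 's) config set"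
  assume \<Lambda>: "finite \<Lambda>" and A: "A \<in> local_sets"
  have "weakly_converges \<rho> \<nu> sequentially"
    by (rule weakly_convergesI[OF \<rho>(1) \<nu> conv])
  then have "(\<lambda>k. \<integral>\<eta>. measure (gibbs_kernel \<Phi> \<Lambda> \<eta>) A \<partial>\<rho> k)
      \<longlonglongrightarrow> (\<integral>\<eta>. measure (gibbs_kernel \<Phi> \<Lambda> \<eta>) A \<partial>\<nu>)"
    unfolding weakly_converges_def using continuous_gibbs_kernel[OF \<Phi> \<Lambda> A] by blast
  moreover have "(\<integral>\<eta>. measure (gibbs_kernel \<Phi> \<Lambda> \<eta>) A \<partial>\<rho> k) = measure (\<rho> k) A" for k
    using \<rho>(2)[of k] \<Lambda> A unfolding gibbs_measure_iff[OF \<Phi> \<rho>(1)] by blast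
  ultimately have "(\<lambda>k. measure (\<rho> k) A) \<longlonglongrightarrow> (\<integral>\<eta>. measure (gibbs_kernel \<Phi> \<Lambda> \<eta>) A \<partial>\<nu>)" by simp
  then show "(\<integral>\<eta>. measure (gibbs_kernel \<Phi> \<Lambda> \<eta>) A \<partial>\<nu>) = measure \<nu> A"
    using conv[OF A] by (rule LIMSEQ_unique)
qed

text \<open>The DLR defect of \<open>A\<close> is orthogonal to everything observed outside
  \<open>\<Lambda>\<close>. Expanding \<open>g\<close> into cylinder indicators reduces the claim to
  the DLR equation for the intersection of such a cylinder with \<open>A\<close>.\<close>

lemma integral_local_times_gibbs:
  fixes \<Phi> :: "('d::finite, 's::{finite, discrete_topology}) potential"
    and g :: "('d, 's) config \<Rightarrow> real"
  assumes \<Phi>: "ti_abs_summable_potential \<Phi>" and \<nu>: "\<nu> \<in> prob_measures" "gibbs_measure \<Phi> \<nu>"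
    and \<Lambda>: "finite \<Lambda>" and g: "finite \<Gamma>" "local_on \<Gamma> g" and disj: "\<Gamma> \<inter> \<Lambda> = {}" and A: "A \<in> local_sets"
  shows "(\<integral>\<eta>. g \<eta> * (indicator A \<eta> - measure (gibbs_kernel \<Phi> \<Lambda> \<eta>) A) \<partial>\<nu>) = 0"
proof -
  let ?\<phi> = "\<lambda>\<eta>. indicator A \<eta> - measure (gibbs_kernel \<Phi> \<Lambda> \<eta>) A"
  note cA = continuous_indicator_local[OF A] continuous_gibbs_kernel[OF \<Phi> \<Lambda> A]
  have zero: "(\<integral>\<eta>. indicator (cylinder \<Gamma> \<xi>) \<eta> * ?\<phi> \<eta> \<partial>\<nu>) = 0" for \<xi>
  proof -
    let ?C = "cylinder \<Gamma> \<xi>"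
    have C: "?C \<in> local_sets" by (rule cylinder_local_sets[OF g(1)])
    note cC = continuous_indicator_local[OF C]
    have CA: "?C \<inter> A \<in> local_sets" by (rule local_sets_Int[OF C A])
    \<comment> \<open>Properness of the kernel: resampling inside \<open>\<Lambda>\<close> leaves
      the sites of \<open>\<Gamma>\<close> alone, so the cylinder event factors out.\<close>
    have kernel: "measure (gibbs_kernel \<Phi> \<Lambda> \<eta>) (?C \<inter> A) = indicator ?C \<eta> * measure (gibbs_kernel \<Phi> \<Lambda> \<eta>) A" for \<eta>
    proof -
      have "override_on \<eta> \<zeta> \<Lambda> \<in> ?C \<longleftrightarrow> \<eta> \<in> ?C" for \<zeta>
        using disj unfolding cylinder_def override_on_def by auto
      then show ?thesis
        unfolding measure_gibbs_kernel[OF \<Lambda> borel_local_sets[OF CA]] measure_gibbs_kernel[OF \<Lambda> borel_local_sets[OF A]]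
        by (simp add: indicator_inter_arith indicator_def sum_distrib_left)
    qed
    have "(\<integral>\<eta>. indicator ?C \<eta> * ?\<phi> \<eta> \<partial>\<nu>)
        = (\<integral>\<eta>. indicator ?C \<eta> * indicator A \<eta> - indicator ?C \<eta> * measure (gibbs_kernel \<Phi> \<Lambda> \<eta>) A \<partial>\<nu>)"
      by (simp add: right_diff_distrib)
    also have "\<dots> = (\<integral>\<eta>. indicator ?C \<eta> * indicator A \<eta> \<partial>\<nu>) - (\<integral>\<eta>. indicator ?C \<eta> * measure (gibbs_kernel \<Phi> \<Lambda> \<eta>) A \<partial>\<nu>)"
      by (intro Bochner_Integration.integral_diff continuous_config_integrable[OF \<nu>(1)] continuous_on_mult cA cC)
    also have "(\<integral>\<eta>. indicator ?C \<eta> * indicator A \<eta> \<partial>\<nu>) = measure \<nu> (?C \<inter> A)"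
      unfolding indicator_inter_arith[symmetric] by (rule integral_indicator_config[OF \<nu>(1)])
    also have "(\<integral>\<eta>. indicator ?C \<eta> * measure (gibbs_kernel \<Phi> \<Lambda> \<eta>) A \<partial>\<nu>) = measure \<nu> (?C \<inter> A)"
      unfolding kernel[symmetric]
      using \<nu>(2) \<Lambda> CA unfolding gibbs_measure_iff[OF \<Phi> \<nu>(1)] by blast
    finally show ?thesis by simp
  qed
  have "(\<integral>\<eta>. g \<eta> * ?\<phi> \<eta> \<partial>\<nu>)
      = (\<integral>\<eta>. (\<Sum>\<xi>\<in>\<Gamma> \<rightarrow>\<^sub>E UNIV. g \<xi> * (indicator (cylinder \<Gamma> \<xi>) \<eta> * ?\<phi> \<eta>)) \<partial>\<nu>)"
    by (subst local_expansion[OF g]) (simp only: sum_distrib_right mult.assoc)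
  also have "\<dots> = (\<Sum>\<xi>\<in>\<Gamma> \<rightarrow>\<^sub>E UNIV. \<integral>\<eta>. g \<xi> * (indicator (cylinder \<Gamma> \<xi>) \<eta> * ?\<phi> \<eta>) \<partial>\<nu>)"
    by (intro Bochner_Integration.integral_sum continuous_config_integrable[OF \<nu>(1)] continuous_intros cA
        continuous_indicator_local cylinder_local_sets g(1))
  also have "\<dots> = 0"
    by (simp add: zero)
  finally show ?thesis .
qed

section \<open>Measures dominated by a Gibbs measure\<close>

lemma finite_translate_disjoint:
  fixes \<Gamma> \<Lambda> :: "(int ^ 'd::finite) set"
  assumes "finite \<Gamma>" "finite \<Lambda>"
  obtains v where "(\<lambda>x. x + v) ` \<Gamma> \<inter> \<Lambda> = {}"
proof -
  \<comment> \<open>Since the dimension is at least 1, constant vectors embed the integers and the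
    lattice is infinite.\<close>
  have "inj (vec :: int \<Rightarrow> int ^ 'd)"
    by (auto simp: inj_on_def vec_eq_iff)
  then have "infinite (UNIV :: (int ^ 'd) set)"
    using range_inj_infinite infinite_UNIV_int by (metis finite_imageD rev_finite_subset subset_UNIV)
  moreover have "finite ((\<lambda>(y, x). y - x) ` (\<Lambda> \<times> \<Gamma>))"
    using assms by simp
  \<comment> \<open>The translate can meet \<open>\<Lambda>\<close> only if \<open>v\<close> is one
    of finitely many differences.\<close>
  ultimately obtain v where v: "v \<notin> (\<lambda>(y, x). y - x) ` (\<Lambda> \<times> \<Gamma>)"
    by (metis UNIV_I ex_new_if_finite)
  have "(\<lambda>x. x + v) ` \<Gamma> \<inter> \<Lambda> = {}"
  proof (rule equals0I)
    fix y assume "y \<in> (\<lambda>x. x + v) ` \<Gamma> \<inter> \<Lambda>"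
    then obtain x where "x \<in> \<Gamma>" "y = x + v" "y \<in> \<Lambda>" by blast
    then have "v = (\<lambda>(y, x). y - x) (y, x)" "(y, x) \<in> \<Lambda> \<times> \<Gamma>" by simp_all
    with v show False by blast
  qed
  then show ?thesis by (rule that)
qed

lemma cylinder_cong: "(\<And>x. x \<in> \<Gamma> \<Longrightarrow> \<omega> x = \<eta> x) \<Longrightarrow> cylinder \<Gamma> \<omega> = cylinder \<Gamma> \<eta>"
  unfolding cylinder_def by simp

text \<open>The Radon-Nikodym density of \<rho> with respect to \<nu> on the events observed in
  \<open>\<Gamma>\<close>; as \<open>\<Gamma>\<close> grows these form a martingale under \<nu> when
  \<rho> is dominated. Division by zero sets it to 0 on \<nu>-null cylinders.\<close>

definition local_density ::
  "('d::finite, 's::{finite, discrete_topology}) config measure \<Rightarrow> ('d, 's) config measure \<Rightarrow>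
    'd site set \<Rightarrow> ('d, 's) config \<Rightarrow> real" where
  "local_density \<rho> \<nu> \<Gamma> \<eta> = measure \<rho> (cylinder \<Gamma> \<eta>) / measure \<nu> (cylinder \<Gamma> \<eta>)"

lemma local_on_local_density: "local_on \<Gamma> (local_density \<rho> \<nu> \<Gamma>)"
  unfolding local_density_def
  by (rule local_onI) (use cylinder_cong in metis)

lemma continuous_local_density:
  "finite \<Gamma> \<Longrightarrow> continuous_on UNIV (local_density \<rho> \<nu> \<Gamma>)"
  by (rule local_on_continuous[OF _ local_on_local_density])

context
  fixes \<rho> \<nu> :: "('d::finite, 's::{finite, discrete_topology}) config measure" and p :: real
  assumes \<rho>: "\<rho> \<in> prob_measures" and \<nu>: "\<nu> \<in> prob_measures" and p: "p > 0"
    and le: "\<And>A. A \<in> local_sets \<Longrightarrow> p * measure \<rho> A \<le> measure \<nu> A"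
begin

lemma local_density_bounds:
  assumes "finite \<Gamma>"
  shows "0 \<le> local_density \<rho> \<nu> \<Gamma> \<eta>" "local_density \<rho> \<nu> \<Gamma> \<eta> \<le> 1 / p"
proof -
  show "0 \<le> local_density \<rho> \<nu> \<Gamma> \<eta>" by (simp add: local_density_def)
  have "p * measure \<rho> (cylinder \<Gamma> \<eta>) \<le> measure \<nu> (cylinder \<Gamma> \<eta>)"
    by (rule le[OF cylinder_local_sets[OF assms]])
  moreover have "0 \<le> measure \<nu> (cylinder \<Gamma> \<eta>)" by simp
  ultimately show "local_density \<rho> \<nu> \<Gamma> \<eta> \<le> 1 / p"
    unfolding local_density_def using p
    by (cases "measure \<nu> (cylinder \<Gamma> \<eta>) = 0") (auto simp: divide_simps mult.commute)
qed

text \<open>A \<nu>-null cylinder is also \<rho>-null by domination, so the default value of the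
  density there does no harm.\<close>

lemma integral_local_density:
  assumes \<Gamma>: "finite \<Gamma>" and g: "local_on \<Gamma> g"
  shows "(\<integral>\<eta>. g \<eta> * local_density \<rho> \<nu> \<Gamma> \<eta> \<partial>\<nu>) = (\<integral>\<eta>. g \<eta> \<partial>\<rho>)"
proof -
  have eq: "g \<xi> * local_density \<rho> \<nu> \<Gamma> \<xi> * measure \<nu> (cylinder \<Gamma> \<xi>) = g \<xi> * measure \<rho> (cylinder \<Gamma> \<xi>)" for \<xi>
  proof (cases "measure \<nu> (cylinder \<Gamma> \<xi>) = 0")
    case True
    then have "p * measure \<rho> (cylinder \<Gamma> \<xi>) \<le> 0"
      using le[OF cylinder_local_sets[OF \<Gamma>], of \<xi>] by simp
    then have "measure \<rho> (cylinder \<Gamma> \<xi>) \<le> 0"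
      using p by (simp add: mult_le_0_iff)
    then have "measure \<rho> (cylinder \<Gamma> \<xi>) = 0" by (rule antisym) simp
    then show ?thesis by (simp add: True)
  qed (simp add: local_density_def)
  show ?thesis
    unfolding integral_local[OF \<rho> \<Gamma> g]
      integral_local[OF \<nu> \<Gamma> local_on_compose2[OF g local_on_local_density, of "(*)"]]
    by (simp only: eq)
qed

text \<open>An energy argument replaces martingale convergence: second moments under \<nu> are
  bounded by \<open>1 / p\<close>, and by orthogonality of increments their growth equals the
  squared L2 distance. A volume whose second moment is nearly the supremum is therefore close to
  every larger one.\<close>

lemma local_density_L1_Cauchy:
  assumes d: "d > 0"
  shows "\<exists>\<Gamma>. finite \<Gamma> \<and> (\<forall>\<Gamma>'. finite \<Gamma>' \<longrightarrow> \<Gamma> \<subseteq> \<Gamma>' \<longrightarrow>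
      (\<integral>\<eta>. \<bar>local_density \<rho> \<nu> \<Gamma>' \<eta> - local_density \<rho> \<nu> \<Gamma> \<eta>\<bar> \<partial>\<nu>) \<le> 2 * d)"
proof -
  interpret \<nu>: prob_space \<nu> by (rule prob_measuresD[OF \<nu>])
  interpret \<rho>: prob_space \<rho> by (rule prob_measuresD[OF \<rho>])
  let ?h = "local_density \<rho> \<nu>"
  \<comment> \<open>This is the second moment of the density under \<nu>, written as a first moment
    under \<rho>; in this form the pointwise bound \<open>1 / p\<close> bounds it at once.\<close>
  define q where "q = (\<lambda>\<Gamma>. \<integral>\<eta>. ?h \<Gamma> \<eta> \<partial>\<rho>)"
  have q_le: "q \<Gamma> \<le> 1 / p" if "finite \<Gamma>" for \<Gamma>
  proof -
    have "q \<Gamma> \<le> (\<integral>\<eta>. 1 / p \<partial>\<rho>)"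
      unfolding q_def using that
      by (intro integral_mono continuous_config_integrable[OF \<rho>] continuous_local_density local_density_bounds(2))
        auto
    then show ?thesis by (simp add: \<rho>.prob_space)
  qed
  have bdd: "bdd_above (q ` Collect finite)"
    using q_le by (intro bdd_aboveI2[of _ _ "1 / p"]) simp
  define s where "s = (SUP \<Gamma>\<in>Collect finite. q \<Gamma>)"
  \<comment> \<open>The margin is \<open>d * d\<close> because it bounds a squared L2
    distance.\<close>
  have "\<exists>\<Gamma>\<in>Collect finite. s - d * d < q \<Gamma>"
    using less_cSUP_iff[OF _ bdd, of "s - d * d"] d unfolding s_def by auto
  then obtain \<Gamma> where \<Gamma>: "finite \<Gamma>" "s - d * d < q \<Gamma>" by blast
  show ?thesis
  proof (intro exI[of _ \<Gamma>] conjI allI impI \<Gamma>(1))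
    fix \<Gamma>' :: "'d site set" assume \<Gamma>': "finite \<Gamma>'" "\<Gamma> \<subseteq> \<Gamma>'"
    note c = continuous_local_density[OF \<Gamma>(1), of \<rho> \<nu>] continuous_local_density[OF \<Gamma>'(1), of \<rho> \<nu>]
    note int = continuous_config_integrable[OF \<nu>]
    have loc: "local_on \<Gamma>' (?h \<Gamma>)"
      by (rule local_on_mono[OF local_on_local_density \<Gamma>'(2)])
    have 1: "(\<integral>\<eta>. ?h \<Gamma>' \<eta> * ?h \<Gamma>' \<eta> \<partial>\<nu>) = q \<Gamma>'"
      unfolding q_def by (rule integral_local_density[OF \<Gamma>'(1) local_on_local_density])
    \<comment> \<open>The smaller density is itself observed in \<open>\<Gamma>'\<close>, so the
      cross term reduces to \<open>q \<Gamma>\<close>; this is the Pythagorean identity.\<close>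
    have 2: "(\<integral>\<eta>. ?h \<Gamma> \<eta> * ?h \<Gamma>' \<eta> \<partial>\<nu>) = q \<Gamma>"
      unfolding q_def by (rule integral_local_density[OF \<Gamma>'(1) loc])
    have 3: "(\<integral>\<eta>. ?h \<Gamma> \<eta> * ?h \<Gamma> \<eta> \<partial>\<nu>) = q \<Gamma>"
      unfolding q_def by (rule integral_local_density[OF \<Gamma>(1) local_on_local_density])
    have "(\<integral>\<eta>. (?h \<Gamma>' \<eta> - ?h \<Gamma> \<eta>)\<^sup>2 \<partial>\<nu>)
        = (\<integral>\<eta>. ?h \<Gamma>' \<eta> * ?h \<Gamma>' \<eta> - 2 * (?h \<Gamma> \<eta> * ?h \<Gamma>' \<eta>) + ?h \<Gamma> \<eta> * ?h \<Gamma> \<eta> \<partial>\<nu>)"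
      by (intro Bochner_Integration.integral_cong refl) (simp add: power2_eq_square algebra_simps)
    also have "\<dots> = q \<Gamma>' - 2 * q \<Gamma> + q \<Gamma>"
      unfolding 1[symmetric] 2[symmetric] using 2 3
      by (subst Bochner_Integration.integral_add Bochner_Integration.integral_diff,
          (intro int continuous_intros c)+)+ simp
    also have "\<dots> \<le> d * d"
      using \<Gamma>(2) cSUP_upper[OF _ bdd, of \<Gamma>'] \<Gamma>'(1) unfolding s_def by simp
    finally have sq: "(\<integral>\<eta>. (?h \<Gamma>' \<eta> - ?h \<Gamma> \<eta>)\<^sup>2 \<partial>\<nu>) \<le> d * d" .
    have "(\<integral>\<eta>. \<bar>?h \<Gamma>' \<eta> - ?h \<Gamma> \<eta>\<bar> \<partial>\<nu>) \<le> (\<integral>\<eta>. (?h \<Gamma>' \<eta> - ?h \<Gamma> \<eta>)\<^sup>2 / d + d \<partial>\<nu>)"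
    proof (rule integral_mono)
      show "\<bar>?h \<Gamma>' \<eta> - ?h \<Gamma> \<eta>\<bar> \<le> (?h \<Gamma>' \<eta> - ?h \<Gamma> \<eta>)\<^sup>2 / d + d" for \<eta>
      proof -
        \<comment> \<open>The passage from L2 to L1 uses \<open>x \<le> x * x / d + d\<close>
          pointwise, so the squared bound \<open>d * d\<close> yields \<open>2 * d\<close>.\<close>
        define x where "x = \<bar>?h \<Gamma>' \<eta> - ?h \<Gamma> \<eta>\<bar>"
        have "x * d \<le> x * x + d * d"
        proof -
          have "0 \<le> x * d" using d unfolding x_def by (intro mult_nonneg_nonneg) simp_all
          moreover have "2 * (x * d) \<le> x * x + d * d"
            using sum_squares_bound[of x d] unfolding power2_eq_square by (simp only: mult.assoc)
          ultimately show ?thesis by linarith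
        qed
        then have "x \<le> x * x / d + d" using d by (simp add: field_simps)
        then show ?thesis unfolding x_def by (simp add: power2_eq_square)
      qed
    qed (intro int continuous_intros c; use d in simp)+
    also have "\<dots> = (\<integral>\<eta>. (?h \<Gamma>' \<eta> - ?h \<Gamma> \<eta>)\<^sup>2 / d \<partial>\<nu>) + (\<integral>\<eta>. d \<partial>\<nu>)"
      by (rule Bochner_Integration.integral_add; intro int continuous_intros c) (use d in auto)
    also have "\<dots> = (\<integral>\<eta>. (?h \<Gamma>' \<eta> - ?h \<Gamma> \<eta>)\<^sup>2 \<partial>\<nu>) / d + d"
      by (simp add: \<nu>.prob_space)
    also have "\<dots> \<le> 2 * d"
      using sq d by (simp add: field_simps)
    finally show "(\<integral>\<eta>. \<bar>?h \<Gamma>' \<eta> - ?h \<Gamma> \<eta>\<bar> \<partial>\<nu>) \<le> 2 * d" .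
  qed
qed

text \<open>The order of quantifiers matters: one \<open>\<Gamma>\<close> serves all test functions
  bounded by 1, so a test function may be translated by a vector that depends on
  \<open>\<Gamma>\<close>. The error collects \<open>d\<close> for making the test function local
  under \<rho>, \<open>2 * d\<close> for shrinking the volume of the density, and
  \<open>d * (1 / p)\<close> for undoing the localisation under \<nu>.\<close>

lemma local_density_approximates:
  assumes d: "d > 0"
  shows "\<exists>\<Gamma>. finite \<Gamma> \<and> (\<forall>\<phi>. continuous_on UNIV \<phi> \<longrightarrow> (\<forall>\<eta>. \<bar>\<phi> \<eta>\<bar> \<le> 1) \<longrightarrow>
      \<bar>(\<integral>\<eta>. \<phi> \<eta> \<partial>\<rho>) - (\<integral>\<eta>. \<phi> \<eta> * local_density \<rho> \<nu> \<Gamma> \<eta> \<partial>\<nu>)\<bar> \<le> 3 * d + d * (1 / p))"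
proof -
  interpret \<nu>: prob_space \<nu> by (rule prob_measuresD[OF \<nu>])
  let ?h = "local_density \<rho> \<nu>"
  obtain \<Gamma> where \<Gamma>: "finite \<Gamma>" "\<And>\<Gamma>'. finite \<Gamma>' \<Longrightarrow> \<Gamma> \<subseteq> \<Gamma>' \<Longrightarrow>
      (\<integral>\<eta>. \<bar>?h \<Gamma>' \<eta> - ?h \<Gamma> \<eta>\<bar> \<partial>\<nu>) \<le> 2 * d"
    using local_density_L1_Cauchy[OF d] by blast
  show ?thesis
  proof (intro exI[of _ \<Gamma>] conjI allI impI \<Gamma>(1))
    fix \<phi> :: "('d, 's) config \<Rightarrow> real"
    assume \<phi>: "continuous_on UNIV \<phi>" and "\<forall>\<eta>. \<bar>\<phi> \<eta>\<bar> \<le> 1"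
    then have \<phi>1: "\<bar>\<phi> \<eta>\<bar> \<le> 1" for \<eta> by blast
    obtain \<Gamma>\<^sub>0 \<psi> where \<psi>: "finite \<Gamma>\<^sub>0" "local_on \<Gamma>\<^sub>0 \<psi>" "\<And>\<eta>. \<bar>\<phi> \<eta> - \<psi> \<eta>\<bar> < d" "range \<psi> \<subseteq> range \<phi>"
      using local_approximation[OF \<phi> d] by metis
    have \<psi>1: "\<bar>\<psi> \<eta>\<bar> \<le> 1" for \<eta>
      using \<psi>(4) \<phi>1 by (metis rangeI rangeE subsetD)
    \<comment> \<open>In a volume that contains both \<open>\<Gamma>\<close> and the support of the
      local approximant, the density represents \<rho> exactly.\<close>
    define \<Gamma>' where "\<Gamma>' = \<Gamma> \<union> \<Gamma>\<^sub>0"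
    have \<Gamma>': "finite \<Gamma>'" "\<Gamma> \<subseteq> \<Gamma>'" using \<Gamma>(1) \<psi>(1) by (auto simp: \<Gamma>'_def)
    have \<psi>': "local_on \<Gamma>' \<psi>" by (rule local_on_mono[OF \<psi>(2)]) (simp add: \<Gamma>'_def)
    have c\<psi>: "continuous_on UNIV \<psi>" by (rule local_on_continuous[OF \<psi>(1,2)])
    note c = continuous_local_density[OF \<Gamma>(1), of \<rho> \<nu>] continuous_local_density[OF \<Gamma>'(1), of \<rho> \<nu>]
    note int = continuous_config_integrable[OF \<nu>]
    have 1: "\<bar>(\<integral>\<eta>. \<phi> \<eta> \<partial>\<rho>) - (\<integral>\<eta>. \<psi> \<eta> \<partial>\<rho>)\<bar> \<le> d"
      by (rule integral_diff_le[OF \<rho> \<phi> c\<psi> less_imp_le[OF \<psi>(3)]])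
    have 2: "(\<integral>\<eta>. \<psi> \<eta> * ?h \<Gamma>' \<eta> \<partial>\<nu>) = (\<integral>\<eta>. \<psi> \<eta> \<partial>\<rho>)"
      by (rule integral_local_density[OF \<Gamma>'(1) \<psi>'])
    have "\<bar>(\<integral>\<eta>. \<psi> \<eta> * ?h \<Gamma>' \<eta> \<partial>\<nu>) - (\<integral>\<eta>. \<psi> \<eta> * ?h \<Gamma> \<eta> \<partial>\<nu>)\<bar>
        = \<bar>\<integral>\<eta>. \<psi> \<eta> * ?h \<Gamma>' \<eta> - \<psi> \<eta> * ?h \<Gamma> \<eta> \<partial>\<nu>\<bar>"
      by (subst Bochner_Integration.integral_diff; intro int continuous_intros c\<psi> c refl)
    also have "\<dots> \<le> (\<integral>\<eta>. \<bar>\<psi> \<eta> * ?h \<Gamma>' \<eta> - \<psi> \<eta> * ?h \<Gamma> \<eta>\<bar> \<partial>\<nu>)"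
      by (rule integral_abs_bound)
    also have "\<dots> \<le> (\<integral>\<eta>. \<bar>?h \<Gamma>' \<eta> - ?h \<Gamma> \<eta>\<bar> \<partial>\<nu>)"
    proof (rule integral_mono)
      show "\<bar>\<psi> \<eta> * ?h \<Gamma>' \<eta> - \<psi> \<eta> * ?h \<Gamma> \<eta>\<bar> \<le> \<bar>?h \<Gamma>' \<eta> - ?h \<Gamma> \<eta>\<bar>" for \<eta>
        unfolding right_diff_distrib[symmetric] abs_mult
        by (rule mult_left_le_one_le[OF abs_ge_zero abs_ge_zero \<psi>1])
    qed (intro int continuous_intros c c\<psi>)+
    also have "\<dots> \<le> 2 * d" by (rule \<Gamma>(2)[OF \<Gamma>'])
    finally have 3: "\<bar>(\<integral>\<eta>. \<psi> \<eta> * ?h \<Gamma>' \<eta> \<partial>\<nu>) - (\<integral>\<eta>. \<psi> \<eta> * ?h \<Gamma> \<eta> \<partial>\<nu>)\<bar> \<le> 2 * d" .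
    have 4: "\<bar>(\<integral>\<eta>. \<phi> \<eta> * ?h \<Gamma> \<eta> \<partial>\<nu>) - (\<integral>\<eta>. \<psi> \<eta> * ?h \<Gamma> \<eta> \<partial>\<nu>)\<bar> \<le> d * (1 / p)"
    proof (rule integral_diff_le[OF \<nu>])
      fix \<eta>
      have "\<bar>\<phi> \<eta> * ?h \<Gamma> \<eta> - \<psi> \<eta> * ?h \<Gamma> \<eta>\<bar> = \<bar>\<phi> \<eta> - \<psi> \<eta>\<bar> * ?h \<Gamma> \<eta>"
        unfolding left_diff_distrib[symmetric] abs_mult using local_density_bounds(1)[OF \<Gamma>(1)] by simp
      also have "\<dots> \<le> d * (1 / p)"
        using d p by (intro mult_mono less_imp_le[OF \<psi>(3)] local_density_bounds[OF \<Gamma>(1)]) auto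
      finally show "\<bar>\<phi> \<eta> * ?h \<Gamma> \<eta> - \<psi> \<eta> * ?h \<Gamma> \<eta>\<bar> \<le> d * (1 / p)" .
    qed (intro continuous_intros c c\<psi> \<phi>)+
    show "\<bar>(\<integral>\<eta>. \<phi> \<eta> \<partial>\<rho>) - (\<integral>\<eta>. \<phi> \<eta> * ?h \<Gamma> \<eta> \<partial>\<nu>)\<bar> \<le> 3 * d + d * (1 / p)"
      using 1 2 3 4 by linarith
  qed
qed

text \<open>The DLR defect \<open>\<phi>\<close> is translated first, which leaves its
  \<rho>-integral unchanged. Replacing \<rho> by the local density costs a small error, and
  translating back under \<nu> moves the density off \<open>\<Lambda>\<close>, where orthogonality
  makes the integral vanish. Both measures therefore have to be translation invariant.\<close>

lemma gibbs_measure_of_dominated: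
  assumes \<Phi>: "ti_abs_summable_potential \<Phi>"
    and ti: "translation_invariant \<rho>" "translation_invariant \<nu>" and gibbs: "gibbs_measure \<Phi> \<nu>"
  shows "gibbs_measure \<Phi> \<rho>"
  unfolding gibbs_measure_iff[OF \<Phi> \<rho>]
proof (intro allI impI ballI)
  fix \<Lambda> :: "'d site set" and A :: "('d, 's) config set"
  assume \<Lambda>: "finite \<Lambda>" and A: "A \<in> local_sets"
  define \<phi> where "\<phi> = (\<lambda>\<eta>. indicator A \<eta> - measure (gibbs_kernel \<Phi> \<Lambda> \<eta>) A)"
  note cA = continuous_indicator_local[OF A] continuous_gibbs_kernel[OF \<Phi> \<Lambda> A]
  have c\<phi>: "continuous_on UNIV \<phi>"
    unfolding \<phi>_def by (intro continuous_on_diff cA)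
  have \<phi>1: "\<bar>\<phi> \<eta>\<bar> \<le> 1" for \<eta>
    using prob_space.prob_le_1[OF gibbs_kernel_prob_space[OF \<Lambda>], of \<Phi> \<eta> A]
    unfolding \<phi>_def by (auto simp: indicator_def)
  have bound: "\<bar>\<integral>\<eta>. \<phi> \<eta> \<partial>\<rho>\<bar> \<le> 3 * d + d * (1 / p)" if d: "d > 0" for d
  proof -
    obtain \<Gamma> where \<Gamma>: "finite \<Gamma>" and approx: "\<forall>\<phi>. continuous_on UNIV \<phi> \<longrightarrow> (\<forall>\<eta>. \<bar>\<phi> \<eta>\<bar> \<le> 1) \<longrightarrow>
      \<bar>(\<integral>\<eta>. \<phi> \<eta> \<partial>\<rho>) - (\<integral>\<eta>. \<phi> \<eta> * local_density \<rho> \<nu> \<Gamma> \<eta> \<partial>\<nu>)\<bar> \<le> 3 * d + d * (1 / p)"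
      using local_density_approximates[OF d] by blast
    \<comment> \<open>The vector is chosen after \<open>\<Gamma>\<close>, as the uniform
      approximation permits.\<close>
    obtain v where v: "(\<lambda>x. x + v) ` \<Gamma> \<inter> \<Lambda> = {}"
      using finite_translate_disjoint[OF \<Gamma> \<Lambda>] by metis
    let ?\<phi> = "\<lambda>\<eta>. \<phi> (shift (- v) \<eta>)" and ?h = "local_density \<rho> \<nu> \<Gamma>"
    have c: "continuous_on UNIV ?\<phi>"
      by (rule continuous_on_compose2[OF c\<phi> continuous_shift]) simp
    have "(\<integral>\<eta>. ?\<phi> \<eta> * ?h \<eta> \<partial>\<nu>) = (\<integral>\<eta>. ?\<phi> (shift v \<eta>) * ?h (shift v \<eta>) \<partial>\<nu>)"
      by (rule integral_shift[OF \<nu> ti(2), symmetric])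
         (intro continuous_on_mult c continuous_local_density \<Gamma>)
    also have "\<dots> = (\<integral>\<eta>. ?h (shift v \<eta>) * \<phi> \<eta> \<partial>\<nu>)"
      by (simp add: shift_shift shift_zero mult.commute)
    also have "\<dots> = 0"
      unfolding \<phi>_def
    proof (rule integral_local_times_gibbs[OF \<Phi> \<nu> gibbs \<Lambda> _ _ v A])
      show "finite ((\<lambda>x. x + v) ` \<Gamma>)" using \<Gamma> by simp
      show "local_on ((\<lambda>x. x + v) ` \<Gamma>) (\<lambda>\<eta>. ?h (shift v \<eta>))"
        by (rule local_onI, rule local_onD[OF local_on_local_density]) (simp add: shift_def)
    qed
    finally have "(\<integral>\<eta>. ?\<phi> \<eta> * ?h \<eta> \<partial>\<nu>) = 0" .
    moreover have "(\<integral>\<eta>. ?\<phi> \<eta> \<partial>\<rho>) = (\<integral>\<eta>. \<phi> \<eta> \<partial>\<rho>)"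
      by (rule integral_shift[OF \<rho> ti(1) c\<phi>])
    ultimately show ?thesis
      using approx[rule_format, OF c \<phi>1] by simp
  qed
  have "\<bar>\<integral>\<eta>. \<phi> \<eta> \<partial>\<rho>\<bar> \<le> 0"
  proof (rule field_le_epsilon)
    fix e :: real assume e: "e > 0"
    have pos: "3 + 1 / p > 0" using p by (simp add: add_pos_pos)
    have "\<bar>\<integral>\<eta>. \<phi> \<eta> \<partial>\<rho>\<bar> \<le> 3 * (e / (3 + 1 / p)) + e / (3 + 1 / p) * (1 / p)"
      by (rule bound) (use e pos in simp)
    also have "\<dots> = (e / (3 + 1 / p)) * (3 + 1 / p)" by (simp only: distrib_left distrib_right mult.commute)
    also have "\<dots> = e" using pos by simp
    finally show "\<bar>\<integral>\<eta>. \<phi> \<eta> \<partial>\<rho>\<bar> \<le> 0 + e" by simp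
  qed
  moreover have "(\<integral>\<eta>. \<phi> \<eta> \<partial>\<rho>) = (\<integral>\<eta>. indicator A \<eta> \<partial>\<rho>) - (\<integral>\<eta>. measure (gibbs_kernel \<Phi> \<Lambda> \<eta>) A \<partial>\<rho>)"
    unfolding \<phi>_def by (intro Bochner_Integration.integral_diff continuous_config_integrable[OF \<rho>] cA)
  ultimately show "(\<integral>\<eta>. measure (gibbs_kernel \<Phi> \<Lambda> \<eta>) A \<partial>\<rho>) = measure \<rho> A"
    unfolding integral_indicator_config[OF \<rho>] by simp
qed

end

section \<open>Limits of time averages\<close>

text \<open>Accumulating along a filter, all averages converge at once and no diagonal sequence is needed.\<close>

lemma simultaneous_filter_limit:
  fixes a :: "nat \<Rightarrow> 'i \<Rightarrow> real"
  assumes bounds: "\<And>m i. 0 \<le> a m i" "\<And>m i. a m i \<le> 1"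
  obtains F y where "F \<noteq> bot" "F \<le> sequentially" "\<And>i. ((\<lambda>m. a m i) \<longlongrightarrow> y i) F"
proof -
  let ?U = "\<Pi>\<^sub>E i\<in>(UNIV :: 'i set). {0..1 :: real}"
  have "compactin (product_topology (\<lambda>i. euclidean) UNIV) ?U"
    unfolding compactin_PiE by simp
  then have U: "compact ?U" by (simp add: euclidean_product_topology)
  have "filtermap a sequentially \<noteq> bot" by (simp add: filtermap_bot_iff)
  moreover have "eventually (\<lambda>z. z \<in> ?U) (filtermap a sequentially)"
    using bounds by (simp add: eventually_filtermap PiE_iff)
  ultimately obtain y where y: "inf (nhds y) (filtermap a sequentially) \<noteq> bot"
    using U unfolding compact_filter by blast
  \<comment> \<open>The neighbourhoods of the cluster point are pulled back to the indices. Being a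
    cluster point is exactly what keeps this filter proper.\<close>
  define F where "F = inf sequentially (filtercomap a (nhds y))"
  have "F \<noteq> bot"
  proof
    assume "F = bot"
    then have "eventually (\<lambda>_. False) F" by simp
    then obtain P Q where PQ: "eventually P sequentially" "eventually Q (filtercomap a (nhds y))"
        "\<And>m. P m \<Longrightarrow> Q m \<Longrightarrow> False"
      unfolding F_def eventually_inf by blast
    obtain R where R: "eventually R (nhds y)" "\<And>m. R (a m) \<Longrightarrow> Q m"
      using PQ(2) unfolding eventually_filtercomap by blast
    have "eventually (\<lambda>z. \<exists>m. P m \<and> z = a m) (filtermap a sequentially)"
      unfolding eventually_filtermap using PQ(1) by eventually_elim blast
    with R(1) have "eventually (\<lambda>_. False) (inf (nhds y) (filtermap a sequentially))"
      unfolding eventually_inf using PQ(3) R(2) by blast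
    then show False using y by (simp add: eventually_False)
  qed
  moreover have "F \<le> sequentially" unfolding F_def by simp
  moreover have "((\<lambda>m. a m i) \<longlongrightarrow> y i) F" for i
  proof -
    have "filterlim a (nhds y) F"
      by (rule filterlim_mono[OF filterlim_filtercomap order_refl]) (simp add: F_def)
    then show ?thesis
      by (rule continuous_on_tendsto_compose[OF continuous_on_product_coordinates]) auto
  qed
  ultimately show ?thesis by (rule that)
qed

section \<open>Averages, finite families of events and a pigeonhole principle\<close>

lemma average_add: "average S (\<lambda>t. a t + b t) = average S a + average S b"
  by (simp add: average_def sum.distrib add_divide_distrib)

lemma average_mono: "(\<And>t. t \<in> S \<Longrightarrow> a t \<le> b t) \<Longrightarrow> average S a \<le> average S b"
  unfolding average_def by (intro divide_right_mono sum_mono) auto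

lemma average_const: "finite S \<Longrightarrow> S \<noteq> {} \<Longrightarrow> average S (\<lambda>_. c) = c"
  by (simp add: average_def)

lemma average_cmult: "average S (\<lambda>t. c * a t) = c * average S a"
  by (simp add: average_def sum_distrib_left)

lemma average_cong: "(\<And>t. t \<in> S \<Longrightarrow> a t = b t) \<Longrightarrow> average S a = average S b"
  unfolding average_def by (simp cong: sum.cong)

text \<open>A local event is recovered from its trace on the finitely many local configurations,
  since restriction to \<open>\<Gamma>\<close> decides membership.\<close>

lemma finite_local_on_sets:
  assumes "finite \<Gamma>"
  shows "finite {A :: ('d::finite, 's::finite) config set. local_on \<Gamma> (\<lambda>\<omega>. \<omega> \<in> A)}"
proof (rule finite_imageD[of "\<lambda>A. A \<inter> (\<Gamma> \<rightarrow>\<^sub>E UNIV)"])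
  show "finite ((\<lambda>A. A \<inter> (\<Gamma> \<rightarrow>\<^sub>E (UNIV :: 's set))) ` {A :: ('d, 's) config set. local_on \<Gamma> (\<lambda>\<omega>. \<omega> \<in> A)})"
    using finite_configs[OF assms]
    by (intro finite_subset[OF _ finite_Pow_iff[THEN iffD2]]) auto
  show "inj_on (\<lambda>A. A \<inter> (\<Gamma> \<rightarrow>\<^sub>E (UNIV :: 's set))) {A :: ('d, 's) config set. local_on \<Gamma> (\<lambda>\<omega>. \<omega> \<in> A)}"
  proof (rule inj_onI)
    fix A B :: "('d, 's) config set"
    assume A: "A \<in> {A. local_on \<Gamma> (\<lambda>\<omega>. \<omega> \<in> A)}" and B: "B \<in> {A. local_on \<Gamma> (\<lambda>\<omega>. \<omega> \<in> A)}"
      and eq: "A \<inter> (\<Gamma> \<rightarrow>\<^sub>E UNIV) = B \<inter> (\<Gamma> \<rightarrow>\<^sub>E UNIV)"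
    show "A = B"
    proof (rule set_eqI)
      fix \<omega> :: "('d, 's) config"
      have mem: "restrict \<omega> \<Gamma> \<in> \<Gamma> \<rightarrow>\<^sub>E UNIV" by simp
      have "(\<omega> \<in> A) = (restrict \<omega> \<Gamma> \<in> A)" "(\<omega> \<in> B) = (restrict \<omega> \<Gamma> \<in> B)"
        using local_on_restrict[of \<Gamma> "\<lambda>\<omega>. \<omega> \<in> A" \<omega>] local_on_restrict[of \<Gamma> "\<lambda>\<omega>. \<omega> \<in> B" \<omega>] A B by simp_all
      then show "\<omega> \<in> A \<longleftrightarrow> \<omega> \<in> B" using eq mem by blast
    qed
  qed
qed

text \<open>Split off one colour: by subadditivity either its class or the remainder has positive
  value, and the remainder uses fewer colours.\<close>

lemma subadditive_pigeonhole:
  fixes d :: "'a set \<Rightarrow> real"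
  assumes sub: "\<And>U V. d (U \<union> V) \<le> d U + d V" and "finite J" "f ` U \<subseteq> J" "d U > 0" "d {} = 0"
  shows "\<exists>j. d (U \<inter> f -` {j}) > 0"
  using assms(2-4)
proof (induction J arbitrary: U)
  case empty
  then show ?case using assms(5) by simp
next
  case (insert j J)
  let ?V = "U \<inter> f -` {j}" and ?W = "U - f -` {j}"
  have "?V \<union> ?W = U" by blast
  then have "d U \<le> d ?V + d ?W" using sub[of ?V ?W] by simp
  then consider "d ?V > 0" | "d ?W > 0" using insert.prems(2) by linarith
  then show ?case
  proof cases
    case 2
    have "f ` ?W \<subseteq> J" using insert.prems(1) by blast
    from insert.IH[OF this 2] obtain i where i: "d (?W \<inter> f -` {i}) > 0" by blast
    \<comment> \<open>Positivity excludes the empty class, so colour \<open>i\<close> really occurs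
      in the remainder and differs from \<open>j\<close>; its class is thus unaffected by the
      removal.\<close>
    then have "?W \<inter> f -` {i} \<noteq> {}" using assms(5) by force
    then have "i \<noteq> j" by blast
    then have "?W \<inter> f -` {i} = U \<inter> f -` {i}" by blast
    with i have "d (U \<inter> f -` {i}) > 0" by (simp only:)
    then show ?thesis by (rule exI)
  qed blast
qed

text \<open>Along \<open>F\<close>, \<open>y U UNIV\<close> is the density of the set of times
  \<open>U\<close>, and \<open>y U A\<close> is the share of the limiting average probability of
  \<open>A\<close> that is due to times in \<open>U\<close>. Every subset of times is covered
  because the relevant ones are selected only after the limits exist. The condition
  \<open>sparse\<close> gives density zero to the times before any threshold
  \<open>B k\<close>.\<close>

locale averaged_limits =
  fixes X :: "'t::linorder \<Rightarrow> ('d::finite, 's::{finite, discrete_topology}) config measure"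
    and T :: "'t set" and S :: "nat \<Rightarrow> 't set" and B :: "nat \<Rightarrow> 't"
    and F :: "nat filter" and y :: "'t set \<Rightarrow> ('d, 's) config set \<Rightarrow> real"
  assumes X: "\<And>t. t \<in> T \<Longrightarrow> X t \<in> prob_measures" "\<And>t. t \<in> T \<Longrightarrow> translation_invariant (X t)"
    and S: "\<And>m. finite (S m)" "\<And>m. S m \<noteq> {}" "\<And>m. S m \<subseteq> T"
    and B: "filterlim B at_top sequentially"
    and sparse: "\<And>k. (\<lambda>m. average (S m) (\<lambda>t. of_bool (t < B k))) \<longlonglongrightarrow> 0"
    and F: "F \<noteq> bot" "F \<le> sequentially"
    and y: "\<And>U A. ((\<lambda>m. average (S m) (\<lambda>t. of_bool (t \<in> U) * measure (X t) A)) \<longlongrightarrow> y U A) F"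
begin

lemma X_prob_space: "t \<in> T \<Longrightarrow> prob_space (X t)"
  by (rule prob_measuresD(1)[OF X(1)])

lemma y_eqI:
  assumes "((\<lambda>m. average (S m) (\<lambda>t. of_bool (t \<in> U) * measure (X t) A)) \<longlongrightarrow> c) F"
  shows "y U A = c"
  by (rule tendsto_unique[OF F(1) y assms])

lemma y_mono:
  assumes "\<And>t. t \<in> T \<Longrightarrow> of_bool (t \<in> U) * measure (X t) A \<le> of_bool (t \<in> V) * measure (X t) A'"
  shows "y U A \<le> y V A'"
proof (rule tendsto_le[OF F(1) y y])
  show "\<forall>\<^sub>F m in F. average (S m) (\<lambda>t. of_bool (t \<in> U) * measure (X t) A)
      \<le> average (S m) (\<lambda>t. of_bool (t \<in> V) * measure (X t) A')"
    using assms S(3) by (intro always_eventually allI average_mono) blast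
qed

lemma y_empty: "y {} A = 0"
  by (rule y_eqI) (simp add: average_def)

lemma y_nonneg: "0 \<le> y U A"
  using y_mono[of "{}" A U A] by (simp add: y_empty)

lemma y_Un_disjoint_sets:
  assumes "A \<in> local_sets" "A' \<in> local_sets" "A \<inter> A' = {}"
  shows "y U (A \<union> A') = y U A + y U A'"
proof (rule y_eqI)
  have "average (S m) (\<lambda>t. of_bool (t \<in> U) * measure (X t) (A \<union> A'))
      = average (S m) (\<lambda>t. of_bool (t \<in> U) * measure (X t) A) + average (S m) (\<lambda>t. of_bool (t \<in> U) * measure (X t) A')" for m
    unfolding average_add[symmetric]
  proof (rule average_cong)
    fix t assume "t \<in> S m"
    then have t: "t \<in> T" using S(3) by blast
    interpret prob_space "X t" by (rule X_prob_space[OF t])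
    have "measure (X t) (A \<union> A') = measure (X t) A + measure (X t) A'"
      using borel_local_sets[OF assms(1)] borel_local_sets[OF assms(2)] prob_measuresD(2)[OF X(1)[OF t]] assms(3)
      by (intro finite_measure_Union) simp_all
    then show "of_bool (t \<in> U) * measure (X t) (A \<union> A')
        = of_bool (t \<in> U) * measure (X t) A + of_bool (t \<in> U) * measure (X t) A'"
      by (simp add: distrib_left)
  qed
  then show "((\<lambda>m. average (S m) (\<lambda>t. of_bool (t \<in> U) * measure (X t) (A \<union> A'))) \<longlongrightarrow> y U A + y U A') F"
    using tendsto_add[OF y[of U A] y[of U A']] by simp
qed

lemma y_subadditive: "y (U \<union> V) A \<le> y U A + y V A"
proof (rule tendsto_le[OF F(1) tendsto_add[OF y y] y])
  show "\<forall>\<^sub>F m in F. average (S m) (\<lambda>t. of_bool (t \<in> U \<union> V) * measure (X t) A)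
      \<le> average (S m) (\<lambda>t. of_bool (t \<in> U) * measure (X t) A) + average (S m) (\<lambda>t. of_bool (t \<in> V) * measure (X t) A)"
    unfolding average_add[symmetric]
    by (intro always_eventually allI average_mono) auto
qed

lemma y_shift:
  assumes "A \<in> local_sets"
  shows "y U (shift u -` A) = y U A"
proof (rule y_eqI)
  have "average (S m) (\<lambda>t. of_bool (t \<in> U) * measure (X t) (shift u -` A))
      = average (S m) (\<lambda>t. of_bool (t \<in> U) * measure (X t) A)" for m
  proof (rule average_cong)
    fix t assume "t \<in> S m"
    then have t: "t \<in> T" using S(3) by blast
    show "of_bool (t \<in> U) * measure (X t) (shift u -` A) = of_bool (t \<in> U) * measure (X t) A"
      using X(2)[OF t] assms unfolding translation_invariant_iff_local[OF X(1)[OF t]] by simp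
  qed
  then show "((\<lambda>m. average (S m) (\<lambda>t. of_bool (t \<in> U) * measure (X t) (shift u -` A))) \<longlongrightarrow> y U A) F"
    using y[of U A] by simp
qed

lemma X_UNIV: "t \<in> T \<Longrightarrow> measure (X t) UNIV = 1"
  using prob_space.prob_space[OF X_prob_space] prob_measuresD(3)[OF X(1)] by metis

lemma y_UNIV: "y UNIV UNIV = 1"
proof (rule y_eqI)
  have "average (S m) (\<lambda>t. of_bool (t \<in> UNIV) * measure (X t) UNIV) = average (S m) (\<lambda>t. 1)" for m
    using X_UNIV S(3) by (intro average_cong) auto
  then show "((\<lambda>m. average (S m) (\<lambda>t. of_bool (t \<in> UNIV) * measure (X t) UNIV)) \<longlongrightarrow> 1) F"
    using average_const[OF S(1,2)] by simp
qed

lemma y_sparse: "y {t. t < B k} UNIV = 0"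
proof (rule y_eqI)
  have "average (S m) (\<lambda>t. of_bool (t \<in> {t. t < B k}) * measure (X t) UNIV)
      = average (S m) (\<lambda>t. of_bool (t < B k))" for m
    using X_UNIV S(3) by (intro average_cong) auto
  then show "((\<lambda>m. average (S m) (\<lambda>t. of_bool (t \<in> {t. t < B k}) * measure (X t) UNIV)) \<longlongrightarrow> 0) F"
    using tendsto_mono[OF F(2) sparse[of k]] by simp
qed

text \<open>Times before \<open>B k\<close> have density zero, so a set of positive density reaches
  beyond it. This is what lets the selected times tend to infinity.\<close>

lemma y_positive_nonempty:
  assumes "y U UNIV > 0"
  obtains t where "t \<in> U" "t \<in> T" "B k \<le> t"
proof -
  have "\<exists>t. t \<in> U \<and> t \<in> T \<and> \<not> t < B k"
  proof (rule ccontr)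
    assume "\<not> ?thesis"
    then have "y U UNIV \<le> y {t. t < B k} UNIV"
      by (intro y_mono) (auto simp: of_bool_def)
    then show False using assms y_sparse[of k] by simp
  qed
  then show ?thesis using that by auto
qed

text \<open>An average of nearly constant values is near that constant. Both sides are multiplied by
  the density, so no division occurs.\<close>

lemma y_close:
  assumes "\<And>t. t \<in> U \<Longrightarrow> t \<in> T \<Longrightarrow> \<bar>measure (X t) A - c\<bar> \<le> e"
  shows "\<bar>y U A - c * y U UNIV\<bar> \<le> e * y U UNIV"
proof -
  have le: "(c - e) * y U UNIV \<le> y U A" "y U A \<le> (c + e) * y U UNIV"
  proof -
    have lim: "((\<lambda>m. average (S m) (\<lambda>t. r * (of_bool (t \<in> U) * measure (X t) UNIV))) \<longlongrightarrow> r * y U UNIV) F" for r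
      unfolding average_cmult by (intro tendsto_mult tendsto_const y)
    have "(c - e) * (of_bool (t \<in> U) * measure (X t) UNIV) \<le> of_bool (t \<in> U) * measure (X t) A"
         "of_bool (t \<in> U) * measure (X t) A \<le> (c + e) * (of_bool (t \<in> U) * measure (X t) UNIV)"
      if "t \<in> S m" for t m
    proof -
      have t: "t \<in> T" using that S(3) by blast
      show "(c - e) * (of_bool (t \<in> U) * measure (X t) UNIV) \<le> of_bool (t \<in> U) * measure (X t) A"
           "of_bool (t \<in> U) * measure (X t) A \<le> (c + e) * (of_bool (t \<in> U) * measure (X t) UNIV)"
        using assms[of t] t X_UNIV[OF t] by (cases "t \<in> U"; simp add: abs_le_iff)+
    qed
    note ptw = this
    show "(c - e) * y U UNIV \<le> y U A"
      by (rule tendsto_le[OF F(1) y lim]) (intro always_eventually allI average_mono ptw(1))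
    show "y U A \<le> (c + e) * y U UNIV"
      by (rule tendsto_le[OF F(1) lim y]) (intro always_eventually allI average_mono ptw(2))
  qed
  then show ?thesis
    unfolding abs_le_iff left_diff_distrib distrib_right by linarith
qed

text \<open>Colour each time by the vector of its probabilities of the events in
  \<open>\<A>\<close>, rounded down to multiples of \<open>e\<close>. There are finitely many
  colours, so one class has positive density, and within a class no probability varies by more than
  \<open>e\<close>.\<close>

lemma refine_times:
  assumes U: "y U UNIV > 0" and \<A>: "finite \<A>" and e: "e > 0"
  obtains V where "V \<subseteq> U" "y V UNIV > 0" "V \<subseteq> T"
    "\<And>A s t. A \<in> \<A> \<Longrightarrow> s \<in> V \<Longrightarrow> t \<in> V \<Longrightarrow> \<bar>measure (X s) A - measure (X t) A\<bar> \<le> e"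
proof -
  define f where "f = (\<lambda>t. restrict (\<lambda>A. \<lfloor>measure (X t) A / e\<rfloor>) \<A>)"
  \<comment> \<open>Only at times in \<open>T\<close> is \<open>X\<close> known to be a probability
    measure, which bounds the number of colours.\<close>
  have UT: "y (U \<inter> T) UNIV > 0"
  proof -
    have "y U UNIV \<le> y (U \<inter> T) UNIV" by (rule y_mono) simp
    with U show ?thesis by simp
  qed
  have "f ` (U \<inter> T) \<subseteq> \<A> \<rightarrow>\<^sub>E {0..\<lfloor>1 / e\<rfloor>}"
  proof (rule image_subsetI)
    fix t assume "t \<in> U \<inter> T"
    then interpret prob_space "X t" using X_prob_space by blast
    have "\<lfloor>measure (X t) A / e\<rfloor> \<in> {0..\<lfloor>1 / e\<rfloor>}" for A
      using e prob_le_1[of A] by (auto intro!: floor_mono divide_right_mono)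
    then show "f t \<in> \<A> \<rightarrow>\<^sub>E {0..\<lfloor>1 / e\<rfloor>}" unfolding f_def by simp
  qed
  moreover have "finite (\<A> \<rightarrow>\<^sub>E {0..\<lfloor>1 / e\<rfloor>})"
    using \<A> by (intro finite_PiE) auto
  ultimately obtain j where j: "y ((U \<inter> T) \<inter> f -` {j}) UNIV > 0"
    using subadditive_pigeonhole[of "\<lambda>U. y U UNIV" "\<A> \<rightarrow>\<^sub>E {0..\<lfloor>1 / e\<rfloor>}" f "U \<inter> T", OF y_subadditive _ _ UT y_empty]
    by blast
  show ?thesis
  proof (rule that[OF _ j])
    fix A s t assume A: "A \<in> \<A>" and "s \<in> (U \<inter> T) \<inter> f -` {j}" "t \<in> (U \<inter> T) \<inter> f -` {j}"
    then have "f s A = f t A" by simp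
    then have "\<lfloor>measure (X s) A / e\<rfloor> = \<lfloor>measure (X t) A / e\<rfloor>" using A by (simp add: f_def)
    then have "\<bar>measure (X s) A / e - measure (X t) A / e\<bar> \<le> 1" by linarith
    then show "\<bar>measure (X s) A - measure (X t) A\<bar> \<le> e"
      using e unfolding diff_divide_distrib[symmetric] abs_divide by (simp add: divide_le_eq)
  qed blast+
qed

text \<open>The normalised limiting average over \<open>U\<close>. Additivity on local events
  suffices for a measure, and each averaged law contributes its translation invariance.\<close>

lemma extend_average:
  assumes U: "y U UNIV > 0"
  obtains \<rho> where "\<rho> \<in> prob_measures" "translation_invariant \<rho>"
    "\<And>A. A \<in> local_sets \<Longrightarrow> y U UNIV * measure \<rho> A = y U A"
proof -
  obtain \<rho> where \<rho>: "\<rho> \<in> prob_measures" "\<And>A. A \<in> local_sets \<Longrightarrow> measure \<rho> A = y U A / y U UNIV"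
  proof (rule extend_local_content[of "\<lambda>A. y U A / y U UNIV"])
    show "0 \<le> y U A / y U UNIV" for A by (intro divide_nonneg_nonneg y_nonneg)
    show "y U (A \<union> A') / y U UNIV = y U A / y U UNIV + y U A' / y U UNIV"
      if "A \<in> local_sets" "A' \<in> local_sets" "A \<inter> A' = {}" for A A'
      unfolding y_Un_disjoint_sets[OF that] by (rule add_divide_distrib)
    show "y U UNIV / y U UNIV = 1" using U by simp
  qed blast
  have "translation_invariant \<rho>"
    unfolding translation_invariant_iff_local[OF \<rho>(1)]
    using \<rho>(2) y_shift local_sets_shift by metis
  then show ?thesis
    using \<rho> U by (intro that[of \<rho>]) simp_all
qed

text \<open>The dynamics enters only through the assumption that the limit of the full averages is
  Gibbs. Nested sets \<open>U k\<close> of positive density, on which ever more events have ever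
  less varying probabilities, produce a limit point both as a limit of single laws
  \<open>X (\<tau> k)\<close> and as a limit of the averages over \<open>U k\<close>: the former
  places it on the trajectory, the latter makes it Gibbs.\<close>

lemma exists_gibbs_limit_point:
  fixes \<Phi> :: "('d, 's) potential"
  assumes \<Phi>: "ti_abs_summable_potential \<Phi>"
    and gibbs: "\<And>\<nu>. \<nu> \<in> prob_measures \<Longrightarrow> translation_invariant \<nu> \<Longrightarrow>
      (\<And>A. A \<in> local_sets \<Longrightarrow> ((\<lambda>m. average (S m) (\<lambda>t. measure (X t) A)) \<longlongrightarrow> measure \<nu> A) F) \<Longrightarrow>
      gibbs_measure \<Phi> \<nu>"
  shows "\<exists>\<nu>\<in>weak_limit_points X. translation_invariant \<nu> \<and> gibbs_measure \<Phi> \<nu>"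
proof -
  obtain \<mu> where \<mu>: "\<mu> \<in> prob_measures" "translation_invariant \<mu>"
      "\<And>A. A \<in> local_sets \<Longrightarrow> measure \<mu> A = y UNIV A"
    using extend_average[of UNIV] unfolding y_UNIV by (metis mult_1 zero_less_one)
  have "((\<lambda>m. average (S m) (\<lambda>t. measure (X t) A)) \<longlongrightarrow> y UNIV A) F" for A
    using y[of UNIV A] by simp
  then have gibbs_\<mu>: "gibbs_measure \<Phi> \<mu>"
    by (intro gibbs \<mu>(1,2)) (simp only: \<mu>(3))
  \<comment> \<open>Finite families exhausting the local events, so that each event is controlled
    from some stage on.\<close>
  define \<A> where "\<A> = (\<lambda>k. {A :: ('d, 's) config set. local_on (cube k) (\<lambda>\<omega>. \<omega> \<in> A)})"
  have \<A>: "finite (\<A> k)" for k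
    unfolding \<A>_def by (rule finite_local_on_sets[OF finite_cube])
  have \<A>_mono: "\<A> k \<subseteq> \<A> l" if "k \<le> l" for k l
    unfolding \<A>_def using local_on_mono[OF _ cube_mono[OF that]] by blast
  have \<A>_local: "\<exists>k. A \<in> \<A> k" if "A \<in> local_sets" for A
  proof -
    obtain \<Gamma> where \<Gamma>: "finite \<Gamma>" "local_on \<Gamma> (\<lambda>\<omega>. \<omega> \<in> A)" using \<open>A \<in> local_sets\<close> by (rule local_setsE)
    obtain n where "\<Gamma> \<subseteq> cube n" using finite_subset_cube[OF \<Gamma>(1)] .
    then show ?thesis unfolding \<A>_def using local_on_mono[OF \<Gamma>(2)] by blast
  qed
  define P where "P = (\<lambda>k U. y U UNIV > 0 \<and> U \<subseteq> T \<and>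
    (\<forall>A\<in>\<A> k. \<forall>s\<in>U. \<forall>t\<in>U. \<bar>measure (X s) A - measure (X t) A\<bar> \<le> 1 / real (Suc k)))"
  have P_refine: "\<exists>V. P k V \<and> V \<subseteq> U" if U: "y U UNIV > 0" for k U
  proof -
    have "(0::real) < 1 / real (Suc k)" by simp
    from refine_times[OF U \<A>[of k] this] obtain V where "V \<subseteq> U" "y V UNIV > 0" "V \<subseteq> T"
        "\<And>A s t. A \<in> \<A> k \<Longrightarrow> s \<in> V \<Longrightarrow> t \<in> V \<Longrightarrow> \<bar>measure (X s) A - measure (X t) A\<bar> \<le> 1 / real (Suc k)"
      by blast
    then show ?thesis unfolding P_def by blast
  qed
  have P_0: "\<exists>U. P 0 U" using P_refine[of UNIV 0] y_UNIV by auto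
  have P_Suc: "\<exists>V. P (Suc k) V \<and> V \<subseteq> U" if "P k U" for k U
    using P_refine that unfolding P_def by blast
  \<comment> \<open>Each set must be taken inside the previous one, hence dependent choice.\<close>
  have "\<exists>U. \<forall>k. P k (U k) \<and> U (Suc k) \<subseteq> U k"
    by (rule dependent_nat_choice[of P "\<lambda>_ U V. V \<subseteq> U", OF P_0 P_Suc])
  then obtain U where U: "\<And>k. P k (U k)" "\<And>k. U (Suc k) \<subseteq> U k"
    by blast
  have U_pos: "y (U k) UNIV > 0" and U_T: "U k \<subseteq> T"
    and U_close: "\<And>A s t. A \<in> \<A> k \<Longrightarrow> s \<in> U k \<Longrightarrow> t \<in> U k \<Longrightarrow>
      \<bar>measure (X s) A - measure (X t) A\<bar> \<le> 1 / real (Suc k)" for k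
    using U(1)[of k] unfolding P_def by blast+
  have U_dec: "U l \<subseteq> U k" if "k \<le> l" for k l
    using that by (induction rule: dec_induct) (use U(2) in blast)+
  have "\<exists>t. t \<in> U k \<and> B k \<le> t" for k
    using y_positive_nonempty[OF U_pos] by metis
  then obtain \<tau> where \<tau>: "\<And>k. \<tau> k \<in> U k" "\<And>k. B k \<le> \<tau> k" by metis
  have \<tau>T: "\<tau> k \<in> T" for k using \<tau>(1) U_T by blast
  have \<tau>_lim: "filterlim \<tau> at_top sequentially"
    by (rule filterlim_at_top_mono[OF B]) (simp add: \<tau>(2))
  \<comment> \<open>By nesting, all times from stage \<open>N\<close> on lie in \<open>U N\<close>,
    where the probability of an event in \<open>\<A> N\<close> varies by at most
    \<open>1 / real (Suc N)\<close>.\<close>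
  have Cauchy: "Cauchy (\<lambda>k. measure (X (\<tau> k)) A)" if "A \<in> local_sets" for A
  proof (rule metric_CauchyI)
    fix e :: real assume "e > 0"
    then obtain n where n: "inverse (real (Suc n)) < e" using reals_Archimedean by blast
    obtain m where m: "A \<in> \<A> m" using \<A>_local[OF \<open>A \<in> local_sets\<close>] by blast
    define N where "N = max m n"
    have A: "A \<in> \<A> N" using m \<A>_mono[of m N] unfolding N_def by auto
    have "1 / real (Suc N) \<le> inverse (real (Suc n))" unfolding N_def by (simp add: divide_simps)
    then have "dist (measure (X (\<tau> k)) A) (measure (X (\<tau> l)) A) < e" if "N \<le> k" "N \<le> l" for k l
      using U_close[OF A, of "\<tau> k" "\<tau> l"] U_dec[OF that(1)] U_dec[OF that(2)] \<tau>(1) n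
      unfolding dist_real_def by (meson le_less_trans subsetD order_trans)
    then show "\<exists>M. \<forall>k\<ge>M. \<forall>l\<ge>M. dist (measure (X (\<tau> k)) A) (measure (X (\<tau> l)) A) < e" by blast
  qed
  define m where "m = (\<lambda>A. lim (\<lambda>k. measure (X (\<tau> k)) A))"
  have m: "(\<lambda>k. measure (X (\<tau> k)) A) \<longlonglongrightarrow> m A" if "A \<in> local_sets" for A
    unfolding m_def using Cauchy[OF that] by (simp add: Cauchy_convergent_iff convergent_LIMSEQ_iff)
  obtain \<nu> where \<nu>: "\<nu> \<in> prob_measures" "\<And>A. A \<in> local_sets \<Longrightarrow> measure \<nu> A = m A"
  proof (rule extend_local_content[of m])
    show "0 \<le> m A" if "A \<in> local_sets" for A
      by (rule LIMSEQ_le_const[OF m[OF that]]) simp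
    show "m (A \<union> A') = m A + m A'" if A: "A \<in> local_sets" "A' \<in> local_sets" "A \<inter> A' = {}" for A A'
    proof (rule LIMSEQ_unique[OF m[OF local_sets_Un[OF A(1,2)]]])
      have "measure (X (\<tau> k)) (A \<union> A') = measure (X (\<tau> k)) A + measure (X (\<tau> k)) A'" for k
      proof -
        interpret prob_space "X (\<tau> k)" by (rule X_prob_space[OF \<tau>T])
        show ?thesis
          using borel_local_sets[OF A(1)] borel_local_sets[OF A(2)] prob_measuresD(2)[OF X(1)[OF \<tau>T[of k]]] A(3)
          by (intro finite_measure_Union) simp_all
      qed
      then show "(\<lambda>k. measure (X (\<tau> k)) (A \<union> A')) \<longlonglongrightarrow> m A + m A'"
        using tendsto_add[OF m[OF A(1)] m[OF A(2)]] by simp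
    qed
    show "m UNIV = 1"
      by (rule LIMSEQ_unique[OF m[OF UNIV_local_sets]]) (simp add: X_UNIV[OF \<tau>T])
  qed blast
  have lim: "(\<lambda>k. measure (X (\<tau> k)) A) \<longlonglongrightarrow> measure \<nu> A" if "A \<in> local_sets" for A
    using m[OF that] \<nu>(2)[OF that] by simp
  have "weakly_converges (\<lambda>k. X (\<tau> k)) \<nu> sequentially"
    by (rule weakly_convergesI[OF X(1)[OF \<tau>T] \<nu>(1) lim])
  then have limit_point: "\<nu> \<in> weak_limit_points X"
    unfolding weak_limit_points_def using \<nu>(1) \<tau>_lim by blast
  have ti: "translation_invariant \<nu>"
    unfolding translation_invariant_iff_local[OF \<nu>(1)]
  proof (intro allI ballI)
    fix u and A :: "('d, 's) config set" assume A: "A \<in> local_sets"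
    have "measure (X (\<tau> k)) (shift u -` A) = measure (X (\<tau> k)) A" for k
      using X(2)[OF \<tau>T[of k]] A unfolding translation_invariant_iff_local[OF X(1)[OF \<tau>T]] by blast
    then show "measure \<nu> (shift u -` A) = measure \<nu> A"
      using LIMSEQ_unique[OF lim[OF local_sets_shift[OF A, of u]]] lim[OF A] by simp
  qed
  have "\<exists>\<rho>. \<rho> \<in> prob_measures \<and> translation_invariant \<rho> \<and>
      (\<forall>A\<in>local_sets. y (U k) UNIV * measure \<rho> A = y (U k) A)" for k
    using extend_average[OF U_pos[of k]] by metis
  then obtain \<rho> where \<rho>: "\<And>k. \<rho> k \<in> prob_measures" "\<And>k. translation_invariant (\<rho> k)"
      "\<And>k A. A \<in> local_sets \<Longrightarrow> y (U k) UNIV * measure (\<rho> k) A = y (U k) A"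
    by metis
  have gibbs_\<rho>: "gibbs_measure \<Phi> (\<rho> k)" for k
  proof (rule gibbs_measure_of_dominated[OF \<rho>(1) \<mu>(1) U_pos[of k] _ \<Phi> \<rho>(2) \<mu>(2) gibbs_\<mu>])
    fix A :: "('d, 's) config set" assume A: "A \<in> local_sets"
    \<comment> \<open>Restricting the times only lowers the share of \<open>A\<close>; this is the
      domination, with the density of \<open>U k\<close> as its constant.\<close>
    have "y (U k) A \<le> y UNIV A" by (rule y_mono) (simp add: of_bool_def)
    then show "y (U k) UNIV * measure (\<rho> k) A \<le> measure \<mu> A"
      unfolding \<rho>(3)[OF A] \<mu>(3)[OF A] .
  qed
  have "(\<lambda>k. measure (\<rho> k) A) \<longlonglongrightarrow> measure \<nu> A" if A: "A \<in> local_sets" for A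
  proof -
    obtain n where n: "A \<in> \<A> n" using \<A>_local[OF A] by blast
    \<comment> \<open>The average over \<open>U k\<close> is compared with the single law at
      \<open>\<tau> k\<close>, itself a member of that set.\<close>
    have "\<bar>measure (\<rho> k) A - measure (X (\<tau> k)) A\<bar> \<le> 1 / real (Suc k)" if "n \<le> k" for k
    proof -
      have Ak: "A \<in> \<A> k" using n \<A>_mono[OF that] by blast
      have "\<bar>y (U k) A - measure (X (\<tau> k)) A * y (U k) UNIV\<bar> \<le> 1 / real (Suc k) * y (U k) UNIV"
        by (rule y_close) (rule U_close[OF Ak _ \<tau>(1)])
      then have "y (U k) UNIV * \<bar>measure (\<rho> k) A - measure (X (\<tau> k)) A\<bar> \<le> y (U k) UNIV * (1 / real (Suc k))"
        unfolding \<rho>(3)[OF A, symmetric] mult.commute[of _ "y (U k) UNIV"] right_diff_distrib[symmetric] abs_mult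
        using U_pos[of k] by simp
      then show ?thesis using U_pos[of k] by (simp only: mult_le_cancel_left_pos)
    qed
    then have "\<forall>\<^sub>F k in sequentially. norm (measure (\<rho> k) A - measure (X (\<tau> k)) A) \<le> 1 / real (Suc k)"
      unfolding real_norm_def by (rule eventually_sequentiallyI)
    then have "(\<lambda>k. measure (\<rho> k) A - measure (X (\<tau> k)) A) \<longlonglongrightarrow> 0"
      by (rule Lim_null_comparison[OF _ LIMSEQ_Suc[OF lim_1_over_n]])
    from tendsto_add[OF this lim[OF A]] show ?thesis by simp
  qed
  then have "gibbs_measure \<Phi> \<nu>"
    by (rule gibbs_measure_limit[OF \<Phi> \<nu>(1) \<rho>(1) gibbs_\<rho>])
  with limit_point ti show ?thesis by blast
qed

end

section \<open>Discrete time\<close>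

lemma translation_invariant_bind:
  fixes \<nu> :: "('d::finite, 's::{finite, discrete_topology}) config measure"
  assumes \<nu>: "\<nu> \<in> prob_measures" "translation_invariant \<nu>" and P: "P \<in> borel \<rightarrow>\<^sub>M prob_algebra borel"
    and shift: "\<And>u \<sigma>. P (shift u \<sigma>) = distr (P \<sigma>) borel (shift u)"
  shows "translation_invariant (\<nu> \<bind> P)"
  unfolding translation_invariant_def
proof
  fix u
  have ne: "space \<nu> \<noteq> {}" using prob_measuresD(3)[OF \<nu>(1)] by simp
  have sh: "shift u \<in> \<nu> \<rightarrow>\<^sub>M borel"
    using measurable_shift prob_measuresD(2)[OF \<nu>(1)] measurable_cong_sets by blast
  have "distr (\<nu> \<bind> P) borel (shift u) = \<nu> \<bind> (\<lambda>\<sigma>. distr (P \<sigma>) borel (shift u))"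
    by (rule distr_bind[OF kernel_subprob[OF \<nu>(1) P] ne measurable_shift])
  also have "\<dots> = \<nu> \<bind> (\<lambda>\<sigma>. P (shift u \<sigma>))"
    by (simp only: shift)
  also have "\<dots> = distr \<nu> borel (shift u) \<bind> P"
    by (rule bind_distr[OF sh measurable_prob_algebraD[OF P] ne, symmetric])
  also have "\<dots> = \<nu> \<bind> P"
    using \<nu>(2) unfolding translation_invariant_def by simp
  finally show "distr (\<nu> \<bind> P) borel (shift u) = \<nu> \<bind> P" .
qed

text \<open>The Krylov-Bogoliubov argument: the Feller property carries \<open>P\<close> through the
  limit of averages, and by \<open>diff\<close> applying \<open>P\<close> changes the averages
  asymptotically not at all. Each kind of dynamics supplies \<open>diff\<close> as a boundary
  term.\<close>

lemma stationary_of_averages: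
  fixes X :: "'t \<Rightarrow> ('d::finite, 's::{finite, discrete_topology}) config measure"
  assumes X: "\<And>m t. t \<in> S m \<Longrightarrow> X t \<in> prob_measures" and \<nu>: "\<nu> \<in> prob_measures"
    and P: "P \<in> borel \<rightarrow>\<^sub>M prob_algebra borel"
    and feller: "\<And>f :: _ \<Rightarrow> real. continuous_on UNIV f \<Longrightarrow> continuous_on UNIV (\<lambda>\<sigma>. \<integral>\<omega>. f \<omega> \<partial>P \<sigma>)"
    and F: "F \<noteq> bot" "F \<le> sequentially"
    and conv: "\<And>A. A \<in> local_sets \<Longrightarrow> ((\<lambda>m. average (S m) (\<lambda>t. measure (X t) A)) \<longlongrightarrow> measure \<nu> A) F"
    and diff: "\<And>A. A \<in> local_sets \<Longrightarrow>
      (\<lambda>m. average (S m) (\<lambda>t. measure (X t \<bind> P) A) - average (S m) (\<lambda>t. measure (X t) A)) \<longlonglongrightarrow> 0"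
  shows "\<nu> \<bind> P = \<nu>"
proof (rule prob_measures_eqI_local_sets[OF prob_measures_bind[OF \<nu> P] \<nu>])
  fix A :: "('d, 's) config set" assume A: "A \<in> local_sets"
  have cont: "continuous_on UNIV (\<lambda>\<sigma>. measure (P \<sigma>) A)"
    using feller[OF continuous_indicator_local[OF A]]
    by (simp only: integral_indicator_config[OF kernel_prob_measures[OF P]])
  have "((\<lambda>m. average (S m) (\<lambda>t. \<integral>\<sigma>. measure (P \<sigma>) A \<partial>X t)) \<longlongrightarrow> (\<integral>\<sigma>. measure (P \<sigma>) A \<partial>\<nu>)) F"
    by (rule average_integral_tendsto[OF X \<nu> conv cont])
  moreover have "average (S m) (\<lambda>t. \<integral>\<sigma>. measure (P \<sigma>) A \<partial>X t) = average (S m) (\<lambda>t. measure (X t \<bind> P) A)" for m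
    by (rule average_cong) (rule measure_bind_config[OF X P borel_local_sets[OF A], symmetric])
  ultimately have "((\<lambda>m. average (S m) (\<lambda>t. measure (X t \<bind> P) A)) \<longlongrightarrow> measure (\<nu> \<bind> P) A) F"
    unfolding measure_bind_config[OF \<nu> P borel_local_sets[OF A]] by simp
  moreover have "((\<lambda>m. average (S m) (\<lambda>t. measure (X t \<bind> P) A)) \<longlongrightarrow> measure \<nu> A) F"
    using tendsto_add[OF tendsto_mono[OF F(2) diff[OF A]] conv[OF A]] by simp
  ultimately show "measure (\<nu> \<bind> P) A = measure \<nu> A"
    by (rule tendsto_unique[OF F(1)])
qed

text \<open>Indexing by pairs of a set of times and an event puts all required averages into one
  compact product of unit intervals.\<close>

lemma exists_averaged_limits:
  fixes X :: "'t::linorder \<Rightarrow> ('d::finite, 's::{finite, discrete_topology}) config measure"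
  assumes X: "\<And>t. t \<in> T \<Longrightarrow> X t \<in> prob_measures" "\<And>t. t \<in> T \<Longrightarrow> translation_invariant (X t)"
    and S: "\<And>m. finite (S m)" "\<And>m. S m \<noteq> {}" "\<And>m. S m \<subseteq> T"
    and B: "filterlim B at_top sequentially"
    and sparse: "\<And>k. (\<lambda>m. average (S m) (\<lambda>t. of_bool (t < B k))) \<longlonglongrightarrow> 0"
  shows "\<exists>F y. averaged_limits X T S B F y"
proof -
  define a where "a = (\<lambda>m (U, A). average (S m) (\<lambda>t. of_bool (t \<in> U) * measure (X t) A))"
  have bounds: "0 \<le> a m i" "a m i \<le> 1" for m i
  proof -
    obtain U A where i: "i = (U, A)" by (cases i)
    have "0 \<le> of_bool (t \<in> U) * measure (X t) A \<and> of_bool (t \<in> U) * measure (X t) A \<le> 1" if "t \<in> S m" for t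
    proof -
      have "prob_space (X t)" using that S(3) prob_measuresD(1)[OF X(1)] by blast
      then show ?thesis using prob_space.prob_le_1[of "X t" A] by simp
    qed
    then have "average (S m) (\<lambda>_. 0) \<le> a m i" "a m i \<le> average (S m) (\<lambda>_. 1)"
      unfolding a_def i prod.case by (intro average_mono; blast)+
    then show "0 \<le> a m i" "a m i \<le> 1" by (simp_all only: average_const[OF S(1,2)])
  qed
  obtain F z where Fz: "F \<noteq> bot" "F \<le> sequentially" "\<And>i. ((\<lambda>m. a m i) \<longlongrightarrow> z i) F"
    using simultaneous_filter_limit[of a, OF bounds] by blast
  have "averaged_limits X T S B F (\<lambda>U A. z (U, A))"
    using Fz(3)[of "(_, _)"] unfolding a_def prod.case
    by (intro averaged_limits.intro X S B sparse Fz(1,2))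
  then show ?thesis by blast
qed

lemma average_image_lessThan:
  assumes "inj_on e {..<N}"
  shows "average (e ` {..<N}) a = (\<Sum>j<N. a (e j)) / real N"
  unfolding average_def using assms by (simp add: sum.reindex card_image)

text \<open>The windows of indices differ by \<open>q\<close> terms at either end, and each end sum
  lies between 0 and \<open>q\<close>.\<close>

lemma sum_translate_diff_le:
  fixes b :: "nat \<Rightarrow> real"
  assumes b: "\<And>j. 0 \<le> b j" "\<And>j. b j \<le> 1"
  shows "\<bar>(\<Sum>j<N. b (j + q)) - (\<Sum>j<N. b j)\<bar> \<le> real q"
proof -
  have "(\<Sum>j<N + q. b j) = (\<Sum>j<q. b j) + (\<Sum>j<N. b (j + q))"
    by (induction N) (simp_all add: add.assoc)
  moreover have "(\<Sum>j<N + q. b j) = (\<Sum>j<N. b j) + (\<Sum>j<q. b (N + j))"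
    by (induction q) (simp_all add: add.assoc)
  moreover have "0 \<le> (\<Sum>j<q. b (f j)) \<and> (\<Sum>j<q. b (f j)) \<le> real q" for f
    using sum_bounded_above[of "{..<q}" "\<lambda>j. b (f j)" 1] b by (auto intro!: sum_nonneg)
  from this[of "\<lambda>j. j"] this[of "\<lambda>j. N + j"] calculation show ?thesis by linarith
qed

lemma sum_of_bool_lessThan:
  fixes k :: nat
  assumes "finite I"
  shows "(\<Sum>j\<in>I. of_bool (j < k) :: real) \<le> real k"
proof -
  have "(\<Sum>j\<in>I. of_bool (j < k) :: real) = real (card (I \<inter> {j. j < k}))"
    using assms by simp
  also have "card (I \<inter> {j. j < k}) \<le> card {..<k}"
    by (rule card_mono) auto
  finally show ?thesis by simp
qed

theorem discrete_gibbs_limit_point: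
  fixes \<Phi> :: "('d::finite, 's::{finite, discrete_topology}) potential"
  assumes \<Phi>: "ti_abs_summable_potential \<Phi>"
    and \<nu>\<^sub>0: "\<nu>\<^sub>0 \<in> prob_measures" "translation_invariant \<nu>\<^sub>0"
    and P: "ti_transition_kernel P" and zero: "zero_entropy_loss_discrete \<Phi> P \<mu>"
  shows "\<exists>\<nu>\<in>weak_limit_points (\<lambda>n::nat. ((\<lambda>\<nu>. \<nu> \<bind> P) ^^ n) \<nu>\<^sub>0). translation_invariant \<nu> \<and> gibbs_measure \<Phi> \<nu>"
proof -
  define X where "X = (\<lambda>n. ((\<lambda>\<nu>. \<nu> \<bind> P) ^^ n) \<nu>\<^sub>0)"
  have kernel: "P \<in> borel \<rightarrow>\<^sub>M prob_algebra borel"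
    and shift: "\<And>u \<sigma>. P (shift u \<sigma>) = distr (P \<sigma>) borel (shift u)"
    using P unfolding ti_transition_kernel_def by blast+
  have feller: "continuous_on UNIV (\<lambda>\<sigma>. \<integral>\<omega>. f \<omega> \<partial>P \<sigma>)" if "continuous_on UNIV f" for f :: "('d, 's) config \<Rightarrow> real"
    using P that unfolding ti_transition_kernel_def weakly_converges_def continuous_on_def by blast
  have X0: "X 0 = \<nu>\<^sub>0" and X_Suc: "X (Suc n) = X n \<bind> P" for n
    by (simp_all add: X_def)
  have X: "X n \<in> prob_measures \<and> translation_invariant (X n)" for n
  proof (induction n)
    case 0
    then show ?case using \<nu>\<^sub>0 by (simp add: X0)
  next
    case (Suc n)
    then show ?case
      unfolding X_Suc using prob_measures_bind[OF _ kernel] translation_invariant_bind[OF _ _ kernel shift] by blast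
  qed
  \<comment> \<open>The identity image makes this an instance of the enumerated averages that the
    dyadic grids also use.\<close>
  define S :: "nat \<Rightarrow> nat set" where "S = (\<lambda>m. (\<lambda>j. j) ` {..<Suc m})"
  have avg: "average (S m) a = (\<Sum>j<Suc m. a j) / real (Suc m)" for m a
    unfolding S_def by (rule average_image_lessThan) simp
  have bound: "(\<lambda>m. c / real (Suc m)) \<longlonglongrightarrow> 0" for c :: real
    using tendsto_mult[OF tendsto_const[of c] LIMSEQ_Suc[OF lim_1_over_n]] by simp
  have sparse: "(\<lambda>m. average (S m) (\<lambda>t. of_bool (t < k))) \<longlonglongrightarrow> 0" for k :: nat
  proof (rule Lim_null_comparison[OF always_eventually bound[of "real k"]], intro allI)
    fix m
    have "(\<Sum>j<Suc m. of_bool (j < k) :: real) \<le> real k"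
      by (rule sum_of_bool_lessThan) simp
    then show "norm (average (S m) (\<lambda>t. of_bool (t < k))) \<le> real k / real (Suc m)"
      unfolding avg real_norm_def abs_divide by (simp add: divide_right_mono sum_nonneg del: sum_of_bool_eq sum.lessThan_Suc)
  qed
  have "\<exists>F y. averaged_limits X UNIV S (\<lambda>k. k) F y"
  proof (rule exists_averaged_limits)
    show "filterlim (\<lambda>k. k) at_top sequentially" by (rule filterlim_ident)
  qed (use X sparse in \<open>auto simp: S_def\<close>)
  then obtain F y where "averaged_limits X UNIV S (\<lambda>k. k) F y" by blast
  then interpret averaged_limits X UNIV S "\<lambda>k. k" F y .
  have "\<exists>\<nu>\<in>weak_limit_points X. translation_invariant \<nu> \<and> gibbs_measure \<Phi> \<nu>"
  proof (rule exists_gibbs_limit_point[OF \<Phi>])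
    fix \<nu> :: "('d, 's) config measure"
    assume \<nu>: "\<nu> \<in> prob_measures" "translation_invariant \<nu>"
      and conv: "\<And>A. A \<in> local_sets \<Longrightarrow> ((\<lambda>m. average (S m) (\<lambda>t. measure (X t) A)) \<longlongrightarrow> measure \<nu> A) F"
    have "\<nu> \<bind> P = \<nu>"
    proof (rule stationary_of_averages[OF _ \<nu>(1) kernel feller F conv])
      show "X t \<in> prob_measures" for t using X by blast
      fix A :: "('d, 's) config set"
      have b: "0 \<le> measure (X j) A" "measure (X j) A \<le> 1" for j
        using prob_space.prob_le_1[OF X_prob_space[of j], of A] by simp_all
      show "(\<lambda>m. average (S m) (\<lambda>t. measure (X t \<bind> P) A) - average (S m) (\<lambda>t. measure (X t) A)) \<longlonglongrightarrow> 0"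
      proof (rule Lim_null_comparison[OF always_eventually bound[of 1]], intro allI)
        fix m
        have "\<bar>(\<Sum>j<Suc m. measure (X (Suc j)) A) - (\<Sum>j<Suc m. measure (X j) A)\<bar> \<le> 1"
          using sum_translate_diff_le[of "\<lambda>j. measure (X j) A" 1 "Suc m", OF b]
          unfolding Suc_eq_plus1 of_nat_1 .
        then show "norm (average (S m) (\<lambda>t. measure (X t \<bind> P) A) - average (S m) (\<lambda>t. measure (X t) A)) \<le> 1 / real (Suc m)"
          unfolding avg X_Suc[symmetric] diff_divide_distrib[symmetric] real_norm_def abs_divide abs_of_nat
          by (rule divide_right_mono) simp
      qed
    qed
    \<comment> \<open>Stationarity makes both relative entropies the same term, so their difference
      is 0 and the zero entropy loss condition applies.\<close>
    then show "gibbs_measure \<Phi> \<nu>"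
      using zero \<nu> unfolding zero_entropy_loss_discrete_def by simp
  qed
  then show ?thesis unfolding X_def .
qed

section \<open>Continuous time\<close>

text \<open>At the infimum of the counterexamples the property holds by \<open>limit\<close>, or by
  \<open>zero\<close> if the infimum is 0; then \<open>step\<close> extends it to the right, so
  counterexamples cannot accumulate there.\<close>

lemma real_continuous_induct:
  fixes t :: real
  assumes "t \<ge> 0" and zero: "Q 0"
    and step: "\<And>s. 0 \<le> s \<Longrightarrow> Q s \<Longrightarrow> \<exists>d>0. \<forall>h. 0 \<le> h \<longrightarrow> h < d \<longrightarrow> Q (s + h)"
    and limit: "\<And>s. 0 < s \<Longrightarrow> (\<And>r. 0 \<le> r \<Longrightarrow> r < s \<Longrightarrow> Q r) \<Longrightarrow> Q s"
  shows "Q t"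
proof (rule ccontr)
  assume "\<not> Q t"
  define Z where "Z = {s. 0 \<le> s \<and> \<not> Q s}"
  have Z: "Z \<noteq> {}" "bdd_below Z" using \<open>\<not> Q t\<close> \<open>t \<ge> 0\<close> unfolding Z_def by (auto intro: bdd_belowI[of _ 0])
  define z where "z = Inf Z"
  have z0: "0 \<le> z" unfolding z_def using Z(1) by (rule cInf_greatest) (simp add: Z_def)
  have below: "Q r" if "0 \<le> r" "r < z" for r
    using cInf_lower[OF _ Z(2), of r] that unfolding Z_def z_def by fastforce
  have "Q z" using zero limit[OF _ below] z0 by (cases "z = 0") auto
  then obtain d where d: "d > 0" "\<And>h. 0 \<le> h \<Longrightarrow> h < d \<Longrightarrow> Q (z + h)"
    using step[OF z0] by blast
  have "Inf Z < z + d" using d(1) by (simp add: z_def)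
  then obtain s where s: "s \<in> Z" "s < z + d" using cInf_less_iff[OF Z] by blast
  have "z \<le> s" unfolding z_def by (rule cInf_lower[OF s(1) Z(2)])
  then have "Q (z + (s - z))" using s(2) by (intro d(2)) simp_all
  then show False using s(1) by (simp add: Z_def)
qed

section \<open>Translation covariance of the generator\<close>

lemma oscillation_shift:
  fixes f :: "('d::finite, 's) config \<Rightarrow> real"
  shows "(SUP (\<eta>\<^sub>1, \<eta>\<^sub>2)\<in>agree_off x. \<bar>f (shift u \<eta>\<^sub>1) - f (shift u \<eta>\<^sub>2)\<bar>)
    = (SUP (\<eta>\<^sub>1, \<eta>\<^sub>2)\<in>agree_off (x - u). \<bar>f \<eta>\<^sub>1 - f \<eta>\<^sub>2\<bar>)"
proof -
  have "agree_off (x - u) = (\<lambda>(\<eta>\<^sub>1, \<eta>\<^sub>2). (shift u \<eta>\<^sub>1, shift u \<eta>\<^sub>2)) ` (agree_off x :: (('d, 's) config \<times> _) set)"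
  proof (intro equalityI subsetI)
    fix p :: "('d, 's) config \<times> ('d, 's) config" assume "p \<in> agree_off (x - u)"
    then obtain \<eta>\<^sub>1 \<eta>\<^sub>2 where p: "p = (\<eta>\<^sub>1, \<eta>\<^sub>2)" and ag: "\<And>y. y \<noteq> x - u \<Longrightarrow> \<eta>\<^sub>1 y = \<eta>\<^sub>2 y"
      unfolding agree_off_def by blast
    have "(shift (- u) \<eta>\<^sub>1, shift (- u) \<eta>\<^sub>2) \<in> agree_off x"
      unfolding agree_off_def shift_def using ag by (simp add: diff_eq_eq eq_diff_eq)
    moreover have "p = (\<lambda>(\<eta>\<^sub>1, \<eta>\<^sub>2). (shift u \<eta>\<^sub>1, shift u \<eta>\<^sub>2)) (shift (- u) \<eta>\<^sub>1, shift (- u) \<eta>\<^sub>2)"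
      by (simp add: p shift_shift shift_zero)
    ultimately show "p \<in> (\<lambda>(\<eta>\<^sub>1, \<eta>\<^sub>2). (shift u \<eta>\<^sub>1, shift u \<eta>\<^sub>2)) ` agree_off x"
      by (rule rev_image_eqI)
  next
    fix p :: "('d, 's) config \<times> ('d, 's) config"
    assume "p \<in> (\<lambda>(\<eta>\<^sub>1, \<eta>\<^sub>2). (shift u \<eta>\<^sub>1, shift u \<eta>\<^sub>2)) ` agree_off x"
    then show "p \<in> agree_off (x - u)"
      unfolding agree_off_def shift_def by (auto simp: eq_diff_eq)
  qed
  then show ?thesis
    by (simp add: image_image case_prod_unfold)
qed

lemma smooth_functions_shift:
  assumes "f \<in> smooth_functions"
  shows "(\<lambda>\<eta>. f (shift u \<eta>)) \<in> smooth_functions"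
proof -
  have f: "continuous_on UNIV f" and osc: "(\<lambda>x. SUP (\<eta>\<^sub>1, \<eta>\<^sub>2)\<in>agree_off x. \<bar>f \<eta>\<^sub>1 - f \<eta>\<^sub>2\<bar>) summable_on UNIV"
    using assms unfolding smooth_functions_def by blast+
  have "bij (\<lambda>x. x - u)"
    by (rule bij_betw_byWitness[where f'="\<lambda>x. x + u"]) auto
  then have "(\<lambda>x. SUP (\<eta>\<^sub>1, \<eta>\<^sub>2)\<in>agree_off (x - u). \<bar>f \<eta>\<^sub>1 - f \<eta>\<^sub>2\<bar>) summable_on UNIV"
    using summable_on_reindex_bij_betw[of "\<lambda>x. x - u" UNIV UNIV "\<lambda>x. SUP (\<eta>\<^sub>1, \<eta>\<^sub>2)\<in>agree_off x. \<bar>f \<eta>\<^sub>1 - f \<eta>\<^sub>2\<bar>"] osc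
    by blast
  then show ?thesis
    unfolding smooth_functions_def mem_Collect_eq oscillation_shift
    using continuous_on_compose2[OF f continuous_shift] by simp
qed

text \<open>Two changes of variables: the outer sum is reindexed by translating the update set, the
  inner one by shifting the local configuration. Translation invariance of the rates matches the
  terms.\<close>

lemma ips_pregenerator_shift:
  fixes c :: "('d::finite, 's::{finite, discrete_topology}) rates"
  assumes c: "ti_ips_rates c"
  shows "ips_pregenerator c (\<lambda>\<eta>. f (shift u \<eta>)) \<eta> = ips_pregenerator c f (shift u \<eta>)"
proof -
  let ?h = "\<lambda>\<Delta>. \<Sum>\<xi>\<in>\<Delta> \<rightarrow>\<^sub>E UNIV. c \<Delta> \<eta> \<xi> * (f (shift u (override_on \<eta> \<xi> \<Delta>)) - f (shift u \<eta>))"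
  let ?tr = "(`) (\<lambda>x. x + u) :: 'd site set \<Rightarrow> 'd site set"
  have bij: "bij_betw ?tr {\<Delta>. finite \<Delta>} {\<Delta>. finite \<Delta>}"
    by (rule bij_betw_byWitness[where f'="(`) (\<lambda>x. x - u)"]) (auto simp: image_image)
  have "?h (?tr \<Delta>) = (\<Sum>\<xi>\<in>\<Delta> \<rightarrow>\<^sub>E UNIV. c \<Delta> (shift u \<eta>) \<xi> * (f (override_on (shift u \<eta>) \<xi> \<Delta>) - f (shift u \<eta>)))"
    if \<Delta>: "finite \<Delta>" for \<Delta>
  proof (rule sum.reindex_bij_witness[where i="shift (- u)" and j="shift u"])
    fix \<xi> :: "('d, 's) config" assume \<xi>: "\<xi> \<in> ?tr \<Delta> \<rightarrow>\<^sub>E UNIV"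
    show "shift (- u) (shift u \<xi>) = \<xi>" by (simp add: shift_shift shift_zero)
    show "shift u \<xi> \<in> \<Delta> \<rightarrow>\<^sub>E UNIV"
    proof (rule PiE_I)
      fix x assume "x \<notin> \<Delta>"
      then have "x + u \<notin> ?tr \<Delta>" by auto
      then show "shift u \<xi> x = undefined"
        using \<xi> unfolding PiE_iff extensional_def shift_def by blast
    qed simp
    have "c (?tr \<Delta>) \<eta> \<xi> = c \<Delta> (shift u \<eta>) (shift u \<xi>)"
      using c \<Delta> \<xi> unfolding ti_ips_rates_def by blast
    moreover have "shift u (override_on \<eta> \<xi> (?tr \<Delta>)) = override_on (shift u \<eta>) (shift u \<xi>) \<Delta>"
      by (auto simp: shift_def override_on_def fun_eq_iff)
    ultimately show "c \<Delta> (shift u \<eta>) (shift u \<xi>) * (f (override_on (shift u \<eta>) (shift u \<xi>) \<Delta>) - f (shift u \<eta>))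
        = c (?tr \<Delta>) \<eta> \<xi> * (f (shift u (override_on \<eta> \<xi> (?tr \<Delta>))) - f (shift u \<eta>))"
      by simp
  next
    fix \<xi> :: "('d, 's) config" assume \<xi>: "\<xi> \<in> \<Delta> \<rightarrow>\<^sub>E UNIV"
    show "shift u (shift (- u) \<xi>) = \<xi>" by (simp add: shift_shift shift_zero)
    show "shift (- u) \<xi> \<in> ?tr \<Delta> \<rightarrow>\<^sub>E UNIV"
    proof (rule PiE_I)
      fix x assume "x \<notin> ?tr \<Delta>"
      then have "x - u \<notin> \<Delta>" by (metis diff_add_cancel image_eqI)
      then show "shift (- u) \<xi> x = undefined"
        using \<xi> by (simp add: PiE_iff extensional_def shift_def)
    qed simp
  qed
  then have "(\<Sum>\<^sub>\<infinity>\<Delta>\<in>{\<Delta>. finite \<Delta>}. ?h (?tr \<Delta>)) = ips_pregenerator c f (shift u \<eta>)"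
    unfolding ips_pregenerator_def by (intro infsum_cong) simp
  then show ?thesis
    unfolding ips_pregenerator_def infsum_reindex_bij_betw[OF bij, of ?h] .
qed

lemma uniform_limit_shift:
  assumes "uniform_limit UNIV F f G"
  shows "uniform_limit UNIV (\<lambda>n \<eta>. F n (shift u \<eta>)) (\<lambda>\<eta>. f (shift u \<eta>)) G"
proof (rule uniform_limitI)
  fix e :: real assume "e > 0"
  from uniform_limitD[OF assms this]
  show "\<forall>\<^sub>F n in G. \<forall>\<eta>\<in>UNIV. dist (F n (shift u \<eta>)) (f (shift u \<eta>)) < e"
    by eventually_elim simp
qed

lemma ips_generator_shift:
  fixes c :: "('d::finite, 's::{finite, discrete_topology}) rates"
  assumes c: "ti_ips_rates c" and "(f, k) \<in> ips_generator c"
  shows "((\<lambda>\<eta>. f (shift u \<eta>)), (\<lambda>\<eta>. k (shift u \<eta>))) \<in> ips_generator c"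
proof -
  obtain F where F: "\<And>n. F n \<in> smooth_functions" "uniform_limit UNIV F f sequentially"
      "uniform_limit UNIV (\<lambda>n. ips_pregenerator c (F n)) k sequentially"
    using assms(2) unfolding ips_generator_def by blast
  have "ips_pregenerator c (\<lambda>\<eta>. F n (shift u \<eta>)) = (\<lambda>\<eta>. ips_pregenerator c (F n) (shift u \<eta>))" for n
    by (rule ext) (rule ips_pregenerator_shift[OF c])
  then have "uniform_limit UNIV (\<lambda>n. ips_pregenerator c (\<lambda>\<eta>. F n (shift u \<eta>))) (\<lambda>\<eta>. k (shift u \<eta>)) sequentially"
    using uniform_limit_shift[OF F(3)] by simp
  then show ?thesis
    unfolding ips_generator_def mem_Collect_eq prod.case
    using smooth_functions_shift[OF F(1)] uniform_limit_shift[OF F(2)]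
    by (intro exI[of _ "\<lambda>n \<eta>. F n (shift u \<eta>)"]) blast
qed

text \<open>Oscillations vanish off \<open>\<Gamma>\<close>, so a local function is smooth and the
  constant sequence witnesses membership in the closure. This supplies indicators of local events as
  elements of the domain.\<close>

lemma ips_generator_local:
  fixes c :: "('d::finite, 's::{finite, discrete_topology}) rates"
  assumes f: "finite \<Gamma>" "local_on \<Gamma> f"
  shows "(f, ips_pregenerator c f) \<in> ips_generator c"
proof -
  have "(SUP (\<eta>\<^sub>1, \<eta>\<^sub>2)\<in>agree_off x. \<bar>f \<eta>\<^sub>1 - f \<eta>\<^sub>2\<bar>) = 0" if "x \<notin> \<Gamma>" for x
  proof -
    have "f \<eta>\<^sub>1 = f \<eta>\<^sub>2" if "(\<eta>\<^sub>1, \<eta>\<^sub>2) \<in> agree_off x" for \<eta>\<^sub>1 \<eta>\<^sub>2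
      using that \<open>x \<notin> \<Gamma>\<close> unfolding agree_off_def
      by (intro local_onD[OF f(2)]) auto
    then have "(SUP (\<eta>\<^sub>1, \<eta>\<^sub>2)\<in>agree_off x. \<bar>f \<eta>\<^sub>1 - f \<eta>\<^sub>2\<bar>) = (SUP p\<in>(agree_off x :: (('d, 's) config \<times> _) set). 0)"
      by (intro SUP_cong) auto
    moreover have "(agree_off x :: (('d, 's) config \<times> _) set) \<noteq> {}"
      unfolding agree_off_def by blast
    ultimately show ?thesis by simp
  qed
  then have "(\<lambda>x. SUP (\<eta>\<^sub>1, \<eta>\<^sub>2)\<in>agree_off x. \<bar>f \<eta>\<^sub>1 - f \<eta>\<^sub>2\<bar>) summable_on UNIV"
    using f(1) by (subst summable_on_cong_neutral[of \<Gamma>]) auto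
  then have smooth: "f \<in> smooth_functions"
    unfolding smooth_functions_def using local_on_continuous[OF f] by simp
  show ?thesis
    unfolding ips_generator_def mem_Collect_eq prod.case
    by (rule exI[of _ "\<lambda>_. f"]) (simp add: smooth uniform_limit_const)
qed

section \<open>Feller semigroups and their generators\<close>

locale feller =
  fixes K :: "real \<Rightarrow> ('d::finite, 's::{finite, discrete_topology}) config \<Rightarrow> ('d, 's) config measure"
  assumes K: "feller_semigroup K"
begin

definition semi :: "real \<Rightarrow> (('d, 's) config \<Rightarrow> real) \<Rightarrow> ('d, 's) config \<Rightarrow> real" where
  "semi t f \<eta> = (\<integral>\<zeta>. f \<zeta> \<partial>K t \<eta>)"

lemma kernel: "0 \<le> t \<Longrightarrow> K t \<in> borel \<rightarrow>\<^sub>M prob_algebra borel"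
  using K unfolding feller_semigroup_def by blast

lemma kernel_prob: "0 \<le> t \<Longrightarrow> K t \<eta> \<in> prob_measures"
  by (rule kernel_prob_measures[OF kernel])

lemma semi_continuous: "0 \<le> t \<Longrightarrow> continuous_on UNIV f \<Longrightarrow> continuous_on UNIV (semi t f)"
  using K unfolding feller_semigroup_def semi_def by blast

lemma semi_zero:
  assumes "continuous_on UNIV f"
  shows "semi 0 f = f"
proof
  fix \<eta>
  have "K 0 \<eta> = return borel \<eta>" using K unfolding feller_semigroup_def by blast
  then show "semi 0 f \<eta> = f \<eta>"
    unfolding semi_def using borel_measurable_continuous_onI[OF assms] by (simp add: integral_return)
qed

lemma semi_add:
  assumes "0 \<le> s" "0 \<le> t" "continuous_on UNIV f"
  shows "semi (s + t) f = semi s (semi t f)"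
proof
  fix \<eta>
  have "K (s + t) \<eta> = K s \<eta> \<bind> K t" using K assms(1,2) unfolding feller_semigroup_def by blast
  then show "semi (s + t) f \<eta> = semi s (semi t f) \<eta>"
    unfolding semi_def using integral_bind_config[OF kernel_prob[OF assms(1)] kernel[OF assms(2)] assms(3)] by simp
qed

lemma semi_diff_le:
  assumes "0 \<le> t" "continuous_on UNIV f" "continuous_on UNIV g" "\<And>\<eta>. \<bar>f \<eta> - g \<eta>\<bar> \<le> e"
  shows "\<bar>semi t f \<eta> - semi t g \<eta>\<bar> \<le> e"
  unfolding semi_def by (rule integral_diff_le[OF kernel_prob[OF assms(1)] assms(2-4)])

lemma semi_right_continuous:
  assumes f: "continuous_on UNIV f" and e: "e > 0"
  obtains d where "d > 0" "\<And>h \<eta>. 0 \<le> h \<Longrightarrow> h < d \<Longrightarrow> \<bar>semi h f \<eta> - f \<eta>\<bar> \<le> e"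
proof -
  have "uniform_limit UNIV (\<lambda>t \<eta>. semi t f \<eta>) f (at_right 0)"
    using K f unfolding feller_semigroup_def semi_def by blast
  from uniform_limitD[OF this e] obtain d where d: "d > 0"
      "\<And>h \<eta>. 0 < h \<Longrightarrow> h < d \<Longrightarrow> dist (semi h f \<eta>) (f \<eta>) < e"
    unfolding eventually_at_right_field by blast
  have "\<bar>semi h f \<eta> - f \<eta>\<bar> \<le> e" if "0 \<le> h" "h < d" for h \<eta>
    using d(2)[OF _ that(2), of \<eta>] that(1) e semi_zero[OF f] unfolding dist_real_def
    by (cases "h = 0") (simp_all add: less_imp_le)
  with d(1) show ?thesis by (rule that)
qed

text \<open>The semigroup consists of contractions, so the modulus of continuity at time 0 works at
  every later time.\<close>

lemma semi_time_continuous: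
  assumes f: "continuous_on UNIV f" and e: "e > 0"
  obtains d where "d > 0" "\<And>s t \<eta>. 0 \<le> s \<Longrightarrow> s \<le> t \<Longrightarrow> t - s < d \<Longrightarrow> \<bar>semi t f \<eta> - semi s f \<eta>\<bar> \<le> e"
proof -
  obtain d where d: "d > 0" "\<And>h \<eta>. 0 \<le> h \<Longrightarrow> h < d \<Longrightarrow> \<bar>semi h f \<eta> - f \<eta>\<bar> \<le> e"
    using semi_right_continuous[OF f e] by blast
  have "\<bar>semi t f \<eta> - semi s f \<eta>\<bar> \<le> e" if "0 \<le> s" "s \<le> t" "t - s < d" for s t \<eta>
  proof -
    have h: "0 \<le> t - s" using that by simp
    have "semi t f = semi s (semi (t - s) f)"
      using semi_add[OF that(1) h f] by simp
    then show ?thesis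
      using semi_diff_le[OF that(1) semi_continuous[OF h f] f d(2)[OF h that(3)]] by simp
  qed
  with d(1) show ?thesis by (rule that)
qed

text \<open>The derivative at 0 as a first-order expansion, uniform in the configuration and without
  division, so that \<open>h = 0\<close> is included.\<close>

lemma generator_expansion:
  assumes "(f, k) \<in> semigroup_generator K" and e: "e > 0"
  obtains d where "d > 0" "\<And>h \<eta>. 0 \<le> h \<Longrightarrow> h < d \<Longrightarrow> \<bar>semi h f \<eta> - (f \<eta> + h * k \<eta>)\<bar> \<le> h * e"
proof -
  have f: "continuous_on UNIV f"
    and lim: "uniform_limit UNIV (\<lambda>t \<eta>. (semi t f \<eta> - f \<eta>) / t) k (at_right 0)"
    using assms(1) unfolding semigroup_generator_def semi_def by blast+
  from uniform_limitD[OF lim e] obtain d where d: "d > 0"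
      "\<And>h \<eta>. 0 < h \<Longrightarrow> h < d \<Longrightarrow> dist ((semi h f \<eta> - f \<eta>) / h) (k \<eta>) < e"
    unfolding eventually_at_right_field by blast
  have "\<bar>semi h f \<eta> - (f \<eta> + h * k \<eta>)\<bar> \<le> h * e" if "0 \<le> h" "h < d" for h \<eta>
  proof (cases "h = 0")
    case True
    then show ?thesis by (simp add: semi_zero[OF f])
  next
    case False
    then have h: "h > 0" using that by simp
    have "semi h f \<eta> - (f \<eta> + h * k \<eta>) = h * ((semi h f \<eta> - f \<eta>) / h - k \<eta>)"
      using h by (simp add: field_simps)
    then have "\<bar>semi h f \<eta> - (f \<eta> + h * k \<eta>)\<bar> = h * \<bar>(semi h f \<eta> - f \<eta>) / h - k \<eta>\<bar>"
      using h by (simp add: abs_mult)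
    also have "\<dots> \<le> h * e"
      using d(2)[OF h that(2), of \<eta>] h unfolding dist_real_def by (intro mult_left_mono) simp_all
    finally show ?thesis .
  qed
  with d(1) show ?thesis by (rule that)
qed

lemma semi_difference_quotient:
  assumes "0 \<le> t" "continuous_on UNIV f" "continuous_on UNIV g"
  shows "semi t (\<lambda>\<eta>. (f \<eta> - g \<eta>) / h) \<eta> = (semi t f \<eta> - semi t g \<eta>) / h"
  unfolding semi_def
  using continuous_config_integrable[OF kernel_prob[OF assms(1)]] assms(2,3) by simp

text \<open>The domain is invariant under the semigroup: \<open>semi s\<close> commutes with the
  difference quotients at 0 and, as a contraction, preserves their uniform convergence.\<close>

lemma generator_semi:
  assumes fk: "(f, k) \<in> semigroup_generator K" and s: "0 \<le> s"
  shows "(semi s f, semi s k) \<in> semigroup_generator K"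
proof -
  have f: "continuous_on UNIV f" and k: "continuous_on UNIV k"
    and lim: "uniform_limit UNIV (\<lambda>t \<eta>. (semi t f \<eta> - f \<eta>) / t) k (at_right 0)"
    using fk unfolding semigroup_generator_def semi_def by blast+
  have "uniform_limit UNIV (\<lambda>t \<eta>. (semi t (semi s f) \<eta> - semi s f \<eta>) / t) (semi s k) (at_right 0)"
  proof (rule uniform_limitI)
    fix e :: real assume "e > 0"
    \<comment> \<open>Contractivity yields only a weak inequality; halving \<open>e\<close> restores
      the strict one.\<close>
    then have "e / 2 > 0" by simp
    from uniform_limitD[OF lim this] eventually_at_right_less[of 0]
    show "\<forall>\<^sub>F t in at_right 0. \<forall>\<eta>\<in>UNIV. dist ((semi t (semi s f) \<eta> - semi s f \<eta>) / t) (semi s k \<eta>) < e"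
    proof eventually_elim
      case (elim t)
      then have t: "0 \<le> t" by simp
      note ct = semi_continuous[OF t f]
      have q: "continuous_on UNIV (\<lambda>\<eta>. (semi t f \<eta> - f \<eta>) / t)"
        using elim(2) by (intro continuous_intros ct f) simp
      have "semi t (semi s f) = semi s (semi t f)"
        using semi_add[OF t s f] semi_add[OF s t f] by (simp add: add.commute)
      then have eq: "(semi t (semi s f) \<eta> - semi s f \<eta>) / t = semi s (\<lambda>\<eta>. (semi t f \<eta> - f \<eta>) / t) \<eta>" for \<eta>
        by (simp add: semi_difference_quotient[OF s ct f])
      have "\<bar>semi s (\<lambda>\<eta>. (semi t f \<eta> - f \<eta>) / t) \<eta> - semi s k \<eta>\<bar> \<le> e / 2" for \<eta>
        using elim(1) unfolding dist_real_def by (intro semi_diff_le[OF s q k]) (simp add: less_imp_le)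
      then have "\<bar>semi s (\<lambda>\<eta>. (semi t f \<eta> - f \<eta>) / t) \<eta> - semi s k \<eta>\<bar> < e" for \<eta>
        by (rule le_less_trans) (use \<open>e > 0\<close> in simp)
      then show ?case
        unfolding eq dist_real_def by blast
    qed
  qed
  then show ?thesis
    unfolding semigroup_generator_def semi_def[symmetric] mem_Collect_eq prod.case
    using semi_continuous[OF s f] semi_continuous[OF s k] by blast
qed

text \<open>The generator commutes with shifts, so the defect of shift invariance at time \<open>s\<close> has
  norm at most \<open>e * s\<close> for every \<open>e > 0\<close>.\<close>

lemma semi_shift_generator:
  assumes gen_shift: "\<And>f k. (f, k) \<in> semigroup_generator K \<Longrightarrow>
      ((\<lambda>\<eta>. f (shift u \<eta>)), (\<lambda>\<eta>. k (shift u \<eta>))) \<in> semigroup_generator K"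
    and fk: "(f, k) \<in> semigroup_generator K" and t: "0 \<le> t"
  shows "semi t f (shift u \<eta>) = semi t (\<lambda>\<eta>. f (shift u \<eta>)) \<eta>"
proof -
  let ?f = "\<lambda>\<eta>. f (shift u \<eta>)"
  have f: "continuous_on UNIV f" using fk unfolding semigroup_generator_def by blast
  have f': "continuous_on UNIV ?f" by (rule continuous_on_compose2[OF f continuous_shift]) simp
  define w where "w = (\<lambda>s \<eta>. semi s f (shift u \<eta>) - semi s ?f \<eta>)"
  have w_le: "\<bar>w t \<eta>\<bar> \<le> e * t" if e: "e > 0" for e \<eta>
  proof -
    have "\<forall>\<eta>. \<bar>w t \<eta>\<bar> \<le> e * t"
      using t
    proof (rule real_continuous_induct)
      show "\<forall>\<eta>. \<bar>w 0 \<eta>\<bar> \<le> e * 0" unfolding w_def by (simp add: semi_zero[OF f] semi_zero[OF f'])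
    next
      fix s :: real assume s: "0 \<le> s" and ws: "\<forall>\<eta>. \<bar>w s \<eta>\<bar> \<le> e * s"
      let ?g = "semi s f" and ?k = "semi s k"
      let ?gu = "\<lambda>\<eta>. ?g (shift u \<eta>)"
      have g: "continuous_on UNIV ?g" by (rule semi_continuous[OF s f])
      have gu: "continuous_on UNIV ?gu" by (rule continuous_on_compose2[OF g continuous_shift]) simp
      have gk: "(?g, ?k) \<in> semigroup_generator K" by (rule generator_semi[OF fk s])
      have e2: "e / 2 > 0" using e by simp
      obtain d\<^sub>1 where d1: "d\<^sub>1 > 0" "\<And>h \<eta>. 0 \<le> h \<Longrightarrow> h < d\<^sub>1 \<Longrightarrow> \<bar>semi h ?g \<eta> - (?g \<eta> + h * ?k \<eta>)\<bar> \<le> h * (e / 2)"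
        using generator_expansion[OF gk e2] by blast
      obtain d\<^sub>2 where d2: "d\<^sub>2 > 0" "\<And>h \<eta>. 0 \<le> h \<Longrightarrow> h < d\<^sub>2 \<Longrightarrow>
          \<bar>semi h ?gu \<eta> - (?gu \<eta> + h * ?k (shift u \<eta>))\<bar> \<le> h * (e / 2)"
        using generator_expansion[OF gen_shift[OF gk] e2] by blast
      \<comment> \<open>Contractivity keeps the defect inherited from time \<open>s\<close> below
        \<open>e * s\<close>. The new error compares two first-order expansions with the same linear
        term, each accurate to \<open>h * (e / 2)\<close>.\<close>
      have "\<bar>w (s + h) \<eta>\<bar> \<le> e * (s + h)" if h: "0 \<le> h" "h < min d\<^sub>1 d\<^sub>2" for h \<eta>
      proof -
        have 1: "semi (s + h) f = semi h ?g" "semi (s + h) ?f = semi h (semi s ?f)"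
          using semi_add[OF h(1) s f] semi_add[OF h(1) s f'] by (simp_all add: add.commute)
        have 2: "\<bar>semi h ?gu \<eta> - semi h (semi s ?f) \<eta>\<bar> \<le> e * s"
          using ws unfolding w_def by (intro semi_diff_le[OF h(1) gu semi_continuous[OF s f']]) blast
        have 3: "\<bar>semi h ?g (shift u \<eta>) - (?g (shift u \<eta>) + h * ?k (shift u \<eta>))\<bar> \<le> h * (e / 2)"
          using h by (intro d1(2)) simp_all
        have 4: "\<bar>semi h ?gu \<eta> - (?g (shift u \<eta>) + h * ?k (shift u \<eta>))\<bar> \<le> h * (e / 2)"
          using h by (intro d2(2)) simp_all
        have "e * (s + h) = e * s + h * (e / 2) + h * (e / 2)" by (simp add: algebra_simps)
        then show ?thesis
          unfolding w_def 1 using 2 3 4 by linarith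
      qed
      then show "\<exists>d>0. \<forall>h. 0 \<le> h \<longrightarrow> h < d \<longrightarrow> (\<forall>\<eta>. \<bar>w (s + h) \<eta>\<bar> \<le> e * (s + h))"
        using d1(1) d2(1) by (intro exI[of _ "min d\<^sub>1 d\<^sub>2"]) simp
    next
      \<comment> \<open>The limit step takes an earlier time so close to \<open>s\<close> that both
        semigroup terms have moved by at most \<open>e' / 2\<close>.\<close>
      fix s :: real assume s: "0 < s" and below: "\<And>r. 0 \<le> r \<Longrightarrow> r < s \<Longrightarrow> \<forall>\<eta>. \<bar>w r \<eta>\<bar> \<le> e * r"
      show "\<forall>\<eta>. \<bar>w s \<eta>\<bar> \<le> e * s"
      proof
        fix \<eta>
        show "\<bar>w s \<eta>\<bar> \<le> e * s"
        proof (rule field_le_epsilon)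
          fix e' :: real assume "e' > 0"
          then have e2: "e' / 2 > 0" by simp
          obtain d\<^sub>1 where d1: "d\<^sub>1 > 0" "\<And>r t \<eta>. 0 \<le> r \<Longrightarrow> r \<le> t \<Longrightarrow> t - r < d\<^sub>1 \<Longrightarrow> \<bar>semi t f \<eta> - semi r f \<eta>\<bar> \<le> e' / 2"
            using semi_time_continuous[OF f e2] by blast
          obtain d\<^sub>2 where d2: "d\<^sub>2 > 0" "\<And>r t \<eta>. 0 \<le> r \<Longrightarrow> r \<le> t \<Longrightarrow> t - r < d\<^sub>2 \<Longrightarrow> \<bar>semi t ?f \<eta> - semi r ?f \<eta>\<bar> \<le> e' / 2"
            using semi_time_continuous[OF f' e2] by blast
          define r where "r = max 0 (s - min d\<^sub>1 d\<^sub>2 / 2)"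
          have r: "0 \<le> r" "r < s" "s - r < d\<^sub>1" "s - r < d\<^sub>2"
            using s d1(1) d2(1) unfolding r_def by auto
          have "\<bar>w r \<eta>\<bar> \<le> e * r" using below[OF r(1,2)] by blast
          also have "\<dots> \<le> e * s" using r(2) e by simp
          finally have "\<bar>w r \<eta>\<bar> \<le> e * s" .
          then show "\<bar>w s \<eta>\<bar> \<le> e * s + e'"
            using d1(2)[OF r(1) less_imp_le[OF r(2)] r(3), of "shift u \<eta>"]
              d2(2)[OF r(1) less_imp_le[OF r(2)] r(4), of \<eta>]
            unfolding w_def by linarith
        qed
      qed
    qed
    then show ?thesis by blast
  qed
  have "\<bar>w t \<eta>\<bar> \<le> 0"
  proof (rule field_le_epsilon)
    fix e :: real assume e: "e > 0"
    \<comment> \<open>Dividing by \<open>t + 1\<close> instead of \<open>t\<close> covers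
      \<open>t = 0\<close>.\<close>
    have "\<bar>w t \<eta>\<bar> \<le> e / (t + 1) * t" using t e by (intro w_le) simp
    also have "\<dots> \<le> e" using t e by (simp add: field_simps)
    finally show "\<bar>w t \<eta>\<bar> \<le> 0 + e" by simp
  qed
  then show ?thesis unfolding w_def by simp
qed

end

text \<open>Translation invariance is assumed for the rates and so is visible first at the
  generator. Indicators of local events lie in its domain, where the covariance passes to the
  semigroup, and they determine the kernel.\<close>

lemma ips_kernel_shift:
  fixes c :: "('d::finite, 's::{finite, discrete_topology}) rates"
  assumes c: "ti_ips_rates c" and ips: "ips_semigroup c K" and t: "0 \<le> t"
  shows "K t (shift u \<sigma>) = distr (K t \<sigma>) borel (shift u)"
proof -
  interpret feller K
    using ips unfolding ips_semigroup_def by (intro feller.intro) blast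
  have gen: "semigroup_generator K = ips_generator c" using ips unfolding ips_semigroup_def by blast
  note kp = kernel_prob[OF t]
  show ?thesis
  proof (rule prob_measures_eqI_local_sets[OF kp distr_shift_prob_measures[OF kp]])
    fix A :: "('d, 's) config set" assume A: "A \<in> local_sets"
    obtain \<Gamma> where \<Gamma>: "finite \<Gamma>" "local_on \<Gamma> (\<lambda>\<omega>. \<omega> \<in> A)" using A by (rule local_setsE)
    have loc: "local_on \<Gamma> (indicator A :: _ \<Rightarrow> real)"
      unfolding indicator_def by (rule local_on_compose2[OF \<Gamma>(2,2), of "\<lambda>p _. of_bool p"])
    have "semi t (indicator A) (shift u \<sigma>) = semi t (\<lambda>\<eta>. indicator A (shift u \<eta>)) \<sigma>"
    proof (rule semi_shift_generator[OF _ _ t])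
      show "(indicator A, ips_pregenerator c (indicator A)) \<in> semigroup_generator K"
        unfolding gen by (rule ips_generator_local[OF \<Gamma>(1) loc])
    qed (unfold gen, rule ips_generator_shift[OF c])
    moreover have "(\<lambda>\<eta>. indicator A (shift u \<eta>) :: real) = indicator (shift u -` A)"
      by (simp add: indicator_def fun_eq_iff)
    ultimately have "measure (K t (shift u \<sigma>)) A = measure (K t \<sigma>) (shift u -` A)"
      unfolding semi_def by (simp only: integral_indicator_config[OF kp])
    moreover have "shift u \<in> K t \<sigma> \<rightarrow>\<^sub>M borel"
      using measurable_shift prob_measuresD(2)[OF kp] measurable_cong_sets by blast
    ultimately show "measure (K t (shift u \<sigma>)) A = measure (distr (K t \<sigma>) borel (shift u)) A"
      using borel_local_sets[OF A] prob_measuresD(3)[OF kp] by (simp add: measure_distr)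
  qed
qed

section \<open>Stationarity at all times and the entropy loss\<close>

lemma (in feller) measure_bind_semi:
  assumes \<nu>: "\<nu> \<in> prob_measures" and t: "0 \<le> t" and A: "A \<in> local_sets"
  shows "measure (\<nu> \<bind> K t) A = (\<integral>\<eta>. semi t (indicator A) \<eta> \<partial>\<nu>)"
  unfolding semi_def integral_indicator_config[OF kernel_prob[OF t]]
  by (rule measure_bind_config[OF \<nu> kernel[OF t] borel_local_sets[OF A]])

lemma (in feller) bind_add:
  assumes \<nu>: "\<nu> \<in> prob_measures" and s: "0 \<le> s" and t: "0 \<le> t"
  shows "\<nu> \<bind> K (s + t) = (\<nu> \<bind> K s) \<bind> K t"
proof -
  have "K (s + t) = (\<lambda>\<eta>. K s \<eta> \<bind> K t)"
  proof
    fix \<eta>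
    show "K (s + t) \<eta> = K s \<eta> \<bind> K t"
      using K s t unfolding feller_semigroup_def by blast
  qed
  then show ?thesis
    by (simp only: bind_assoc[OF kernel_subprob[OF \<nu> kernel[OF s]] measurable_prob_algebraD[OF kernel[OF t]]])
qed

text \<open>Invariance under each step \<open>1 / 2 ^ r\<close> iterates to all dyadic times. These
  are dense, and the probabilities of local events are continuous in time.\<close>

lemma (in feller) stationary_of_dyadic:
  assumes \<nu>: "\<nu> \<in> prob_measures" and dyadic: "\<And>r :: nat. \<nu> \<bind> K (1 / 2 ^ r) = \<nu>" and t: "0 \<le> t"
  shows "\<nu> \<bind> K t = \<nu>"
proof (rule prob_measures_eqI_local_sets[OF prob_measures_bind[OF \<nu> kernel[OF t]] \<nu>])
  have multiple: "\<nu> \<bind> K (real i / 2 ^ r) = \<nu>" for i r :: nat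
  proof (induction i)
    case 0
    have "K 0 = return borel"
      using K unfolding feller_semigroup_def by (simp add: fun_eq_iff)
    then show ?case
      using bind_return''[OF prob_measuresD(2)[OF \<nu>]] by simp
  next
    case (Suc i)
    have "real (Suc i) / 2 ^ r = real i / 2 ^ r + 1 / 2 ^ r" by (simp add: add_divide_distrib)
    then show ?case
      using bind_add[OF \<nu>, of "real i / 2 ^ r" "1 / 2 ^ r"] Suc dyadic[of r] by simp
  qed
  fix A :: "('d, 's) config set" assume A: "A \<in> local_sets"
  note f = continuous_indicator_local[OF A]
  have "\<bar>measure (\<nu> \<bind> K t) A - measure \<nu> A\<bar> \<le> 0"
  proof (rule field_le_epsilon)
    fix e :: real assume e: "e > 0"
    obtain d where d: "d > 0" "\<And>s t \<eta>. 0 \<le> s \<Longrightarrow> s \<le> t \<Longrightarrow> t - s < d \<Longrightarrow>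
        \<bar>semi t (indicator A) \<eta> - semi s (indicator A) \<eta>\<bar> \<le> e"
      using semi_time_continuous[OF f e] by blast
    obtain r where r: "(1 / 2 :: real) ^ r < d" using real_arch_pow_inv[OF d(1), of "1 / 2"] by auto
    \<comment> \<open>Rounding down gives the last grid time not after \<open>t\<close>, at distance
      less than the mesh.\<close>
    define i where "i = nat \<lfloor>t * 2 ^ r\<rfloor>"
    define s where "s = real i / 2 ^ r"
    have i: "real i = of_int \<lfloor>t * 2 ^ r\<rfloor>" using t unfolding i_def by simp
    have "real i \<le> t * 2 ^ r" "t * 2 ^ r < real i + 1" unfolding i
      by (rule of_int_floor_le, rule real_of_int_floor_add_one_gt)
    then have "real i / 2 ^ r \<le> t" "t < (real i + 1) / 2 ^ r"
      by (simp_all add: pos_divide_le_eq pos_less_divide_eq)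
    then have s: "0 \<le> s" "s \<le> t" "t - s < (1 / 2) ^ r"
      unfolding s_def by (simp_all add: add_divide_distrib power_one_over)
    have "\<bar>measure (\<nu> \<bind> K t) A - measure (\<nu> \<bind> K s) A\<bar> \<le> e"
      unfolding measure_bind_semi[OF \<nu> t A] measure_bind_semi[OF \<nu> s(1) A]
      using s r by (intro integral_diff_le[OF \<nu> semi_continuous[OF t f] semi_continuous[OF s(1) f]] d(2)) auto
    then show "\<bar>measure (\<nu> \<bind> K t) A - measure \<nu> A\<bar> \<le> 0 + e"
      unfolding s_def multiple by simp
  qed
  then show "measure (\<nu> \<bind> K t) A = measure \<nu> A" by simp
qed

text \<open>For times \<open>t \<ge> 0\<close>, the only ones seen by the one-sided derivative,
  every local entropy is constant; all derivatives \<open>D n\<close> are 0.\<close>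

lemma stationary_has_entropy_loss:
  assumes "\<And>t. 0 \<le> t \<Longrightarrow> \<nu> \<bind> K t = \<nu>"
  shows "has_entropy_loss K \<nu> \<mu> 0"
  unfolding has_entropy_loss_def
proof (rule exI[of _ "\<lambda>_. 0"], intro conjI always_eventually allI)
  fix n
  show "((\<lambda>t. local_entropy (cube n) (\<nu> \<bind> K t) \<mu>) has_real_derivative 0) (at 0 within {0..})"
    by (rule has_field_derivative_transform_within[OF DERIV_const zero_less_one]) (simp_all add: assms)
qed simp

theorem continuous_gibbs_limit_point:
  fixes \<Phi> :: "('d::finite, 's::{finite, discrete_topology}) potential"
  assumes \<Phi>: "ti_abs_summable_potential \<Phi>"
    and \<nu>\<^sub>0: "\<nu>\<^sub>0 \<in> prob_measures" "translation_invariant \<nu>\<^sub>0"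
    and c: "ti_ips_rates c" and ips: "ips_semigroup c K" and zero: "zero_entropy_loss_continuous \<Phi> K \<mu>"
  shows "\<exists>\<nu>\<in>weak_limit_points (\<lambda>t::real. \<nu>\<^sub>0 \<bind> K t). translation_invariant \<nu> \<and> gibbs_measure \<Phi> \<nu>"
proof -
  interpret feller K
    using ips unfolding ips_semigroup_def by (intro feller.intro) blast
  define X where "X = (\<lambda>t. \<nu>\<^sub>0 \<bind> K t)"
  have X: "X t \<in> prob_measures" "translation_invariant (X t)" if "t \<in> {0..}" for t
  proof -
    have t: "0 \<le> t" using that by simp
    show "X t \<in> prob_measures" unfolding X_def by (rule prob_measures_bind[OF \<nu>\<^sub>0(1) kernel[OF t]])
    show "translation_invariant (X t)"
      unfolding X_def by (rule translation_invariant_bind[OF \<nu>\<^sub>0 kernel[OF t] ips_kernel_shift[OF c ips t]])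
  qed
  \<comment> \<open>The grid of mesh \<open>1 / 2 ^ m\<close> on the interval from 0 to
    \<open>m + 1\<close>: it is refined and lengthened at once, so it eventually resolves every
    dyadic step while boundary terms vanish.\<close>
  define N where "N = (\<lambda>m :: nat. Suc m * 2 ^ m)"
  define S :: "nat \<Rightarrow> real set" where "S = (\<lambda>m. (\<lambda>j. real j / 2 ^ m) ` {..<N m})"
  have avg: "average (S m) a = (\<Sum>j<N m. a (real j / 2 ^ m)) / real (N m)" for m a
    unfolding S_def by (rule average_image_lessThan) (simp add: inj_on_def)
  have N: "N m > 0" "real (N m) = real (Suc m) * 2 ^ m" for m
    by (simp add: N_def) (simp only: N_def of_nat_mult of_nat_power of_nat_numeral)
  have bound: "(\<lambda>m. r / real (Suc m)) \<longlonglongrightarrow> 0" for r :: real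
    using tendsto_mult[OF tendsto_const[of r] LIMSEQ_Suc[OF lim_1_over_n]] by simp
  have sparse: "(\<lambda>m. average (S m) (\<lambda>t. of_bool (t < real k))) \<longlonglongrightarrow> 0" for k :: nat
  proof (rule Lim_null_comparison[OF always_eventually bound[of "real k"]], intro allI)
    fix m
    \<comment> \<open>Of the \<open>Suc m * 2 ^ m\<close> grid times at most
      \<open>k * 2 ^ m\<close> precede \<open>k\<close>, a fraction of at most
      \<open>k / Suc m\<close>.\<close>
    have "real j / 2 ^ m < real k \<longleftrightarrow> j < k * 2 ^ m" for j :: nat
    proof -
      have "real j / 2 ^ m < real k \<longleftrightarrow> real j < real (k * 2 ^ m)" by (simp add: divide_less_eq)
      then show ?thesis by (simp only: of_nat_less_iff)
    qed
    then have "average (S m) (\<lambda>t. of_bool (t < real k)) = (\<Sum>j<N m. of_bool (j < k * 2 ^ m)) / real (N m)"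
      unfolding avg by simp
    also have "\<dots> \<le> real (k * 2 ^ m) / real (N m)"
      by (intro divide_right_mono sum_of_bool_lessThan) simp_all
    also have "\<dots> = real k / real (Suc m)"
      unfolding N(2) by simp
    finally have "average (S m) (\<lambda>t. of_bool (t < real k)) \<le> real k / real (Suc m)" .
    moreover have "0 \<le> average (S m) (\<lambda>t. of_bool (t < real k))"
      unfolding average_def by (intro divide_nonneg_nonneg sum_nonneg) simp_all
    ultimately show "norm (average (S m) (\<lambda>t. of_bool (t < real k))) \<le> real k / real (Suc m)" by simp
  qed
  have "\<exists>F y. averaged_limits X {0..} S real F y"
  proof (rule exists_averaged_limits[OF X])
    show "filterlim real at_top sequentially" by (rule filterlim_real_sequentially)
    show "S m \<noteq> {}" for m using N(1)[of m] unfolding S_def by auto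
    show "S m \<subseteq> {0..}" "finite (S m)" for m unfolding S_def by auto
  qed (use sparse in auto)
  then obtain F y where "averaged_limits X {0..} S real F y" by blast
  then interpret averaged_limits X "{0..}" S real F y .
  have "\<exists>\<nu>\<in>weak_limit_points X. translation_invariant \<nu> \<and> gibbs_measure \<Phi> \<nu>"
  proof (rule exists_gibbs_limit_point[OF \<Phi>])
    fix \<nu> :: "('d, 's) config measure"
    assume \<nu>: "\<nu> \<in> prob_measures" "translation_invariant \<nu>"
      and conv: "\<And>A. A \<in> local_sets \<Longrightarrow> ((\<lambda>m. average (S m) (\<lambda>t. measure (X t) A)) \<longlongrightarrow> measure \<nu> A) F"
    have dyadic: "\<nu> \<bind> K (1 / 2 ^ r) = \<nu>" for r :: nat
    proof (rule stationary_of_averages[OF _ \<nu>(1) kernel _ F conv])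
      show "X t \<in> prob_measures" if "t \<in> S m" for m t using X(1) S(3) that by blast
      show "0 \<le> 1 / (2 :: real) ^ r" by simp
      show "continuous_on UNIV (\<lambda>\<sigma>. \<integral>\<omega>. f \<omega> \<partial>K (1 / 2 ^ r) \<sigma>)" if "continuous_on UNIV f" for f :: "('d, 's) config \<Rightarrow> real"
        using semi_continuous[OF _ that, of "1 / 2 ^ r"] unfolding semi_def by simp
      fix A :: "('d, 's) config set"
      show "(\<lambda>m. average (S m) (\<lambda>t. measure (X t \<bind> K (1 / 2 ^ r)) A) - average (S m) (\<lambda>t. measure (X t) A)) \<longlonglongrightarrow> 0"
      \<comment> \<open>From \<open>m = r\<close> on, the time step \<open>1 / 2 ^ r\<close> is
        exactly \<open>q = 2 ^ (m - r)\<close> steps of the grid, so evolving the law only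
        translates the index.\<close>
      proof (rule Lim_null_comparison[OF eventually_sequentiallyI[of r] bound[of 1]])
        fix m assume m: "r \<le> m"
        define q where "q = (2 :: nat) ^ (m - r)"
        have "(2 :: real) ^ m = 2 ^ (m - r) * 2 ^ r"
          using m by (simp flip: power_add)
        then have q: "1 / 2 ^ r = real q / 2 ^ m"
          unfolding q_def by simp
        let ?b = "\<lambda>j. measure (X (real j / 2 ^ m)) A"
        have b: "0 \<le> ?b j" "?b j \<le> 1" for j
          using prob_space.prob_le_1[OF X_prob_space[of "real j / 2 ^ m"], of A] by simp_all
        have shifted: "X (real j / 2 ^ m) \<bind> K (1 / 2 ^ r) = X (real (j + q) / 2 ^ m)" for j
          using bind_add[OF \<nu>\<^sub>0(1), of "real j / 2 ^ m" "1 / 2 ^ r"]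
          unfolding X_def q of_nat_add add_divide_distrib by simp
        have "\<bar>(\<Sum>j<N m. ?b (j + q)) - (\<Sum>j<N m. ?b j)\<bar> \<le> real q"
          by (rule sum_translate_diff_le[OF b])
        \<comment> \<open>The crude bound suffices: the grid has \<open>Suc m\<close> times as many
          points, which leaves \<open>1 / Suc m\<close>.\<close>
        also have "\<dots> \<le> 2 ^ m"
          unfolding q_def by simp
        finally have "\<bar>(\<Sum>j<N m. ?b (j + q)) - (\<Sum>j<N m. ?b j)\<bar> / real (N m) \<le> 2 ^ m / real (N m)"
          by (rule divide_right_mono) simp
        also have "\<dots> = 1 / real (Suc m)" unfolding N(2) by simp
        finally show "norm (average (S m) (\<lambda>t. measure (X t \<bind> K (1 / 2 ^ r)) A) - average (S m) (\<lambda>t. measure (X t) A))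
            \<le> 1 / real (Suc m)"
          unfolding avg shifted diff_divide_distrib[symmetric] real_norm_def abs_divide abs_of_nat .
      qed
    qed
    have "has_entropy_loss K \<nu> \<mu> 0"
      by (rule stationary_has_entropy_loss) (rule stationary_of_dyadic[OF \<nu>(1) dyadic])
    then show "gibbs_measure \<Phi> \<nu>"
      using zero \<nu> unfolding zero_entropy_loss_continuous_def by blast
  qed
  then show ?thesis unfolding X_def .
qed

theorem theorem2p4:
  fixes \<Phi> :: "('d::finite, 's::{finite, discrete_topology}) potential"
    and \<nu>\<^sub>0 :: "('d, 's) config measure"
  assumes "ti_abs_summable_potential \<Phi>"
    and "\<nu>\<^sub>0 \<in> prob_measures" and "translation_invariant \<nu>\<^sub>0"
  shows "(\<forall>P \<mu>. ti_transition_kernel P \<and> zero_entropy_loss_discrete \<Phi> P \<mu> \<longrightarrow>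
            (\<exists>\<nu> \<in> weak_limit_points (\<lambda>n::nat. ((\<lambda>\<nu>. \<nu> \<bind> P) ^^ n) \<nu>\<^sub>0).
               translation_invariant \<nu> \<and> gibbs_measure \<Phi> \<nu>)) \<and>
         (\<forall>c K \<mu>. ti_ips_rates c \<and> ips_semigroup c K \<and> zero_entropy_loss_continuous \<Phi> K \<mu> \<longrightarrow>
            (\<exists>\<nu> \<in> weak_limit_points (\<lambda>t::real. \<nu>\<^sub>0 \<bind> K t).
               translation_invariant \<nu> \<and> gibbs_measure \<Phi> \<nu>))"
proof (intro conjI allI impI)
  fix P \<mu> assume "ti_transition_kernel P \<and> zero_entropy_loss_discrete \<Phi> P \<mu>"
  then show "\<exists>\<nu> \<in> weak_limit_points (\<lambda>n::nat. ((\<lambda>\<nu>. \<nu> \<bind> P) ^^ n) \<nu>\<^sub>0).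
      translation_invariant \<nu> \<and> gibbs_measure \<Phi> \<nu>"
    using discrete_gibbs_limit_point[OF assms] by blast
next
  fix c K \<mu> assume "ti_ips_rates c \<and> ips_semigroup c K \<and> zero_entropy_loss_continuous \<Phi> K \<mu>"
  then show "\<exists>\<nu> \<in> weak_limit_points (\<lambda>t::real. \<nu>\<^sub>0 \<bind> K t).
      translation_invariant \<nu> \<and> gibbs_measure \<Phi> \<nu>"
    using continuous_gibbs_limit_point[OF assms] by blast
qed

end
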